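(* Let $\mu$ be the standard V-monotone Gaussian measure and $\gamma_0=\dfrac{2}{e^{2\sqrt3\pi/9}-1}$. Let $Q=\{z\in\mathbb{C}:\operatorname{Re}z>0,\ \operatorname{Im}z>0\}$. Then the reciprocal Cauchy--Stieltjes transform $F_\mu$ of $\mu$ satisfies $$F_\mu(z)=z\,T^{-1}\!\left(\frac12\operatorname{Log}\Big(1+\frac{2}{z^2-2}\Big)\right)\qquad\text{for } z\in Q\cup i\cdot(0,\infty)\cup(\sqrt{2+\gamma_0},\infty),$$ and on the remaining part of $\{z:\operatorname{Im} z\ge 0\}\setminus[-\sqrt{2+\gamma_0},\sqrt{2+\gamma_0}]$ it is given by $F_\mu(z)=-\overline{F_\mu(-\overline z)}$ for $\operatorname{Re}z<0$.
   Context: The measure $\mu$. Let $(C_n)_{n\ge0}$ be the Catalan numbers and define polynomials $P_n(s)$, $s\in[0,1]$, by $P_0(s)=1$ and $P_{n+1}(s)=\sum_{m=0}^{n}\Big(\int_0^s P_m(t)\,dt+2^{-m}C_m(1-s)^{m+1}\Big)P_{n-m}(s)$ for $n\ge0$. Put $m_n=P_{n/2}(1)$ if $n$ is even and $m_n=0$ if $n$ is odd. It is known that $|P_n(s)|\le C_n$ and that $(m_n)_{n\ge0}$ is the moment sequence of a (unique, compactly supported) probability measure $\mu$ on $\mathbb{R}$, called the standard V-monotone Gaussian measure. Its Cauchy--Stieltjes transform is $G_\mu(z)=\int_{\mathbb{R}}\frac{\mu(dt)}{z-t}$ for $z\in\mathbb{C}\setminus\operatorname{supp}\mu$, and its reciprocal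 Cauchy--Stieltjes transform is $F_\mu=1/G_\mu$. $\operatorname{Log}$ is the principal logarithm: $\operatorname{Log}(re^{i\varphi})=\ln r+i\varphi$ for $r>0$, $-\pi<\varphi\le\pi$. The function $T^{-1}$. Let $u_0=\frac{1+\sqrt3 i}{2}$. For $\eta,\xi\in\mathbb{R}$ with $\xi<-\eta$ put $R=e^{-\sqrt3(\eta+\xi)}>1$ and $g(\eta,\xi)=\frac{\sqrt3 i(Re^{i\xi}-1)}{1-R^2}+u_0$. Let $\Gamma_\eta=\{g(\eta,\xi):\xi<-\eta\}$ and $\Delta=\bigcup_{-\pi<\eta<0}\Gamma_\eta$; $\Delta$ is a simply connected domain in $\mathbb{C}$ whose closure $\operatorname{Cl}\Delta$ contains $[0,\infty)$. Let $T_0:[0,\infty)\to\mathbb{R}$, $T_0(s)=\int_s^1\frac{t}{t^2-t+1}\,dt$. Let $T:\operatorname{Cl}\Delta\setminus\{u_0\}\to\mathbb{C}$ be the unique continuous extension of $T_0$ that is analytic on $\Delta$. The function $T$ is a bijection from $\operatorname{Cl}\Delta\setminus\{u_0\}$ onto the strip $D=\{w\in\mathbb{C}:-\pi/2\le\operatorname{Im}w\le0\}$, and $T^{-1}:D\to\operatorname{Cl}\Delta\setminus\{u_0\}$ denotes its inverse. *)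

theory Defs
  imports "HOL-Probability.Probability"
begin

definition catalan_number :: "nat \<Rightarrow> real" where
  "catalan_number n = real ((2 * n) choose n) / real (n + 1)"

(* Only the values for s in [0,1] are meaningful. *)
fun V_poly :: "nat \<Rightarrow> real \<Rightarrow> real" where
  "V_poly 0 = (\<lambda>s. 1)"
| "V_poly (Suc n) = (\<lambda>s. \<Sum>m\<in>{0..n}.
     (integral {0..s} (V_poly m) + (1 / 2) ^ m * catalan_number m * (1 - s) ^ (m + 1))
       * V_poly (n - m) s)"

definition V_moment :: "nat \<Rightarrow> real" where
  "V_moment n = (if even n then V_poly (n div 2) 1 else 0)"

(* The moment sequence determines the measure, so this predicate singles out one measure;
   compactness of its support is a consequence of the moment condition. *)
definition standard_V_monotone_gaussian :: "real measure \<Rightarrow> bool" where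
  "standard_V_monotone_gaussian M \<longleftrightarrow>
     real_distribution M \<and>
     (\<forall>n. integrable M (\<lambda>t. t ^ n) \<and> (LINT t|M. t ^ n) = V_moment n)"

definition measure_supp :: "real measure \<Rightarrow> real set" where
  "measure_supp M = {x. \<forall>U. open U \<and> x \<in> U \<longrightarrow> emeasure M U > 0}"

definition cauchy_stieltjes :: "real measure \<Rightarrow> complex \<Rightarrow> complex" where
  "cauchy_stieltjes M z = (LINT t|M. 1 / (z - complex_of_real t))"

definition recip_cauchy_stieltjes :: "real measure \<Rightarrow> complex \<Rightarrow> complex" where
  "recip_cauchy_stieltjes M z = 1 / cauchy_stieltjes M z"

definition u0 :: complex where
  "u0 = (1 + of_real (sqrt 3) * \<i>) / 2"

definition g_curve :: "real \<Rightarrow> real \<Rightarrow> complex" where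
  "g_curve \<eta> \<xi> =
     (let R = complex_of_real (exp (- sqrt 3 * (\<eta> + \<xi>)))
      in of_real (sqrt 3) * \<i> * (R * exp (\<i> * of_real \<xi>) - 1) / (1 - R\<^sup>2) + u0)"

definition Gamma_curve :: "real \<Rightarrow> complex set" where
  "Gamma_curve \<eta> = {g_curve \<eta> \<xi> | \<xi>. \<xi> < - \<eta>}"

definition Delta_domain :: "complex set" where
  "Delta_domain = (\<Union>\<eta>\<in>{- pi<..<0}. Gamma_curve \<eta>)"

(* The interval integral is oriented, as needed for s > 1. *)
definition T0_fun :: "real \<Rightarrow> real" where
  "T0_fun s = (LBINT t=ereal s..ereal 1. t / (t\<^sup>2 - t + 1))"

definition T_domain :: "complex set" where
  "T_domain = closure Delta_domain - {u0}"

(* Determines T uniquely on T_domain; the values of T elsewhere are irrelevant. *)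
definition is_T_extension :: "(complex \<Rightarrow> complex) \<Rightarrow> bool" where
  "is_T_extension T \<longleftrightarrow>
     continuous_on T_domain T \<and>
     T analytic_on Delta_domain \<and>
     (\<forall>s\<ge>0. T (complex_of_real s) = complex_of_real (T0_fun s))"

definition T_strip :: "complex set" where
  "T_strip = {w. - pi / 2 \<le> Im w \<and> Im w \<le> 0}"

definition T_inverse :: "(complex \<Rightarrow> complex) \<Rightarrow> complex \<Rightarrow> complex" where
  "T_inverse T = the_inv_into T_domain T"

definition gamma0 :: real where
  "gamma0 = 2 / (exp (2 * sqrt 3 * pi / 9) - 1)"

definition Q_quadrant :: "complex set" where
  "Q_quadrant = {z. Re z > 0 \<and> Im z > 0}"

end

theory Submission
  imports Defs "HOL-Complex_Analysis.Complex_Analysis"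
begin

text \<open>For fixed \<open>x\<close> let \<open>A(s) = \<Sum>n. P\<^sub>n(s) x\<^sup>n\<close> and \<open>v(s) = sqrt (1 - 2 x (1 - s))\<close>. Summing the Catalan series
  turns the recursion into \<open>1 / A(s) = v(s) - x \<integral>\<^sub>0\<^sup>s A\<close>, and the substitution \<open>p = 1 / (A v)\<close> separates the variables:
  \<open>T\<^sub>0(p(s)) - ln v(s)\<close> is constant. At \<open>s = 1\<close> this reads \<open>T\<^sub>0(1 / A(1)) = - ln (1 - 2 x) / 2\<close>, which is the
  claim near infinity, since \<open>F(z) = z / A(1)\<close> for \<open>x = 1 / z\<^sup>2\<close>. Conversely the solution of the differential
  equation exists for all positive \<open>x < 1 / (2 + \<gamma>\<^sub>0)\<close> and dominates the partial sums of the nonnegative terms,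
  so the series converges there and \<open>\<mu>\<close> is supported in \<open>[- sqrt (2 + \<gamma>\<^sub>0), sqrt (2 + \<gamma>\<^sub>0)]\<close>.

  The function \<open>T\<close> becomes explicit in the coordinate \<open>d\<close> with \<open>exp d = (u - cnj u\<^sub>0) / (u - u\<^sub>0)\<close>: there
  it has derivative \<open>- \<i> u / sqrt 3\<close>, whose real part is positive on the half-plane \<open>Re d > 0\<close>. Hence \<open>T\<close> is
  injective and maps \<open>\<Delta>\<close> onto the open strip, and the identity extends from a neighbourhood of infinity to the
  quadrant by analytic continuation and to its boundary by continuity.\<close>

section \<open>The generating function of the moments on the real axis\<close>

text \<open>The coordinate \<open>d\<close> comes from the partial fractions of
  \<open>t / (t\<^sup>2 - t + 1)\<close>. The poles are \<open>u0\<close> and \<open>cnj u0\<close>,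
  both residues are non-real, and \<open>Delta_domain\<close> spirals around \<open>u0\<close>, so
  no principal branch in u covers it. In \<open>d\<close> the winding becomes a translation and only
  one logarithm is left; its argument \<open>1 - exp (- d)\<close> stays in the right half-plane, so
  the principal \<open>Ln\<close> suffices.

  The constant \<open>gamma0\<close> marks where the differential equation breaks down: p falls from
  1 towards 0 as the time ln (v(s) / v(0)) grows towards \<open>T0_fun 0\<close>, and the total time
  - ln (1 - 2 x) / 2 stays below this value exactly for x < 1 / (2 + \<open>gamma0\<close>).

  A further obstacle is that T is given only through continuity, analyticity and its values on [0,
  \<infinity>). It has to be recognised as the explicit function by a gluing argument at u = 1, and
  injectivity is needed on the whole of \<open>T_domain\<close>, boundary included, because the
  inverse in the statement refers to that set.\<close>

lemma catalan_number_Suc: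
  "catalan_number (Suc n) = catalan_number n * (4 * real n + 2) / (real n + 2)"
proof -
  have a: "real ((2 * m) choose m) = fact (2 * m) / (fact m * fact m)" for m
    by (simp add: binomial_fact mult_2)
  have "fact (2 * Suc n) = (2 * real n + 2) * (2 * real n + 1) * fact (2 * n)"
    by (simp add: algebra_simps)
  then have "real ((2 * Suc n) choose Suc n)
      = (2 * real n + 2) * (2 * real n + 1) * fact (2 * n) / ((real n + 1) * fact n * ((real n + 1) * fact n))"
    by (simp only: a) (simp add: algebra_simps)
  also have "\<dots> = (4 * real n + 2) / (real n + 1) * real ((2 * n) choose n)"
    unfolding a by (simp add: divide_simps) (simp add: algebra_simps)
  finally show ?thesis
    unfolding catalan_number_def by (simp only:) (simp add: field_simps)
qed

lemma catalan_number_nonneg: "catalan_number n \<ge> 0"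
  by (simp add: catalan_number_def)

text \<open>Both sides are multiplied by (4 n + 2) / (n + 2) when n grows by one. Up to the factor
  -2, an index shift and the constant term, the binomial series of sqrt (1 - 4 y) is therefore the
  Catalan series.\<close>

lemma gbinomial_half_eq_catalan:
  "((1 / 2) gchoose Suc n) * (- 4) ^ Suc n = - 2 * catalan_number n"
proof (induction n)
  case 0
  show ?case by (simp add: catalan_number_def)
next
  case (Suc n)
  have "(1 / 2 :: real) gchoose Suc (Suc n) = ((1 / 2) gchoose Suc n) * (1 / 2 - real (Suc n)) / real (Suc (Suc n))"
    using gbinomial_absorb_comp[of "1 / 2 :: real" "Suc n"]
      gbinomial_absorption[of "Suc n" "1 / 2 :: real"] by (simp add: field_simps)
  then have "((1 / 2) gchoose Suc (Suc n)) * (- 4) ^ Suc (Suc n)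
      = (((1 / 2) gchoose Suc n) * (- 4) ^ Suc n) * ((4 * real n + 2) / (real n + 2))"
    by (simp only:) (simp add: field_simps)
  then show ?case unfolding Suc.IH catalan_number_Suc by (simp add: field_simps)
qed

lemma catalan_sums:
  assumes "\<bar>y\<bar> < 1 / 4"
  shows "(\<lambda>n. catalan_number n * y ^ Suc n) sums ((1 - sqrt (1 - 4 * y)) / 2)"
proof -
  have "(\<lambda>n. ((1 / 2) gchoose n) * (- 4 * y) ^ n) sums (1 + (- 4 * y)) powr (1 / 2)"
    using assms by (intro gen_binomial_real) auto
  also have "(1 + (- 4 * y)) powr (1 / 2) = sqrt (1 - 4 * y)"
    using assms by (simp add: powr_half_sqrt)
  finally have "(\<lambda>n. ((1 / 2) gchoose Suc n) * (- 4 * y) ^ Suc n) sums (sqrt (1 - 4 * y) - 1)"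
    by (subst sums_Suc_iff) simp
  then have "(\<lambda>n. (- 1 / 2) * (((1 / 2) gchoose Suc n) * (- 4 * y) ^ Suc n))
      sums ((- 1 / 2) * (sqrt (1 - 4 * y) - 1))"
    by (rule sums_mult)
  moreover have "(- 1 / 2) * (((1 / 2) gchoose Suc n) * (- 4 * y) ^ Suc n) = catalan_number n * y ^ Suc n" for n
    using gbinomial_half_eq_catalan[of n] by (simp only: power_mult_distrib) (simp add: algebra_simps)
  moreover have "(- 1 / 2) * (sqrt (1 - 4 * y) - 1) = (1 - sqrt (1 - 4 * y)) / 2"
    by (simp add: field_simps)
  ultimately show ?thesis by (simp only:)
qed

text \<open>This is \<open>catalan_sums\<close> at y = x (1 - s) / 2, scaled by 2 / x; x < 1 / 2
  keeps y below 1 / 4. The limit is (1 - v(s)) / x, the contribution of the explicit term of the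
  recursion.\<close>

lemma catalan_half_sums:
  assumes "0 < x" "x < 1 / 2" "0 \<le> s" "s \<le> 1"
  shows "(\<lambda>m. (1 / 2) ^ m * catalan_number m * (1 - s) ^ (m + 1) * x ^ m)
    sums ((1 - sqrt (1 - 2 * x * (1 - s))) / x)"
proof -
  have "x * (1 - s) \<le> x" "0 \<le> x * (1 - s)" using assms by (simp_all add: mult_left_le)
  then have "\<bar>x * (1 - s) / 2\<bar> < 1 / 4" using assms unfolding abs_less_iff by linarith
  from sums_mult[OF catalan_sums[OF this], of "2 / x"]
  have "(\<lambda>m. 2 / x * (catalan_number m * (x * (1 - s) / 2) ^ Suc m))
      sums (2 / x * ((1 - sqrt (1 - 4 * (x * (1 - s) / 2))) / 2))" .
  moreover have "2 / x * (c * (x * w / 2) ^ Suc m) = (1 / 2) ^ m * c * w ^ (m + 1) * x ^ m" for m c w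
    using assms by (simp add: power_mult_distrib power_divide field_simps)
  moreover have "2 / x * (a / 2) = a / x" and "4 * (b / 2) = 2 * b" for a b :: real by simp_all
  ultimately show ?thesis by (simp only: mult.assoc)
qed

section \<open>The real function \<open>T0_fun\<close> and its inverse\<close>

lemma quadratic_pos: "(t::real)\<^sup>2 - t + 1 > 0"
proof -
  have "t\<^sup>2 - t + 1 = (t - 1 / 2)\<^sup>2 + 3 / 4" by (simp add: power2_eq_square algebra_simps)
  then show ?thesis using zero_le_power2[of "t - 1/2"] by linarith
qed

text \<open>The numerator splits as t = (2 t - 1) / 2 + 1 / 2: the first part gives the logarithm,
  the second, after completing the square, the arc tangent.\<close>

lemma has_real_derivative_T0_antiderivative:
  "((\<lambda>t. ln (t\<^sup>2 - t + 1) / 2 + arctan ((2 * t - 1) / sqrt 3) / sqrt 3)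
     has_real_derivative t / (t\<^sup>2 - t + 1)) (at t within A)"
proof -
  have q: "t\<^sup>2 - t + 1 > 0" by (rule quadratic_pos)
  have a: "1 + ((2 * t - 1) / sqrt 3)\<^sup>2 = 4 / 3 * (t\<^sup>2 - t + 1)"
    by (simp add: power_divide) (simp add: power2_eq_square algebra_simps)
  have "((\<lambda>t. t\<^sup>2 - t + 1) has_real_derivative 2 * t - 1) (at t within A)"
    by (auto intro!: derivative_eq_intros)
  from DERIV_cdivide[OF DERIV_chain2[OF DERIV_ln[OF q] this], of 2]
  have 1: "((\<lambda>t. ln (t\<^sup>2 - t + 1) / 2) has_real_derivative
      inverse (t\<^sup>2 - t + 1) * (2 * t - 1) / 2) (at t within A)" .
  have "((\<lambda>t. 2 * t - 1 :: real) has_real_derivative 2) (at t within A)"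
    by (auto intro!: derivative_eq_intros)
  from DERIV_cdivide[OF DERIV_chain2[OF DERIV_arctan DERIV_cdivide[OF this, of "sqrt 3"]], of "sqrt 3"]
  have 2: "((\<lambda>t. arctan ((2 * t - 1) / sqrt 3) / sqrt 3) has_real_derivative
      inverse (1 + ((2 * t - 1) / sqrt 3)\<^sup>2) * (2 / sqrt 3) / sqrt 3) (at t within A)" .
  have r: "x * (2 / sqrt 3) / sqrt 3 = x * (2 / 3)" for x by simp
  have "inverse (1 + ((2 * t - 1) / sqrt 3)\<^sup>2) * (2 / sqrt 3) / sqrt 3 = 1 / (2 * (t\<^sup>2 - t + 1))"
    unfolding a r using q by (simp add: field_simps)
  moreover have "inverse p * (2 * t - 1) / 2 + 1 / (2 * p) = t / p" if "p > 0" for p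
    using that by (simp add: field_simps)
  from this[OF q] have "inverse (t\<^sup>2 - t + 1) * (2 * t - 1) / 2 + 1 / (2 * (t\<^sup>2 - t + 1)) = t / (t\<^sup>2 - t + 1)" .
  ultimately show ?thesis using DERIV_add[OF 1 2] by (simp only:)
qed

lemma T0_fun_eq:
  "T0_fun s = pi / (6 * sqrt 3) - (ln (s\<^sup>2 - s + 1) / 2 + arctan ((2 * s - 1) / sqrt 3) / sqrt 3)"
proof -
  define K where "K t = ln (t\<^sup>2 - t + 1) / 2 + arctan ((2 * t - 1) / sqrt 3) / sqrt 3" for t :: real
  have K: "(K has_real_derivative t / (t\<^sup>2 - t + 1)) (at t)" for t
    unfolding K_def by (rule has_real_derivative_T0_antiderivative)
  have ne: "t\<^sup>2 - t + 1 \<noteq> 0" for t :: real using quadratic_pos[of t] by simp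
  have "continuous_on A (\<lambda>t::real. t / (t\<^sup>2 - t + 1))" for A
    using ne by (intro continuous_on_divide continuous_intros) simp
  then have "T0_fun s = K 1 - K s" unfolding T0_fun_def
    by (rule interval_integral_FTC_finite)
      (use K in \<open>simp add: has_real_derivative_iff_has_vector_derivative has_vector_derivative_at_within\<close>)
  also have "K 1 = pi / (6 * sqrt 3)"
  proof -
    have "arctan (1 / sqrt 3) = pi / 6" using tan_30 by (intro arctan_unique) auto
    then have "arctan (1 / sqrt 3) / sqrt 3 = pi / (6 * sqrt 3)" by (simp only: divide_divide_eq_left)
    then show ?thesis by (simp only: K_def) simp
  qed
  finally show ?thesis by (simp add: K_def)
qed

lemma has_real_derivative_T0_fun:
  "(T0_fun has_real_derivative - (t / (t\<^sup>2 - t + 1))) (at t within A)"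
proof -
  have "T0_fun = (\<lambda>s. pi / (6 * sqrt 3) - (ln (s\<^sup>2 - s + 1) / 2 + arctan ((2 * s - 1) / sqrt 3) / sqrt 3))"
    by (rule ext) (rule T0_fun_eq)
  moreover have "((\<lambda>s. pi / (6 * sqrt 3) - (ln (s\<^sup>2 - s + 1) / 2 + arctan ((2 * s - 1) / sqrt 3) / sqrt 3))
      has_real_derivative 0 - t / (t\<^sup>2 - t + 1)) (at t within A)"
    by (rule DERIV_diff[OF DERIV_const has_real_derivative_T0_antiderivative])
  ultimately show ?thesis by simp
qed

text \<open>The origin of \<open>gamma0\<close>: its exponent is twice this value.\<close>

lemma T0_fun_0: "T0_fun 0 = sqrt 3 * pi / 9"
proof -
  have "arctan (1 / sqrt 3) = pi / 6" using tan_30 by (intro arctan_unique) auto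
  then have a: "arctan ((2 * 0 - 1) / sqrt 3) = - (pi / 6)" using arctan_minus[of "1 / sqrt 3"] by simp
  have "T0_fun 0 = pi / (6 * sqrt 3) + pi / 6 / sqrt 3"
    unfolding T0_fun_eq a by (simp only: minus_divide_left[symmetric]) simp
  also have "\<dots> = (pi / 3) * (1 / sqrt 3)" by simp
  also have "1 / sqrt 3 = sqrt 3 / 3" by (simp add: real_div_sqrt flip: divide_eq_eq)
  finally show ?thesis by simp
qed

lemma T0_fun_1: "T0_fun 1 = 0"
  by (simp add: T0_fun_def zero_ereal_def)

lemma isCont_T0_fun: "isCont T0_fun t"
  using has_real_derivative_T0_fun by (rule DERIV_isCont)

lemma T0_fun_strict_decreasing:
  assumes "0 \<le> a" "a < b"
  shows "T0_fun b < T0_fun a"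
proof (rule DERIV_neg_imp_decreasing_open[OF assms(2)])
  fix t assume "a < t" "t < b"
  then have "t / (t\<^sup>2 - t + 1) > 0" using assms quadratic_pos[of t] by simp
  then show "\<exists>y. DERIV T0_fun t :> y \<and> y < 0"
    using has_real_derivative_T0_fun[of t UNIV] by (intro exI[of _ "- (t / (t\<^sup>2 - t + 1))"]) auto
qed (use isCont_T0_fun continuous_at_imp_continuous_on in blast)

lemma T0_fun_inj_on: "inj_on T0_fun {0..}"
  using T0_fun_strict_decreasing by (intro linorder_inj_onI') (force simp: less_imp_neq)+

text \<open>Inverting \<open>T0_fun\<close> solves the autonomous equation that remains after
  separating the variables. The solution ends at time \<open>T0_fun 0\<close>, where it reaches 0
  and its slope becomes infinite.\<close>

lemma T0_fun_inverse:
  obtains g where "g 0 = 1"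
    "\<And>\<tau>. 0 \<le> \<tau> \<Longrightarrow> \<tau> < T0_fun 0 \<Longrightarrow> g \<tau> > 0"
    "\<And>\<tau>. 0 \<le> \<tau> \<Longrightarrow> \<tau> < T0_fun 0 \<Longrightarrow>
       (g has_real_derivative - (((g \<tau>)\<^sup>2 - g \<tau> + 1) / g \<tau>)) (at \<tau>)"
proof -
  define g where "g = the_inv_into {0..} T0_fun"
  have left: "g (T0_fun t) = t" if "t \<ge> 0" for t
    unfolding g_def using that by (simp add: the_inv_into_f_f[OF T0_fun_inj_on])
  \<comment> \<open>The endpoint 2 could be any number above 1. It makes \<tau> = 0 an interior
    point of the range, as the two-sided derivative there requires.\<close>
  have ex: "\<exists>p. 0 < p \<and> p < 2 \<and> T0_fun p = \<tau>" if "T0_fun 2 < \<tau>" "\<tau> < T0_fun 0" for \<tau>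
  proof -
    have "\<exists>p\<ge>0. p \<le> 2 \<and> T0_fun p = \<tau>"
      by (rule IVT2) (use that isCont_T0_fun in auto)
    then obtain p where p: "0 \<le> p" "p \<le> 2" "T0_fun p = \<tau>" by blast
    with that show ?thesis by (intro exI[of _ p]) (auto simp: less_le)
  qed
  have neg: "T0_fun 2 < 0" using T0_fun_strict_decreasing[of 1 2] by (simp add: T0_fun_1)
  show thesis
  proof
    show "g 0 = 1" using left[of 1] by (simp add: T0_fun_1)
    fix \<tau> assume \<tau>: "0 \<le> \<tau>" "\<tau> < T0_fun 0"
    then have "T0_fun 2 < \<tau>" using neg by linarith
    then obtain p where p: "0 < p" "p < 2" "T0_fun p = \<tau>" using ex \<tau>(2) by blast
    then have gp: "g \<tau> = p" using left[of p] by simp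
    show "g \<tau> > 0" using gp p by simp
    have "isCont g (T0_fun p)"
      by (rule isCont_inverse_function2[where a = "p / 2" and b = 2])
        (use p left isCont_T0_fun in auto)
    then have c: "isCont g \<tau>" using p by simp
    have "DERIV g \<tau> :> inverse (- (p / (p\<^sup>2 - p + 1)))"
    proof (rule DERIV_inverse_function[where f = T0_fun and a = "T0_fun 2" and b = "T0_fun 0"])
      show "DERIV T0_fun (g \<tau>) :> - (p / (p\<^sup>2 - p + 1))"
        unfolding gp by (rule has_real_derivative_T0_fun)
      show "- (p / (p\<^sup>2 - p + 1)) \<noteq> 0" using p quadratic_pos[of p] by simp
      show "T0_fun (g y) = y" if "T0_fun 2 < y" "y < T0_fun 0" for y
        using ex[OF that] left less_imp_le by metis
    qed (use \<tau> neg c in auto)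
    then show "(g has_real_derivative - (((g \<tau>)\<^sup>2 - g \<tau> + 1) / g \<tau>)) (at \<tau>)"
      by (simp add: gp)
  qed
qed

section \<open>The polynomials \<open>V_poly\<close> and their generating function\<close>

lemma V_poly_Suc:
  "V_poly (Suc n) s = (\<Sum>m\<le>n.
     (integral {0..s} (V_poly m) + (1 / 2) ^ m * catalan_number m * (1 - s) ^ (m + 1)) * V_poly (n - m) s)"
  by (simp add: atLeast0AtMost)

lemma V_poly_continuous: "continuous_on {0..1} (V_poly n)"
proof (induction n rule: less_induct)
  case (less n)
  show ?case
  proof (cases n)
    case (Suc k)
    have "continuous_on {0..1} (\<lambda>s. integral {0..s} (V_poly m))" if "m \<le> k" for m
      using less.IH[of m] Suc that
      by (intro indefinite_integral_continuous_1 integrable_continuous_interval) auto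
    moreover have "continuous_on {0..1} (V_poly m)" if "m \<le> k" for m
      using less.IH[of m] Suc that by auto
    ultimately show ?thesis unfolding Suc V_poly_Suc[abs_def]
      by (intro continuous_on_sum continuous_on_mult continuous_on_add) (auto intro!: continuous_intros)
  qed simp
qed

lemma V_poly_integrable:
  assumes "0 \<le> s" "s \<le> 1"
  shows "V_poly n integrable_on {0..s}"
  by (rule integrable_continuous_interval, rule continuous_on_subset[OF V_poly_continuous])
    (use assms in auto)

lemma V_poly_nonneg:
  assumes "0 \<le> s" "s \<le> 1"
  shows "V_poly n s \<ge> 0"
  using assms
proof (induction n arbitrary: s rule: less_induct)
  case (less n)
  show ?case
  proof (cases n)
    case (Suc k)
    have "integral {0..s} (V_poly m) \<ge> 0" if "m \<le> k" for m
      using less Suc that by (intro integral_nonneg V_poly_integrable) auto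
    then show ?thesis unfolding Suc V_poly_Suc
      using less Suc by (intro sum_nonneg mult_nonneg_nonneg add_nonneg_nonneg)
        (auto simp: catalan_number_nonneg)
  qed simp
qed

text \<open>The pairs with i + j < N form a triangle inside the square of side N, and the added
  products are nonnegative.\<close>

lemma sum_convolution_le:
  fixes a b :: "nat \<Rightarrow> real"
  assumes "\<And>n. a n \<ge> 0" "\<And>n. b n \<ge> 0"
  shows "(\<Sum>n<N. \<Sum>m\<le>n. a m * b (n - m)) \<le> (\<Sum>m<N. a m) * (\<Sum>k<N. b k)"
proof -
  have "(\<Sum>n<N. \<Sum>m\<le>n. a m * b (n - m)) = (\<Sum>(i, j)\<in>{(i, j). i + j < N}. a i * b j)"
    by (rule sum.triangle_reindex[symmetric])
  also have "\<dots> \<le> (\<Sum>(i, j)\<in>{..<N} \<times> {..<N}. a i * b j)"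
    using assms by (intro sum_mono2) auto
  also have "\<dots> = (\<Sum>m<N. a m) * (\<Sum>k<N. b k)"
    by (simp add: sum_product sum.cartesian_product)
  finally show ?thesis .
qed

text \<open>The recursion is monotone on nonnegative data: putting a partial sum into the right-hand
  side of the integral equation gives at least the next partial sum, while A reproduces itself. So a
  nonnegative solution dominates all partial sums before any convergence is known.\<close>

lemma V_poly_partial_sum_le:
  assumes x: "0 < x" "x < 1 / 2"
    and cont: "continuous_on {0..1} A"
    and pos: "\<And>s. s \<in> {0..1} \<Longrightarrow> A s \<ge> 0"
    and eq: "\<And>s. s \<in> {0..1} \<Longrightarrow>
      A s = 1 + (x * integral {0..s} A + (1 - sqrt (1 - 2 * x * (1 - s)))) * A s"
    and s: "s \<in> {0..1}"
  shows "(\<Sum>n<N. V_poly n s * x ^ n) \<le> A s"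
  using s
proof (induction N arbitrary: s)
  case 0
  then show ?case using pos by simp
next
  case (Suc N)
  define a where
    "a m = (integral {0..s} (V_poly m) + (1 / 2) ^ m * catalan_number m * (1 - s) ^ (m + 1)) * x ^ m" for m
  define b where "b m = V_poly m s * x ^ m" for m
  have s: "0 \<le> s" "s \<le> 1" using Suc.prems by auto
  have a0: "a m \<ge> 0" for m
    unfolding a_def using s x V_poly_nonneg
    by (intro mult_nonneg_nonneg add_nonneg_nonneg integral_nonneg V_poly_integrable)
      (auto simp: catalan_number_nonneg)
  have b0: "b m \<ge> 0" for m unfolding b_def using s x V_poly_nonneg by auto
  have int: "(\<lambda>t. \<Sum>n<N. V_poly n t * x ^ n) integrable_on {0..s}"
    using s by (intro integrable_sum integrable_on_mult_left V_poly_integrable) auto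
  have "(\<Sum>n<N. integral {0..s} (V_poly n) * x ^ n) = integral {0..s} (\<lambda>t. \<Sum>n<N. V_poly n t * x ^ n)"
    using s by (subst integral_sum) (auto intro!: integrable_on_mult_left V_poly_integrable)
  also have "\<dots> \<le> integral {0..s} A"
  proof (rule integral_le[OF int])
    show "A integrable_on {0..s}"
      by (rule integrable_continuous_interval, rule continuous_on_subset[OF cont]) (use s in auto)
    show "(\<Sum>n<N. V_poly n t * x ^ n) \<le> A t" if "t \<in> {0..s}" for t
      using Suc.IH[of t] that s by auto
  qed
  moreover have "(\<Sum>n<N. (1 / 2) ^ n * catalan_number n * (1 - s) ^ (n + 1) * x ^ n)
      \<le> (1 - sqrt (1 - 2 * x * (1 - s))) / x"
    by (rule sum_le_suminf[OF sums_summable, THEN order_trans, OF catalan_half_sums])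
      (use x s catalan_half_sums[OF x s] in \<open>auto simp: catalan_number_nonneg sums_iff\<close>)
  ultimately have *: "(\<Sum>m<N. a m) \<le> integral {0..s} A + (1 - sqrt (1 - 2 * x * (1 - s))) / x"
    by (simp add: a_def distrib_right sum.distrib)
  have V: "V_poly (Suc n) s * x ^ Suc n = x * (\<Sum>m\<le>n. a m * b (n - m))" for n
    unfolding V_poly_Suc sum_distrib_left sum_distrib_right
  proof (rule sum.cong[OF refl])
    fix m assume "m \<in> {..n}"
    then have "x ^ n = x ^ m * x ^ (n - m)" by (simp flip: power_add)
    then show "(integral {0..s} (V_poly m) + (1 / 2) ^ m * catalan_number m * (1 - s) ^ (m + 1)) *
        V_poly (n - m) s * x ^ Suc n = x * (a m * b (n - m))"
      by (simp add: a_def b_def)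
  qed
  have "(\<Sum>n<Suc N. V_poly n s * x ^ n) = 1 + x * (\<Sum>n<N. \<Sum>m\<le>n. a m * b (n - m))"
    unfolding sum.lessThan_Suc_shift V by (simp add: sum_distrib_left)
  also have "(\<Sum>n<N. \<Sum>m\<le>n. a m * b (n - m)) \<le> (\<Sum>m<N. a m) * (\<Sum>k<N. b k)"
    by (rule sum_convolution_le[OF a0 b0])
  also have "\<dots> \<le> (integral {0..s} A + (1 - sqrt (1 - 2 * x * (1 - s))) / x) * A s"
    using * Suc.IH[OF Suc.prems] pos[OF Suc.prems] a0 b0
    by (intro mult_mono sum_nonneg order_trans[OF sum_nonneg *]) (auto simp: b_def)
  also have "1 + x * ((integral {0..s} A + (1 - sqrt (1 - 2 * x * (1 - s))) / x) * A s) = A s"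
  proof -
    have "1 + x * ((I + r / x) * w) = 1 + (x * I + r) * w" for I r w
      using x by (simp add: field_simps)
    then show ?thesis using eq[OF Suc.prems] by (simp only:)
  qed
  finally show ?case using x by simp
qed

lemma has_real_derivative_sqrt_affine:
  assumes "1 - 2 * x * (1 - s) > 0"
  shows "((\<lambda>s. sqrt (1 - 2 * x * (1 - s))) has_real_derivative x / sqrt (1 - 2 * x * (1 - s)))
    (at s within A)"
proof -
  have a: "((\<lambda>s. 1 - 2 * x * (1 - s)) has_real_derivative 0 - 2 * x * (0 - 1)) (at s within A)"
    by (rule DERIV_diff[OF DERIV_const DERIV_cmult[OF DERIV_diff[OF DERIV_const DERIV_ident]]])
  have b: "(sqrt has_real_derivative inverse (sqrt (1 - 2 * x * (1 - s))) / 2) (at (1 - 2 * x * (1 - s)))"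
    by (rule DERIV_real_sqrt[OF assms])
  have c: "inverse w / 2 * (0 - 2 * x * (0 - 1)) = x / w" for w :: real by (simp add: field_simps)
  show ?thesis
    using DERIV_chain2[where g = "\<lambda>s. 1 - 2 * x * (1 - s)" and x = s, OF b a] unfolding c .
qed

text \<open>Separation of variables read backwards: g at the time \<tau>(s) = ln (v(s) / v(0)) takes
  the role of p, and U = p v is the reciprocal of the wanted A. The bound on x says precisely that
  the total time - ln (1 - 2 x) / 2 is below \<open>T0_fun 0\<close>.\<close>

lemma V_poly_majorant:
  assumes x: "0 < x" "x < (1 - exp (- 2 * T0_fun 0)) / 2"
  obtains A where "continuous_on {0..1} A" "\<And>s. s \<in> {0..1} \<Longrightarrow> A s > 0"
    "\<And>s. s \<in> {0..1} \<Longrightarrow> A s = 1 + (x * integral {0..s} A + (1 - sqrt (1 - 2 * x * (1 - s)))) * A s"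
proof -
  obtain g where g0: "g 0 = 1"
    and g_pos: "\<And>\<tau>. 0 \<le> \<tau> \<Longrightarrow> \<tau> < T0_fun 0 \<Longrightarrow> g \<tau> > 0"
    and g_deriv: "\<And>\<tau>. 0 \<le> \<tau> \<Longrightarrow> \<tau> < T0_fun 0 \<Longrightarrow>
       (g has_real_derivative - (((g \<tau>)\<^sup>2 - g \<tau> + 1) / g \<tau>)) (at \<tau>)"
    by (rule T0_fun_inverse) blast
  have x2: "x < 1 / 2" using x by (smt (verit) exp_gt_zero divide_strict_right_mono)
  define v where "v s = sqrt (1 - 2 * x * (1 - s))" for s
  define \<tau> where "\<tau> s = ln (v s) - ln (v 0)" for s
  define U where "U s = g (\<tau> s) * v s" for s
  define A where "A s = 1 / U s" for s
  have q: "1 - 2 * x * (1 - s) > 0" if "s \<in> {0..1}" for s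
  proof -
    have "x * (1 - s) \<le> x" using that x by (simp add: mult_left_le)
    then show ?thesis using x2 by linarith
  qed
  have v: "v s > 0" "v s \<le> 1" "v 0 \<le> v s" if "s \<in> {0..1}" for s
    using q[OF that] that x by (auto simp: v_def algebra_simps)
  have \<tau>: "0 \<le> \<tau> s" "\<tau> s < T0_fun 0" if s: "s \<in> {0..1}" for s
  proof -
    show "0 \<le> \<tau> s" using v(3)[OF s] v(1)[of 0] by (simp add: \<tau>_def)
    have "ln (v s) \<le> 0" using v[OF s] by simp
    moreover have "ln (v 0) = ln (1 - 2 * x) / 2" using q[of 0] by (simp add: v_def ln_sqrt)
    moreover have "- 2 * T0_fun 0 < ln (1 - 2 * x)"
      using x q[of 0] ln_less_cancel_iff[of "exp (- 2 * T0_fun 0)" "1 - 2 * x"] by (simp del: ln_less_cancel_iff)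
    ultimately show "\<tau> s < T0_fun 0" by (simp add: \<tau>_def)
  qed
  have U_pos: "U s > 0" if "s \<in> {0..1}" for s
    using v(1)[OF that] g_pos[OF \<tau>[OF that]] by (simp add: U_def)
  have dv: "(v has_real_derivative x / v s) (at s)" if "s \<in> {0..1}" for s
    unfolding v_def by (rule has_real_derivative_sqrt_affine[OF q[OF that]])
  \<comment> \<open>The equation for g is the one that yields U' = v' - x / U, the differentiated
    form of the integral equation.\<close>
  have dU: "(U has_real_derivative x / v s - x * A s) (at s)" if s: "s \<in> {0..1}" for s
  proof -
    define p where "p = g (\<tau> s)"
    have p: "p > 0" using g_pos \<tau>[OF s] by (simp add: p_def)
    have "(\<tau> has_real_derivative inverse (v s) * (x / v s) - 0) (at s)"
      unfolding \<tau>_def by (intro DERIV_diff DERIV_const DERIV_chain2[OF DERIV_ln dv] v s)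
    from DERIV_mult[OF DERIV_chain2[where g = \<tau> and x = s, OF g_deriv[OF \<tau>[OF s]] this] dv[OF s]]
    have "(U has_real_derivative
        - ((p\<^sup>2 - p + 1) / p) * (inverse (v s) * (x / v s) - 0) * v s + x / v s * p) (at s)"
      unfolding U_def p_def .
    also have "- ((p\<^sup>2 - p + 1) / p) * (inverse (v s) * (x / v s) - 0) * v s + x / v s * p
        = x / v s - x * (1 / (p * v s))"
      using p v(1)[OF s] by (simp add: field_simps power2_eq_square)
    finally show ?thesis unfolding A_def U_def[of s] p_def .
  qed
  have "isCont U s" if "s \<in> {0..1}" for s using dU[OF that] by (rule DERIV_isCont)
  then have contU: "continuous_on {0..1} U" by (simp add: continuous_at_imp_continuous_on)
  show thesis
  proof
    show "continuous_on {0..1} A" unfolding A_def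
      by (intro continuous_intros contU) (use U_pos in force)
    fix s :: real assume s: "s \<in> {0..1}"
    show "A s > 0" using U_pos[OF s] by (simp add: A_def)
    have "((\<lambda>t. x * A t) has_integral (v s - U s) - (v 0 - U 0)) {0..s}"
    proof (rule fundamental_theorem_of_calculus)
      fix t assume "t \<in> {0..s}"
      then have t: "t \<in> {0..1}" using s by auto
      have "((\<lambda>s. v s - U s) has_real_derivative x / v t - (x / v t - x * A t)) (at t)"
        by (intro DERIV_diff dv dU t)
      then show "((\<lambda>s. v s - U s) has_vector_derivative x * A t) (at t within {0..s})"
        by (simp add: has_real_derivative_iff_has_vector_derivative has_vector_derivative_at_within)
    qed (use s in auto)
    \<comment> \<open>No constant of integration appears, because \<tau> starts at 0 and g(0) =
      1.\<close>
    moreover have "v 0 - U 0 = 0" by (simp add: U_def \<tau>_def g0)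
    ultimately have "x * integral {0..s} A = v s - U s"
      by (metis integral_mult_right diff_zero integral_unique)
    then show "A s = 1 + (x * integral {0..s} A + (1 - sqrt (1 - 2 * x * (1 - s)))) * A s"
      using U_pos[OF s] by (simp add: A_def v_def field_simps)
  qed
qed


text \<open>Domination gives convergence but not the value of the sum. Uniform convergence in s
  permits termwise integration and the Cauchy product, so the sum itself solves the integral
  equation; the conserved quantity is then compared at s = 0, where p = 1, and at s = 1, where v =
  1.\<close>

lemma V_poly_series:
  assumes x: "0 < x" "x < (1 - exp (- 2 * T0_fun 0)) / 2"
  shows "summable (\<lambda>n. V_poly n 1 * x ^ n)" "(\<Sum>n. V_poly n 1 * x ^ n) > 0"
    "T0_fun (1 / (\<Sum>n. V_poly n 1 * x ^ n)) = - ln (1 - 2 * x) / 2"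
proof -
  \<comment> \<open>The room between x and y turns the bound by the majorant at y into the geometric
    bound \<open>M * (x / y) ^ n\<close>, uniform in s.\<close>
  obtain y where y: "x < y" "y < (1 - exp (- 2 * T0_fun 0)) / 2" using dense x by blast
  have "y < 1 / 2" using y by (smt (verit) exp_gt_zero divide_strict_right_mono)
  then have x2: "x < 1 / 2" using y by simp
  obtain B where B: "continuous_on {0..1} B" "\<And>s. s \<in> {0..1} \<Longrightarrow> B s > 0"
    "\<And>s. s \<in> {0..1} \<Longrightarrow> B s = 1 + (y * integral {0..s} B + (1 - sqrt (1 - 2 * y * (1 - s)))) * B s"
    using V_poly_majorant[of y] x y by (metis order_less_trans)
  have "\<exists>r\<in>{0..1}. \<forall>s\<in>{0..1}. B s \<le> B r"
    by (rule continuous_attains_sup[OF compact_Icc _ B(1)]) simp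
  then obtain M where M: "\<And>s. s \<in> {0..1} \<Longrightarrow> B s \<le> M" by blast
  have term_le: "norm (V_poly n s * x ^ n) \<le> M * (x / y) ^ n" if s: "s \<in> {0..1}" for n s
  proof -
    have nn: "V_poly k s \<ge> 0" for k using s by (intro V_poly_nonneg) auto
    have "V_poly n s * y ^ n \<le> (\<Sum>k<Suc n. V_poly k s * y ^ k)"
      using nn x y by (intro member_le_sum) auto
    also have "\<dots> \<le> B s"
      by (rule V_poly_partial_sum_le) (use B x y s \<open>y < 1 / 2\<close> in \<open>auto simp: less_imp_le\<close>)
    also have "\<dots> \<le> M" by (rule M[OF s])
    finally have "V_poly n s * y ^ n * (x / y) ^ n \<le> M * (x / y) ^ n"
      using x y by (intro mult_right_mono) auto
    moreover have "V_poly n s * y ^ n * (x / y) ^ n = V_poly n s * x ^ n"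
      using x y by (simp add: power_divide)
    ultimately show ?thesis using nn[of n] x by simp
  qed
  have geo: "summable (\<lambda>n. M * (x / y) ^ n)"
    using x y by (intro summable_mult summable_geometric) auto
  define A where "A s = (\<Sum>n. V_poly n s * x ^ n)" for s
  have unif: "uniform_limit {0..1} (\<lambda>N s. \<Sum>n<N. V_poly n s * x ^ n) A sequentially"
    unfolding A_def by (rule Weierstrass_m_test[OF term_le geo])
  have cont_N: "continuous_on {0..1} (\<lambda>s. \<Sum>n<N. V_poly n s * x ^ n)" for N
    by (intro continuous_intros V_poly_continuous)
  have cont: "continuous_on {0..1} A"
    by (rule uniform_limit_theorem[OF _ unif]) (simp_all add: cont_N)
  have summ: "summable (\<lambda>n. norm (V_poly n s * x ^ n))" if "s \<in> {0..1}" for s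
    by (rule summable_comparison_test'[OF geo, of 0]) (use term_le[OF that] in auto)
  have nonneg: "V_poly n s * x ^ n \<ge> 0" if "s \<in> {0..1}" for n s
    using that x V_poly_nonneg by auto
  define v where "v s = sqrt (1 - 2 * x * (1 - s))" for s
  have int_sums: "(\<lambda>n. integral {0..s} (V_poly n) * x ^ n) sums integral {0..s} A"
    if s: "s \<in> {0..1}" for s
  proof -
    have u: "uniform_limit {0..s} (\<lambda>N s. \<Sum>n<N. V_poly n s * x ^ n) A sequentially"
      by (rule uniform_limit_on_subset[OF unif]) (use s in auto)
    have c: "continuous_on {0..s} (\<lambda>s. \<Sum>n<N. V_poly n s * x ^ n)" for N
      by (rule continuous_on_subset[OF cont_N]) (use s in auto)
    obtain I J where IJ: "\<And>N. ((\<lambda>s. \<Sum>n<N. V_poly n s * x ^ n) has_integral I N) {0..s}"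
      "(A has_integral J) {0..s}" "I \<longlonglongrightarrow> J"
      by (rule uniform_limit_integral[OF u c]) auto
    have "I N = (\<Sum>n<N. integral {0..s} (V_poly n) * x ^ n)" for N
    proof -
      have "I N = integral {0..s} (\<lambda>s. \<Sum>n<N. V_poly n s * x ^ n)"
        by (rule integral_unique[OF IJ(1), symmetric])
      also have "\<dots> = (\<Sum>n<N. integral {0..s} (V_poly n) * x ^ n)"
        using s by (subst integral_sum) (auto intro!: integrable_on_mult_left V_poly_integrable)
      finally show ?thesis .
    qed
    then have I: "I = (\<lambda>N. \<Sum>n<N. integral {0..s} (V_poly n) * x ^ n)" by (rule ext)
    show ?thesis unfolding sums_def integral_unique[OF IJ(2)] using IJ(3) unfolding I .
  qed
  have eq: "A s = 1 + (x * integral {0..s} A + (1 - v s)) * A s" if s: "s \<in> {0..1}" for s :: real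
  proof -
    define a where
      "a m = (integral {0..s} (V_poly m) + (1 / 2) ^ m * catalan_number m * (1 - s) ^ (m + 1)) * x ^ m" for m
    define b where "b m = V_poly m s * x ^ m" for m
    have b0: "b m \<ge> 0" for m using nonneg[OF s] by (simp add: b_def)
    have b: "b sums A s"
      unfolding b_def A_def by (rule summable_sums[OF summable_norm_cancel[OF summ[OF s]]])
    have "(\<lambda>m. integral {0..s} (V_poly m) * x ^ m + (1 / 2) ^ m * catalan_number m * (1 - s) ^ (m + 1) * x ^ m)
        sums (integral {0..s} A + (1 - v s) / x)"
      unfolding v_def using s x x2 by (intro sums_add int_sums catalan_half_sums) auto
    then have a: "a sums (integral {0..s} A + (1 - v s) / x)"
      by (simp add: a_def[abs_def] distrib_right)
    have a0: "a m \<ge> 0" for m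
      unfolding a_def using s x V_poly_nonneg
      by (intro mult_nonneg_nonneg add_nonneg_nonneg integral_nonneg V_poly_integrable)
        (auto simp: catalan_number_nonneg)
    have V: "V_poly (Suc n) s * x ^ Suc n = x * (\<Sum>m\<le>n. a m * b (n - m))" for n
      unfolding V_poly_Suc sum_distrib_left sum_distrib_right
    proof (rule sum.cong[OF refl])
      fix m assume "m \<in> {..n}"
      then have "x ^ n = x ^ m * x ^ (n - m)" by (simp flip: power_add)
      then show "(integral {0..s} (V_poly m) + (1 / 2) ^ m * catalan_number m * (1 - s) ^ (m + 1)) *
          V_poly (n - m) s * x ^ Suc n = x * (a m * b (n - m))"
        by (simp add: a_def b_def)
    qed
    have "(\<lambda>n. \<Sum>m\<le>n. a m * b (n - m)) sums ((\<Sum>n. a n) * (\<Sum>n. b n))"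
      using a b a0 b0 by (intro Cauchy_product_sums) (auto simp: sums_iff)
    then have "(\<lambda>n. V_poly (Suc n) s * x ^ Suc n) sums (x * ((integral {0..s} A + (1 - v s) / x) * A s))"
      unfolding V using a b by (intro sums_mult) (simp add: sums_iff)
    then have "(\<lambda>n. V_poly n s * x ^ n) sums (x * ((integral {0..s} A + (1 - v s) / x) * A s) + 1)"
      by (subst (asm) sums_Suc_iff) simp
    then have "A s = x * ((integral {0..s} A + (1 - v s) / x) * A s) + 1"
      unfolding A_def by (simp add: sums_iff)
    moreover have "x * ((I + r / x) * w) + 1 = 1 + (x * I + r) * w" for I r w
      using x by (simp add: field_simps)
    ultimately show ?thesis by (simp only:)
  qed
  define U where "U s = v s - x * integral {0..s} A" for s
  have UA: "U s * A s = 1" if "s \<in> {0..1}" for s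
    using eq[OF that] by (simp add: U_def algebra_simps)
  have A1: "A s \<ge> 1" if "s \<in> {0..1}" for s
  proof -
    have "(\<Sum>n<1. V_poly n s * x ^ n) \<le> A s"
      unfolding A_def using nonneg[OF that] summ[OF that]
      by (intro sum_le_suminf[OF summable_norm_cancel[OF summ[OF that]]]) auto
    then show ?thesis by simp
  qed
  have U: "U s > 0" "U s = 1 / A s" if "s \<in> {0..1}" for s
  proof -
    show "U s = 1 / A s" using UA[OF that] A1[OF that] by (simp add: field_simps)
    then show "U s > 0" using A1[OF that] by simp
  qed
  have q: "1 - 2 * x * (1 - s) > 0" if "s \<in> {0..1}" for s
  proof -
    have "x * (1 - s) \<le> x" using that x by (simp add: mult_left_le)
    then show ?thesis using x2 by linarith
  qed
  have v: "v s > 0" if "s \<in> {0..1}" for s using q[OF that] by (simp add: v_def)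
  have dv: "(v has_real_derivative x / v s) (at s within {0..1})" if "s \<in> {0..1}" for s
    unfolding v_def by (rule has_real_derivative_sqrt_affine[OF q[OF that]])
  define p where "p s = U s / v s" for s
  have p: "p s > 0" if "s \<in> {0..1}" for s using U(1)[OF that] v[OF that] by (simp add: p_def)
  have deriv0: "((\<lambda>s. T0_fun (p s) - ln (v s)) has_real_derivative 0) (at s within {0..1})"
    if s: "s \<in> {0..1}" for s
  proof -
    have "((\<lambda>s. integral {0..s} A) has_real_derivative A s) (at s within {0..1})"
      by (rule integral_has_real_derivative[OF cont s])
    from DERIV_diff[OF dv[OF s] DERIV_cmult[OF this, of x]]
    have "(U has_real_derivative x / v s - x * A s) (at s within {0..1})" unfolding U_def .
    from DERIV_divide[OF this dv[OF s]] v[OF s]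
    have dp: "(p has_real_derivative
        ((x / v s - x * A s) * v s - U s * (x / v s)) / (v s * v s)) (at s within {0..1})"
      unfolding p_def by simp
    have "((\<lambda>s. T0_fun (p s)) has_real_derivative - (p s / ((p s)\<^sup>2 - p s + 1))
        * (((x / v s - x * A s) * v s - U s * (x / v s)) / (v s * v s))) (at s within {0..1})"
      by (rule DERIV_chain2[OF has_real_derivative_T0_fun dp])
    moreover have "((\<lambda>s. ln (v s)) has_real_derivative inverse (v s) * (x / v s)) (at s within {0..1})"
      by (rule DERIV_chain2[OF DERIV_ln[OF v[OF s]] dv[OF s]])
    ultimately have d: "((\<lambda>s. T0_fun (p s) - ln (v s)) has_real_derivative - (p s / ((p s)\<^sup>2 - p s + 1))
        * (((x / v s - x * A s) * v s - U s * (x / v s)) / (v s * v s)) - inverse (v s) * (x / v s))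
        (at s within {0..1})"
      by (rule DERIV_diff)
    \<comment> \<open>With U = P V and A = 1 / (P V) the derivative of p collapses to
      \<open>- (P\<^sup>2 - P + 1) / P * (x / (V * V))\<close>; the derivative of
      \<open>T0_fun\<close> cancels the first factor.\<close>
    have "- (P / (P\<^sup>2 - P + 1)) * (((x / V - x * (1 / (P * V))) * V - (P * V) * (x / V)) / (V * V))
        - inverse V * (x / V) = 0" if "P > 0" "V > 0" for P V :: real
    proof -
      have "((x / V - x * (1 / (P * V))) * V - (P * V) * (x / V)) / (V * V) = - (P\<^sup>2 - P + 1) / P * (x / (V * V))"
        using that by (simp add: field_simps power2_eq_square)
      moreover have "- (P / R) * (- R / P * y) = y" if "R > 0" for R y
        using that \<open>P > 0\<close> by simp
      note this[OF quadratic_pos[of P]]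
      moreover have "inverse V * (x / V) = x / (V * V)" by (simp add: field_simps)
      ultimately show ?thesis by (simp only: diff_self)
    qed
    from this[OF p[OF s] v[OF s]] have "- (p s / ((p s)\<^sup>2 - p s + 1))
        * (((x / v s - x * A s) * v s - U s * (x / v s)) / (v s * v s)) - inverse (v s) * (x / v s) = 0"
      using U(2)[OF s] v[OF s] A1[OF s] by (simp add: p_def)
    with d show ?thesis by simp
  qed
  have "\<exists>c. \<forall>s\<in>{0..1}. T0_fun (p s) - ln (v s) = c"
    by (rule has_field_derivative_zero_constant) (use deriv0 in auto)
  then have "T0_fun (p 1) - ln (v 1) = T0_fun (p 0) - ln (v 0)" by force
  moreover have "p 0 = 1" using v[of 0] by (simp add: p_def U_def)
  moreover have "v 1 = 1" "ln (v 0) = ln (1 - 2 * x) / 2" using q[of 0] by (auto simp: v_def ln_sqrt)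
  ultimately have "T0_fun (U 1) = - ln (1 - 2 * x) / 2" by (simp add: p_def T0_fun_1)
  then show "T0_fun (1 / (\<Sum>n. V_poly n 1 * x ^ n)) = - ln (1 - 2 * x) / 2"
    using U(2)[of 1] by (simp add: A_def)
  show "summable (\<lambda>n. V_poly n 1 * x ^ n)" using summable_norm_cancel[OF summ[of 1]] by simp
  show "(\<Sum>n. V_poly n 1 * x ^ n) > 0" using A1[of 1] by (simp add: A_def)
qed

section \<open>The Cauchy--Stieltjes transform\<close>

definition supp_radius :: real where
  "supp_radius = sqrt (2 + gamma0)"

definition supp_segment :: "complex set" where
  "supp_segment = of_real ` {- supp_radius..supp_radius}"

lemma gamma0_pos: "gamma0 > 0"
  by (simp add: gamma0_def)

lemma supp_radius_pos: "supp_radius > 0"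
  using gamma0_pos by (simp add: supp_radius_def)

lemma supp_radius_power2: "supp_radius\<^sup>2 = 2 + gamma0"
  using gamma0_pos by (simp add: supp_radius_def)

text \<open>With E = exp (2 * \<open>T0_fun 0\<close>) one has \<open>gamma0\<close> = 2 / (E - 1)
  and 2 + \<open>gamma0\<close> = 2 E / (E - 1). Hence the range of x in
  \<open>V_poly_series\<close>, for \<open>x = 1 / z\<^sup>2\<close>, is the region outside
  \<open>supp_radius\<close>.\<close>

lemma inverse_supp_radius_power2: "1 / supp_radius\<^sup>2 = (1 - exp (- 2 * T0_fun 0)) / 2"
proof -
  define E where "E = exp (2 * T0_fun 0)"
  have "T0_fun 0 > 0" by (simp add: T0_fun_0)
  then have "E > 1" by (simp add: E_def)
  have g: "gamma0 = 2 / (E - 1)" by (simp add: gamma0_def E_def T0_fun_0 mult.assoc)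
  have "2 + 2 / (E - 1) = 2 * E / (E - 1)" using \<open>E > 1\<close> by (simp add: field_simps)
  then have "1 / supp_radius\<^sup>2 = (1 - 1 / E) / 2"
    unfolding supp_radius_power2 g using \<open>E > 1\<close> by (simp add: field_simps)
  moreover have "exp (- 2 * T0_fun 0) = 1 / E" by (simp add: E_def exp_minus inverse_eq_divide)
  ultimately show ?thesis by simp
qed

lemma closed_supp_segment: "closed supp_segment"
  unfolding supp_segment_def
  by (intro compact_imp_closed compact_continuous_image continuous_intros compact_Icc)

lemma notin_supp_segment_of_norm: "norm z > supp_radius \<Longrightarrow> z \<notin> supp_segment"
  by (auto simp: supp_segment_def)

lemma notin_supp_segment_of_Im: "Im z \<noteq> 0 \<Longrightarrow> z \<notin> supp_segment"
  by (auto simp: supp_segment_def)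

lemma uminus_supp_segment_iff [simp]: "- z \<in> supp_segment \<longleftrightarrow> z \<in> supp_segment"
proof -
  have "- z \<in> supp_segment" if "z \<in> supp_segment" for z
    using that by (auto simp: supp_segment_def image_iff intro!: bexI[of _ "- x" for x])
  from this[of z] this[of "- z"] show ?thesis by auto
qed

lemma connected_compl_supp_segment: "connected (- supp_segment)"
proof (rule connected_complement_bounded_convex)
  show "bounded supp_segment"
    unfolding supp_segment_def
    by (intro compact_imp_bounded compact_continuous_image continuous_intros compact_Icc)
  show "convex supp_segment"
    unfolding supp_segment_def by (intro convex_linear_image bounded_linear.linear bounded_linear_of_real) simp
qed simp

text \<open>Half the radius of a disc around z that avoids the segment serves both as radius of a
  neighbourhood and as lower bound for all denominators in it; differentiation under the integral
  uses both.\<close>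

lemma supp_segment_dist:
  assumes "z \<notin> supp_segment"
  obtains \<delta> where "\<delta> > 0"
    "\<And>y t. dist y z < \<delta> \<Longrightarrow> \<bar>t\<bar> \<le> supp_radius \<Longrightarrow> norm (y - complex_of_real t) \<ge> \<delta>"
proof -
  obtain e where e: "e > 0" "ball z e \<subseteq> - supp_segment"
    using closed_supp_segment assms by (metis ComplI open_Compl open_contains_ball)
  show thesis
  proof (rule that)
    show "e / 2 > 0" using e by simp
    fix y t assume y: "dist y z < e / 2" and "\<bar>t\<bar> \<le> supp_radius"
    then have "complex_of_real t \<in> supp_segment"
      unfolding supp_segment_def by (intro imageI) (auto simp: abs_le_iff)
    then have "dist z (of_real t) \<ge> e" using e(2) by (force simp: not_less)
    moreover have "dist z (of_real t) \<le> dist y z + dist y (of_real t)"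
      by (metis dist_commute dist_triangle)
    ultimately show "norm (y - complex_of_real t) \<ge> e / 2" using y unfolding dist_norm by linarith
  qed
qed

section \<open>Support and transform of a measure with the prescribed moments\<close>

context
  fixes M :: "real measure"
  assumes M: "standard_V_monotone_gaussian M"
begin

interpretation real_distribution M
  using M by (simp add: standard_V_monotone_gaussian_def)

lemma prob_UNIV: "measure M UNIV = 1"
  using prob_space by simp

lemma power_integrable: "integrable M (\<lambda>t. t ^ n)"
  and integral_power: "(LINT t|M. t ^ n) = V_moment n"
  using M by (simp_all add: standard_V_monotone_gaussian_def)

text \<open>Markov's inequality for \<open>t ^ (2 * n)\<close> bounds the tail, for every n, by the
  n-th term of a convergent series.\<close>

lemma measure_tail_eq_0:
  assumes a: "a > supp_radius"
  shows "measure M {t. \<bar>t\<bar> \<ge> a} = 0"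
proof -
  have pos: "a > 0" using a supp_radius_pos by simp
  have "1 / a\<^sup>2 < 1 / supp_radius\<^sup>2"
    using a supp_radius_pos by (intro divide_strict_left_mono power_strict_mono) auto
  then have "summable (\<lambda>n. V_poly n 1 * (1 / a\<^sup>2) ^ n)"
    using pos by (intro V_poly_series) (auto simp: inverse_supp_radius_power2)
  then have lim: "(\<lambda>n. V_poly n 1 * (1 / a\<^sup>2) ^ n) \<longlonglongrightarrow> 0" by (rule summable_LIMSEQ_zero)
  have "measure M {t. \<bar>t\<bar> \<ge> a} \<le> V_poly n 1 * (1 / a\<^sup>2) ^ n" for n
  proof -
    have m: "{t. \<bar>t\<bar> \<ge> a} \<in> sets M" by simp
    have "(LINT t|M. indicator {t. \<bar>t\<bar> \<ge> a} t * a ^ (2 * n)) \<le> (LINT t|M. t ^ (2 * n))"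
    proof (rule integral_mono)
      show "integrable M (\<lambda>t. indicator {t. \<bar>t\<bar> \<ge> a} t * a ^ (2 * n))"
        by (intro integrable_mult_left) (use m in \<open>auto simp: emeasure_eq_measure\<close>)
      fix t :: real
      have "a ^ (2 * n) \<le> \<bar>t\<bar> ^ (2 * n)" if "a \<le> \<bar>t\<bar>"
        using that pos by (intro power_mono) auto
      then show "indicator {t. \<bar>t\<bar> \<ge> a} t * a ^ (2 * n) \<le> t ^ (2 * n)"
        by (auto simp: indicator_def power_even_abs)
    qed (rule power_integrable)
    also have "\<dots> = V_poly n 1" by (simp add: integral_power V_moment_def)
    finally have "measure M {t. \<bar>t\<bar> \<ge> a} * (a\<^sup>2) ^ n \<le> V_poly n 1"
      using m by (simp add: power_mult)
    moreover have "(a\<^sup>2) ^ n > 0" using pos by simp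
    ultimately have "measure M {t. \<bar>t\<bar> \<ge> a} \<le> V_poly n 1 / (a\<^sup>2) ^ n" by (simp only: pos_le_divide_eq)
    then show ?thesis by (simp only: power_one_over) simp
  qed
  then have "measure M {t. \<bar>t\<bar> \<ge> a} \<le> 0" by (intro LIMSEQ_le_const[OF lim]) auto
  then show ?thesis by (simp add: measure_le_0_iff)
qed

text \<open>The tail estimate needs a radius strictly above \<open>supp_radius\<close>, hence the
  countable family of radii decreasing to it.\<close>

lemma AE_bounded: "AE t in M. \<bar>t\<bar> \<le> supp_radius"
proof -
  have "AE t in M. \<forall>n. \<not> \<bar>t\<bar> \<ge> supp_radius + 1 / real (Suc n)"
    unfolding AE_all_countable
  proof
    fix n
    have "measure M {t. \<bar>t\<bar> \<ge> supp_radius + 1 / real (Suc n)} = 0"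
      by (rule measure_tail_eq_0) simp
    then show "AE t in M. \<not> \<bar>t\<bar> \<ge> supp_radius + 1 / real (Suc n)"
      by (subst AE_iff_measurable[OF _ refl]) (auto simp: emeasure_eq_measure)
  qed
  then show ?thesis
  proof eventually_elim
    case (elim t)
    show ?case
    proof (rule field_le_epsilon)
      fix e :: real assume "e > 0"
      then obtain n where "1 / real (Suc n) < e" using nat_approx_posE by blast
      then show "\<bar>t\<bar> \<le> supp_radius + e" using elim[rule_format, of n] by linarith
    qed
  qed
qed

lemma notin_measure_supp:
  assumes "\<bar>x\<bar> > supp_radius"
  shows "x \<notin> measure_supp M"
proof
  assume x: "x \<in> measure_supp M"
  have "open {t::real. \<bar>t\<bar> > supp_radius}" by (intro open_Collect_less continuous_intros)
  then have "emeasure M {t. \<bar>t\<bar> > supp_radius} > 0" using x assms by (auto simp: measure_supp_def)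
  moreover have "emeasure M {t. \<bar>t\<bar> > supp_radius} = 0"
    using AE_bounded by (subst (asm) AE_iff_measurable[OF _ refl]) (auto simp: not_le)
  ultimately show False by simp
qed

lemma integrable_resolvent_product:
  assumes "y \<notin> supp_segment" "z \<notin> supp_segment"
  shows "integrable M (\<lambda>t. 1 / (y - complex_of_real t) ^ j * (1 / (z - complex_of_real t) ^ k))"
proof -
  obtain d where d: "d > 0" "\<And>t. \<bar>t\<bar> \<le> supp_radius \<Longrightarrow> norm (y - complex_of_real t) \<ge> d"
    using supp_segment_dist[OF assms(1)] by (metis dist_self)
  obtain e where e: "e > 0" "\<And>t. \<bar>t\<bar> \<le> supp_radius \<Longrightarrow> norm (z - complex_of_real t) \<ge> e"
    using supp_segment_dist[OF assms(2)] by (metis dist_self)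
  show ?thesis
  proof (rule integrable_const_bound)
    show "AE t in M. norm (1 / (y - complex_of_real t) ^ j * (1 / (z - complex_of_real t) ^ k))
        \<le> 1 / d ^ j * (1 / e ^ k)"
      using AE_bounded
    proof eventually_elim
      case (elim t)
      have "1 / norm (y - complex_of_real t) ^ j \<le> 1 / d ^ j"
        using d elim by (intro frac_le power_mono zero_less_power) auto
      moreover have "1 / norm (z - complex_of_real t) ^ k \<le> 1 / e ^ k"
        using e elim by (intro frac_le power_mono zero_less_power) auto
      ultimately show ?case unfolding norm_mult norm_divide norm_power norm_one
        using d(1) by (intro mult_mono) auto
    qed
  qed measurable
qed

lemma integrable_resolvent:
  assumes "z \<notin> supp_segment"
  shows "integrable M (\<lambda>t. 1 / (z - complex_of_real t))"
  using integrable_resolvent_product[OF assms assms, of 1 0] by simp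

text \<open>Differentiation under the integral with an explicit remainder: for a = y - t and b = z -
  t the difference quotient of the kernel misses its derivative by
  \<open>(y - z) / (a * b\<^sup>2)\<close>, which is at most \<open>norm (y - z) / d ^ 3\<close>
  uniformly in t.\<close>

lemma cauchy_stieltjes_has_field_derivative:
  assumes z: "z \<notin> supp_segment"
  shows "(cauchy_stieltjes M has_field_derivative - (LINT t|M. 1 / (z - complex_of_real t)\<^sup>2)) (at z)"
proof -
  obtain d where d: "d > 0"
    "\<And>y t. dist y z < d \<Longrightarrow> \<bar>t\<bar> \<le> supp_radius \<Longrightarrow> norm (y - complex_of_real t) \<ge> d"
    using supp_segment_dist[OF z] by blast
  define D where "D = - (LINT t|M. 1 / (z - complex_of_real t)\<^sup>2)"
  have bound: "norm ((cauchy_stieltjes M y - cauchy_stieltjes M z) / (y - z) - D) \<le> norm (y - z) / d ^ 3"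
    if y: "dist y z < d" "y \<noteq> z" for y
  proof -
    have yK: "y \<notin> supp_segment"
    proof
      assume "y \<in> supp_segment"
      then obtain t where t: "y = of_real t" "\<bar>t\<bar> \<le> supp_radius"
        by (auto simp: supp_segment_def abs_le_iff)
      show False using d(2)[OF y(1) t(2)] d(1) t(1) by simp
    qed
    have int: "integrable M (\<lambda>t. (1 / (y - complex_of_real t) - 1 / (z - complex_of_real t)) / (y - z)
        + 1 / (z - complex_of_real t)\<^sup>2)"
      using integrable_resolvent_product[OF z z, of 2 0] integrable_resolvent[OF yK] integrable_resolvent[OF z]
      by (intro Bochner_Integration.integrable_add integrable_divide Bochner_Integration.integrable_diff) auto
    have "(cauchy_stieltjes M y - cauchy_stieltjes M z) / (y - z) - D
        = (LINT t|M. (1 / (y - complex_of_real t) - 1 / (z - complex_of_real t)) / (y - z)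
        + 1 / (z - complex_of_real t)\<^sup>2)"
      unfolding cauchy_stieltjes_def D_def
      using integrable_resolvent_product[OF z z, of 2 0] integrable_resolvent[OF yK] integrable_resolvent[OF z]
      by (subst Bochner_Integration.integral_add) auto
    also have "norm \<dots> \<le> (LINT t|M. norm (y - z) / d ^ 3)"
    proof (rule order_trans[OF Bochner_Integration.integral_norm_bound])
      show "(LINT t|M. norm ((1 / (y - complex_of_real t) - 1 / (z - complex_of_real t)) / (y - z)
        + 1 / (z - complex_of_real t)\<^sup>2)) \<le> (LINT t|M. norm (y - z) / d ^ 3)"
      proof (rule integral_mono_AE)
        show "AE t in M. norm ((1 / (y - complex_of_real t) - 1 / (z - complex_of_real t)) / (y - z)
          + 1 / (z - complex_of_real t)\<^sup>2) \<le> norm (y - z) / d ^ 3"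
          using AE_bounded
        proof eventually_elim
          case (elim t)
          define a b where "a = y - complex_of_real t" and "b = z - complex_of_real t"
          have ab: "norm a \<ge> d" "norm b \<ge> d"
            using d elim y by (auto simp: a_def b_def)
          then have ne: "a \<noteq> 0" "b \<noteq> 0" using d(1) by auto
          have "y - z = a - b" by (simp add: a_def b_def)
          moreover have "a - b \<noteq> 0" using y by (simp add: a_def b_def)
          ultimately have "(1 / a - 1 / b) / (y - z) + 1 / b\<^sup>2 = (y - z) / (a * b\<^sup>2)"
            using ne by (simp add: divide_simps) (simp add: algebra_simps power2_eq_square)
          moreover have "norm ((y - z) / (a * b\<^sup>2)) \<le> norm (y - z) / d ^ 3"
          proof -
            have "d * d\<^sup>2 \<le> norm a * (norm b)\<^sup>2"
              using ab d(1) by (intro mult_mono power_mono) auto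
            then have "d ^ 3 \<le> norm (a * b\<^sup>2)"
              by (simp add: norm_mult norm_power power3_eq_cube power2_eq_square mult.assoc)
            then show ?thesis unfolding norm_divide
              using d(1) ne by (intro divide_left_mono mult_pos_pos) auto
          qed
          ultimately show ?case by (simp only: a_def b_def)
        qed
      qed (use int in auto)
    qed
    finally show ?thesis by (simp add: prob_UNIV)
  qed
  have "((\<lambda>y. (cauchy_stieltjes M y - cauchy_stieltjes M z) / (y - z) - D) \<longlongrightarrow> 0) (at z)"
  proof (rule Lim_null_comparison)
    show "\<forall>\<^sub>F y in at z. norm ((cauchy_stieltjes M y - cauchy_stieltjes M z) / (y - z) - D)
        \<le> norm (y - z) / d ^ 3"
      unfolding eventually_at using d(1) bound by blast
    show "((\<lambda>y. norm (y - z) / d ^ 3) \<longlongrightarrow> 0) (at z)"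
      by (rule tendsto_eq_intros refl | simp add: d(1) less_imp_neq[symmetric])+
  qed
  then have "((\<lambda>y. (cauchy_stieltjes M y - cauchy_stieltjes M z) / (y - z)) \<longlongrightarrow> D) (at z)"
    by (rule LIM_zero_cancel)
  then show ?thesis by (simp add: has_field_derivative_iff D_def)
qed

lemma cauchy_stieltjes_holomorphic: "cauchy_stieltjes M holomorphic_on - supp_segment"
  unfolding holomorphic_on_open[OF open_Compl[OF closed_supp_segment]]
  using cauchy_stieltjes_has_field_derivative by blast

text \<open>The geometric series of the kernel in t / z has the ratio bound
  \<open>supp_radius / norm z\<close> < 1 almost everywhere, so it may be integrated
  termwise.\<close>

lemma cauchy_stieltjes_sums:
  assumes z: "norm z > supp_radius"
  shows "(\<lambda>n. of_real (V_poly n 1) / z ^ (2 * n + 1)) sums cauchy_stieltjes M z"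
proof -
  define f where "f n t = complex_of_real (t ^ n) / z ^ (n + 1)" for n t
  have nz: "norm z > 0" using z supp_radius_pos by linarith
  have int: "integrable M (f n)" for n
    unfolding f_def using power_integrable by (intro integrable_divide integrable_of_real)
  have nb: "norm (f n t) \<le> 1 / norm z * (supp_radius / norm z) ^ n" if "\<bar>t\<bar> \<le> supp_radius" for n t
  proof -
    have "norm (f n t) = \<bar>t\<bar> ^ n / norm z ^ (n + 1)"
      by (simp add: f_def norm_divide norm_power norm_mult power_abs)
    also have "\<dots> \<le> supp_radius ^ n / norm z ^ (n + 1)"
      using that by (intro divide_right_mono power_mono) auto
    finally show ?thesis by (simp add: power_divide)
  qed
  have geo: "summable (\<lambda>n. 1 / norm z * (supp_radius / norm z) ^ n)"
    using z nz supp_radius_pos by (intro summable_mult summable_geometric) auto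
  have "(\<lambda>n. LINT t|M. f n t) sums (LINT t|M. (\<Sum>n. f n t))"
  proof (rule sums_integral)
    show "AE t in M. summable (\<lambda>n. norm (f n t))"
      using AE_bounded
    proof eventually_elim
      case (elim t)
      show ?case by (rule summable_comparison_test'[OF geo, of 0]) (use nb[OF elim] in auto)
    qed
    show "summable (\<lambda>n. LINT t|M. norm (f n t))"
    proof (rule summable_comparison_test'[OF geo, of 0])
      fix n
      have "(LINT t|M. norm (f n t)) \<le> (LINT t|M. 1 / norm z * (supp_radius / norm z) ^ n)"
        using AE_bounded by (intro integral_mono_AE) (use int nb in auto)
      then show "norm (LINT t|M. norm (f n t)) \<le> 1 / norm z * (supp_radius / norm z) ^ n"
        by (simp add: prob_UNIV)
    qed
  qed (rule int)
  also have "(LINT t|M. (\<Sum>n. f n t)) = cauchy_stieltjes M z"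
    unfolding cauchy_stieltjes_def
  proof (rule integral_cong_AE)
    show "AE t in M. (\<Sum>n. f n t) = 1 / (z - complex_of_real t)"
      using AE_bounded
    proof eventually_elim
      case (elim t)
      have "norm (of_real t / z) < 1" using elim z nz by (simp add: norm_divide)
      then have "(\<lambda>n. 1 / z * (of_real t / z) ^ n) sums (1 / z * (1 / (1 - of_real t / z)))"
        by (intro sums_mult geometric_sums)
      moreover have "1 / z * (1 / (1 - of_real t / z)) = 1 / (z - of_real t)"
        using nz by (simp add: field_simps)
      moreover have "1 / z * (of_real t / z) ^ n = f n t" for n
        by (simp add: f_def power_divide)
      ultimately show ?case by (simp add: sums_iff)
    qed
  qed (auto simp: f_def)
  also have "(\<lambda>n. LINT t|M. f n t) = (\<lambda>n. of_real (V_moment n) / z ^ (n + 1))"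
    unfolding f_def by (simp del: of_real_power add: integral_power)
  finally have "(\<lambda>n. of_real (V_moment n) / z ^ (n + 1)) sums cauchy_stieltjes M z" .
  moreover have "strict_mono (\<lambda>n::nat. 2 * n)" by (auto simp: strict_mono_def)
  \<comment> \<open>Passing to the even indices loses nothing, since the odd moments are 0.\<close>
  ultimately have "(\<lambda>n. of_real (V_moment (2 * n)) / z ^ (2 * n + 1)) sums cauchy_stieltjes M z"
    by (subst sums_mono_reindex[where f = "\<lambda>n. of_real (V_moment n) / z ^ (n + 1)"])
      (auto simp: V_moment_def elim!: evenE)
  then show ?thesis by (simp add: V_moment_def)
qed

text \<open>Near infinity the expansion has only odd powers. The identity theorem carries oddness
  through the connected complement of the segment, without deducing symmetry of the measure from its
  moments.\<close>

lemma cauchy_stieltjes_minus: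
  assumes "z \<notin> supp_segment"
  shows "cauchy_stieltjes M (- z) = - cauchy_stieltjes M z"
proof (rule analytic_continuation_open[where s = "{z. norm z > supp_radius}" and s' = "- supp_segment"
      and f = "\<lambda>z. cauchy_stieltjes M (- z)" and g = "\<lambda>z. - cauchy_stieltjes M z"])
  show "open {z::complex. norm z > supp_radius}" by (intro open_Collect_less continuous_intros)
  show "{z::complex. norm z > supp_radius} \<noteq> {}"
    using supp_radius_pos by (auto intro!: exI[of _ "of_real (supp_radius + 1)"])
  show "{z. norm z > supp_radius} \<subseteq> - supp_segment" using notin_supp_segment_of_norm by auto
  have "cauchy_stieltjes M \<circ> uminus holomorphic_on - supp_segment"
    by (rule holomorphic_on_compose_gen[OF _ cauchy_stieltjes_holomorphic])
      (auto intro!: holomorphic_intros)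
  then show "(\<lambda>z. cauchy_stieltjes M (- z)) holomorphic_on - supp_segment" by (simp add: o_def)
  show "(\<lambda>z. - cauchy_stieltjes M z) holomorphic_on - supp_segment"
    by (intro holomorphic_intros cauchy_stieltjes_holomorphic)
  fix z :: complex assume "z \<in> {z. norm z > supp_radius}"
  then have z: "norm z > supp_radius" by simp
  have "(\<lambda>n. of_real (V_poly n 1) / (- z) ^ (2 * n + 1)) sums cauchy_stieltjes M (- z)"
    using cauchy_stieltjes_sums[of "- z"] z by simp
  moreover have "(\<lambda>n. - (of_real (V_poly n 1) / z ^ (2 * n + 1))) sums - cauchy_stieltjes M z"
    using cauchy_stieltjes_sums[OF z] by (rule sums_minus)
  ultimately show "cauchy_stieltjes M (- z) = - cauchy_stieltjes M z"
    by (simp add: sums_iff)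
qed (use assms closed_supp_segment connected_compl_supp_segment in auto)

lemma cauchy_stieltjes_cnj: "cauchy_stieltjes M (cnj z) = cnj (cauchy_stieltjes M z)"
proof -
  have "cauchy_stieltjes M (cnj z) = (LINT t|M. cnj (1 / (z - complex_of_real t)))"
    by (simp add: cauchy_stieltjes_def)
  also have "\<dots> = cnj (LINT t|M. 1 / (z - complex_of_real t))" by (rule Bochner_Integration.integral_cnj)
  finally show ?thesis by (simp only: cauchy_stieltjes_def)
qed

lemma recip_cauchy_stieltjes_reflect:
  assumes "z \<notin> supp_segment"
  shows "recip_cauchy_stieltjes M z = - cnj (recip_cauchy_stieltjes M (- cnj z))"
proof -
  have "cauchy_stieltjes M (- cnj z) = cnj (- cauchy_stieltjes M z)"
    using cauchy_stieltjes_minus[OF assms] cauchy_stieltjes_cnj[of "- z"] by simp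
  then show ?thesis by (simp add: recip_cauchy_stieltjes_def)
qed

text \<open>Above the axis the kernel has imaginary part
  \<open>- Im z / (norm (z - of_real t))\<^sup>2\<close>, bounded away from 0 for |t| \<le>
  \<open>supp_radius\<close>. To the right of the segment the kernel is positive, and the left side
  follows by oddness.\<close>

lemma cauchy_stieltjes_nonzero:
  assumes z: "z \<notin> supp_segment" "Im z \<ge> 0"
  shows "cauchy_stieltjes M z \<noteq> 0"
proof (cases "Im z = 0")
  case False
  define r where "r = norm z + supp_radius"
  have r: "r > 0" using supp_radius_pos norm_ge_zero[of z] unfolding r_def by linarith
  have "Im (cauchy_stieltjes M z) = (LINT t|M. Im (1 / (z - complex_of_real t)))"
    unfolding cauchy_stieltjes_def using integrable_resolvent[OF z(1)] by (rule integral_Im[symmetric])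
  also have "\<dots> \<le> (LINT t|M. - (Im z / r\<^sup>2))"
  proof (rule integral_mono_AE)
    show "AE t in M. Im (1 / (z - complex_of_real t)) \<le> - (Im z / r\<^sup>2)"
      using AE_bounded
    proof eventually_elim
      case (elim t)
      have "norm (z - of_real t) \<le> r"
        using norm_triangle_ineq4[of z "of_real t"] elim by (simp add: r_def)
      then have "(norm (z - of_real t))\<^sup>2 \<le> r\<^sup>2" by (intro power_mono) auto
      moreover have "norm (z - of_real t) > 0" using False by auto
      ultimately have "Im z / r\<^sup>2 \<le> Im z / (norm (z - of_real t))\<^sup>2"
        using z r by (intro divide_left_mono) auto
      then show ?case by (simp add: Im_divide cmod_power2)
    qed
  qed (use integrable_resolvent[OF z(1)] in auto)
  also have "\<dots> < 0" using z False r by (simp add: prob_UNIV)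
  finally show ?thesis by auto
next
  case True
  have pos: "cauchy_stieltjes M (of_real x) \<noteq> 0" if x: "x > supp_radius" for x
  proof -
    have xK: "complex_of_real x \<notin> supp_segment"
      using x supp_radius_pos by (intro notin_supp_segment_of_norm) auto
    have "0 < (LINT t|M. 1 / (x + supp_radius))" using x supp_radius_pos by (simp add: prob_UNIV)
    also have "\<dots> \<le> (LINT t|M. Re (1 / (complex_of_real x - complex_of_real t)))"
    proof (rule integral_mono_AE)
      show "AE t in M. 1 / (x + supp_radius) \<le> Re (1 / (complex_of_real x - complex_of_real t))"
        using AE_bounded
      proof eventually_elim
        case (elim t)
        then have "1 / (x + supp_radius) \<le> 1 / (x - t)" using x
          by (intro divide_left_mono) (auto intro!: mult_pos_pos)
        also have "1 / (x - t) = Re (1 / (complex_of_real x - complex_of_real t))"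
          by (metis Re_complex_of_real of_real_1 of_real_diff of_real_divide)
        finally show ?case .
      qed
    qed (simp, rule integrable_Re[OF integrable_resolvent[OF xK]])
    also have "\<dots> = Re (cauchy_stieltjes M (of_real x))"
      unfolding cauchy_stieltjes_def using integrable_resolvent[OF xK] by (rule integral_Re)
    finally show ?thesis by auto
  qed
  have zr: "z = of_real (Re z)" using True by (simp add: complex_eq_iff)
  then have "\<bar>Re z\<bar> > supp_radius" using z(1) unfolding supp_segment_def by (force simp: image_iff)
  then consider "Re z > supp_radius" | "- Re z > supp_radius" by linarith
  then show ?thesis
  proof cases
    case 1
    then show ?thesis using pos zr by metis
  next
    case 2
    then have "cauchy_stieltjes M (- z) \<noteq> 0" using pos[of "- Re z"] zr by (metis of_real_minus)
    then show ?thesis using cauchy_stieltjes_minus[OF z(1)] by auto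
  qed
qed

end

section \<open>An explicit coordinate for T\<close>

text \<open>The equation exp d = (u - cnj \<open>u0\<close>) / (u - \<open>u0\<close>) solved for u,
  as \<open>u0\<close> - cnj \<open>u0\<close> = sqrt 3 * i. Large \<open>Re d\<close> means u near
  \<open>u0\<close>; near the zeros of exp d - 1 the value u tends to infinity.\<close>

definition u_chart :: "complex \<Rightarrow> complex" where
  "u_chart d = u0 + of_real (sqrt 3) * \<i> / (exp d - 1)"

text \<open>The additive constant makes \<^term>\<open>T_chart\<close> vanish at the point \<open>d = 2 \<pi> \<i> / 3\<close> over \<open>u = 1\<close>.\<close>

definition T_chart :: "complex \<Rightarrow> complex" where
  "T_chart d = d / 2 - \<i> * d / (2 * of_real (sqrt 3)) + Ln (1 - exp (- d))
     - (\<i> * of_real (pi / 2) + of_real (pi / (3 * sqrt 3) + ln 3 / 2))"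

lemma Re_u0 [simp]: "Re u0 = 1 / 2" and Im_u0 [simp]: "Im u0 = sqrt 3 / 2"
  by (simp_all add: u0_def)

text \<open>exp (- d) lies in the closed unit disc, which meets the line Re w = 1 only at w = 1.
  This keeps the principal \<open>Ln\<close> in \<open>T_chart\<close> analytic up to the line Re d
  = 0, except where exp d = 1.\<close>

lemma Re_one_minus_exp_pos:
  assumes "Re d \<ge> 0" "exp d \<noteq> 1"
  shows "Re (1 - exp (- d)) > 0"
proof -
  define w where "w = exp (- d)"
  have n: "norm w \<le> 1" using assms(1) by (simp add: w_def)
  have "w \<noteq> 1" using assms(2) by (auto simp: w_def exp_minus)
  have "Re w \<noteq> 1"
  proof
    assume r: "Re w = 1"
    have "(Re w)\<^sup>2 + (Im w)\<^sup>2 \<le> 1" using n by (simp add: cmod_def)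
    with r have "Im w = 0" by simp
    with r \<open>w \<noteq> 1\<close> show False by (simp add: complex_eq_iff)
  qed
  moreover have "Re w \<le> 1" using n complex_Re_le_cmod[of w] by linarith
  ultimately show ?thesis by (simp add: w_def)
qed

lemma one_minus_exp_notin_nonpos_Reals:
  assumes "Re d \<ge> 0" "exp d \<noteq> 1"
  shows "1 - exp (- d) \<notin> \<real>\<^sub>\<le>\<^sub>0"
  using Re_one_minus_exp_pos[OF assms] by (auto simp: complex_nonpos_Reals_iff)

text \<open>\<open>u_chart\<close> is affine in 1 / (exp d - 1), whose primitive is Ln (1 - exp (-
  d)); the linear part of \<open>T_chart\<close> comes from the constant \<open>u0\<close>, because
  - i \<open>u0\<close> / sqrt 3 = 1 / 2 - i / (2 sqrt 3).\<close>

lemma has_field_derivative_T_chart: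
  assumes "1 - exp (- d) \<notin> \<real>\<^sub>\<le>\<^sub>0"
  shows "(T_chart has_field_derivative - \<i> * u_chart d / of_real (sqrt 3)) (at d within A)"
proof -
  have ne: "exp d \<noteq> 1" using assms by (auto simp: exp_minus)
  have L: "((\<lambda>d. Ln (1 - exp (- d))) has_field_derivative exp (- d) / (1 - exp (- d))) (at d within A)"
    using assms by (auto intro!: derivative_eq_intros simp: divide_inverse)
  have "((\<lambda>d. (1 / 2 - \<i> / k) * d) has_field_derivative 1 / 2 - \<i> / k) (at d within A)" for k
    by (rule DERIV_cmult_Id)
  then have lin: "((\<lambda>d. d / 2 - \<i> * d / k) has_field_derivative 1 / 2 - \<i> / k) (at d within A)" for k
    by (simp add: left_diff_distrib)
  have "((\<lambda>d. d / 2 - \<i> * d / k + Ln (1 - exp (- d)) - c) has_field_derivative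
      1 / 2 - \<i> / k + exp (- d) / (1 - exp (- d)) - 0) (at d within A)" for k c
    by (rule DERIV_diff[OF DERIV_add[OF lin L] DERIV_const])
  then have "(T_chart has_field_derivative 1 / 2 - \<i> / (2 * of_real (sqrt 3)) + exp (- d) / (1 - exp (- d)))
      (at d within A)"
    unfolding T_chart_def by simp
  also have "exp (- d) / (1 - exp (- d)) = 1 / (exp d - 1)"
    using ne by (simp add: exp_minus field_simps)
  also have "1 / 2 - \<i> / (2 * of_real (sqrt 3)) + 1 / (exp d - 1)
      = - \<i> * u_chart d / of_real (sqrt 3)"
  proof -
    define r E where "r = complex_of_real (sqrt 3)" and "E = 1 / (exp d - 1)"
    have "r \<noteq> 0" by (simp add: r_def)
    have "u_chart d = (1 + r * \<i>) / 2 + r * \<i> * E"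
      by (simp add: u_chart_def u0_def E_def r_def)
    then have "- \<i> * u_chart d = r / 2 - \<i> / 2 + r * E"
      by (simp add: complex_eq_iff field_simps)
    then have "- \<i> * u_chart d / r = 1 / 2 - \<i> / (2 * r) + E"
      using \<open>r \<noteq> 0\<close> by (simp add: add_divide_distrib diff_divide_distrib)
    then show ?thesis by (simp add: r_def E_def)
  qed
  finally show ?thesis .
qed

lemma T_chart_holomorphic:
  assumes "\<And>d. d \<in> A \<Longrightarrow> 1 - exp (- d) \<notin> \<real>\<^sub>\<le>\<^sub>0"
  shows "T_chart holomorphic_on A"
  using assms has_field_derivative_T_chart holomorphic_on_def field_differentiable_def by blast

lemma isCont_T_chart:
  assumes "Re d \<ge> 0" "exp d \<noteq> 1"
  shows "isCont T_chart d"
  using has_field_derivative_T_chart[OF one_minus_exp_notin_nonpos_Reals[OF assms]]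
  by (rule DERIV_isCont)

lemma isCont_u_chart:
  assumes "exp d \<noteq> 1"
  shows "isCont u_chart d"
  unfolding u_chart_def using assms by (auto intro!: continuous_intros)

text \<open>Re d = ln |exp d| compares the distances of u from cnj \<open>u0\<close> and from
  \<open>u0\<close>, so the sides of Re d = 0 correspond to the sides of the real axis.\<close>

lemma Im_u_chart:
  assumes "exp d \<noteq> 1"
  shows "Im (u_chart d) = sqrt 3 / 2 * (exp (2 * Re d) - 1) / (norm (exp d - 1))\<^sup>2"
proof -
  define a b where "a = Re (exp d)" and "b = Im (exp d)"
  have n: "a\<^sup>2 + b\<^sup>2 = exp (2 * Re d)"
    unfolding a_def b_def cmod_power2[symmetric] by (simp add: exp_double)
  have N: "(norm (exp d - 1))\<^sup>2 = (a - 1)\<^sup>2 + b\<^sup>2"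
    by (simp add: cmod_power2 a_def b_def)
  have pos: "(a - 1)\<^sup>2 + b\<^sup>2 \<noteq> 0"
    using assms by (metis N norm_eq_zero right_minus_eq zero_eq_power2)
  have "Im (u_chart d) = sqrt 3 / 2 + sqrt 3 * (a - 1) / ((a - 1)\<^sup>2 + b\<^sup>2)"
    by (simp add: u_chart_def Im_divide a_def b_def)
  also have "\<dots> = sqrt 3 / 2 * ((a\<^sup>2 + b\<^sup>2) - 1) / ((a - 1)\<^sup>2 + b\<^sup>2)"
    using pos by (simp add: field_simps power2_eq_square)
  finally show ?thesis by (simp add: n N)
qed

lemma Im_u_chart_pos_iff:
  assumes "exp d \<noteq> 1"
  shows "Im (u_chart d) > 0 \<longleftrightarrow> Re d > 0"
  using assms by (simp add: Im_u_chart zero_less_divide_iff zero_less_mult_iff)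

lemma Im_u_chart_eq_0_iff:
  assumes "exp d \<noteq> 1"
  shows "Im (u_chart d) = 0 \<longleftrightarrow> Re d = 0"
  using assms by (simp add: Im_u_chart)

lemma exp_neq_1_of_Re_pos: "Re d > 0 \<Longrightarrow> exp d \<noteq> (1::complex)"
  by (metis norm_exp_eq_Re norm_one one_less_exp_iff order_less_irrefl)

text \<open>The derivative of \<^term>\<open>T_chart\<close> has positive real part on the open half-plane, so the map is
  injective there (Noshiro--Warschawski), and up to the boundary except along the boundary line.\<close>

lemma T_chart_monotone:
  assumes "Re d \<ge> 0" "exp d \<noteq> 1" "Re e \<ge> 0" "exp e \<noteq> 1" "Re d > 0 \<or> Re e > 0"
    and ne: "d \<noteq> e"
  shows "Re (cnj (e - d) * (T_chart e - T_chart d)) > 0"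
proof -
  define p where "p t = d + of_real t * (e - d)" for t :: real
  define f where "f t = Re (cnj (e - d) * T_chart (p t))" for t
  have Rep: "Re (p t) > 0" if "0 < t" "t < 1" for t
  proof -
    have "Re (p t) = (1 - t) * Re d + t * Re e" by (simp add: p_def algebra_simps)
    moreover have "(1 - t) * Re d \<ge> 0" "t * Re e \<ge> 0" using that assms by auto
    moreover have "(1 - t) * Re d > 0 \<or> t * Re e > 0" using that assms by auto
    ultimately show ?thesis by linarith
  qed
  have cont: "continuous_on {0..1} f"
  proof (rule continuous_at_imp_continuous_on, rule)
    fix t :: real assume "t \<in> {0..1}"
    \<comment> \<open>Only an endpoint of the segment can lie on the line Re = 0, and there the
      hypotheses exclude exp = 1.\<close>
    then consider "t = 0" | "t = 1" | "0 < t" "t < 1" by fastforce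
    then have "Re (p t) \<ge> 0 \<and> exp (p t) \<noteq> 1"
      by cases (use assms Rep exp_neq_1_of_Re_pos in \<open>auto simp: p_def less_imp_le\<close>)
    then have *: "isCont T_chart (p t)" using isCont_T_chart by blast
    have "isCont p t" unfolding p_def by (intro continuous_intros)
    then have "isCont (\<lambda>t. T_chart (p t)) t" using * by (rule isCont_o2)
    then have "isCont (\<lambda>t. cnj (e - d) * T_chart (p t)) t" by (intro continuous_intros)
    then show "isCont f t" unfolding f_def by (rule continuous_Re)
  qed
  have der: "(f has_real_derivative (norm (e - d))\<^sup>2 * Im (u_chart (p t)) / sqrt 3) (at t)"
    if t: "0 < t" "t < 1" for t
  proof -
    have a: "(T_chart has_field_derivative - \<i> * u_chart (p t) / of_real (sqrt 3)) (at (p t))"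
      using has_field_derivative_T_chart one_minus_exp_notin_nonpos_Reals Rep[OF t]
        exp_neq_1_of_Re_pos by (meson less_imp_le)
    have *: "Re (of_real a * (- \<i> * w / of_real (sqrt 3))) = a * Im w / sqrt 3" for a w
      by (simp add: Re_divide_of_real)
    have b: "(p has_vector_derivative (e - d)) (at t)"
      unfolding p_def by (auto intro!: derivative_eq_intros simp: has_vector_derivative_def scaleR_conv_of_real)
    have c: "((\<lambda>t. T_chart (p t)) has_vector_derivative
         (e - d) * (- \<i> * u_chart (p t) / of_real (sqrt 3))) (at t)"
      using field_vector_diff_chain_at[OF b a] by (simp add: o_def)
    have "((\<lambda>t. cnj (e - d) * T_chart (p t)) has_vector_derivative
         cnj (e - d) * ((e - d) * (- \<i> * u_chart (p t) / of_real (sqrt 3)))) (at t)"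
      by (rule has_vector_derivative_mult_right[OF c])
    then have "(f has_real_derivative
        Re (cnj (e - d) * ((e - d) * (- \<i> * u_chart (p t) / of_real (sqrt 3))))) (at t)"
      unfolding f_def has_real_derivative_iff_has_vector_derivative
      by (rule bounded_linear.has_vector_derivative[OF bounded_linear_Re])
    also have "cnj (e - d) * ((e - d) * (- \<i> * u_chart (p t) / of_real (sqrt 3)))
       = of_real ((norm (e - d))\<^sup>2) * (- \<i> * u_chart (p t) / of_real (sqrt 3))"
      by (simp only: complex_norm_square mult_ac)
    also have "Re \<dots> = (norm (e - d))\<^sup>2 * Im (u_chart (p t)) / sqrt 3"
      by (rule *)
    finally show ?thesis .
  qed
  have "f 0 < f 1"
  proof (rule DERIV_pos_imp_increasing_open[OF _ _ cont])
    fix t :: real assume t: "0 < t" "t < 1"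
    have "Im (u_chart (p t)) > 0"
      using Im_u_chart_pos_iff exp_neq_1_of_Re_pos Rep[OF t] by blast
    then show "\<exists>y. DERIV f t :> y \<and> 0 < y"
      using der[OF t] ne by (intro exI[of _ "(norm (e - d))\<^sup>2 * Im (u_chart (p t)) / sqrt 3"] conjI) auto
  qed simp
  then show ?thesis by (simp add: f_def p_def algebra_simps)
qed

lemma T_chart_inj:
  assumes "Re d \<ge> 0" "exp d \<noteq> 1" "Re e \<ge> 0" "exp e \<noteq> 1" "Re d > 0 \<or> Re e > 0"
    and "T_chart d = T_chart e"
  shows "d = e"
  using T_chart_monotone[OF assms(1-5)] assms(6) by fastforce

text \<open>For purely imaginary e - d the real part in \<open>T_chart_monotone\<close> involves
  only the difference of the imaginary parts of T.\<close>

lemma T_chart_inj_vertical: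
  assumes "Re d > 0" "Re e = Re d" "Im (T_chart d) = Im (T_chart e)"
  shows "d = e"
proof (rule ccontr)
  assume "d \<noteq> e"
  then have "Re (cnj (e - d) * (T_chart e - T_chart d)) > 0"
    using assms exp_neq_1_of_Re_pos by (intro T_chart_monotone) auto
  then show False using assms by simp
qed

text \<open>In polar form 1 - exp (- i \<theta>) has modulus 2 sin (\<theta> / 2) and argument pi /
  2 - \<theta> / 2, which cancels the other imaginary terms of \<open>T_chart\<close>.\<close>

lemma Im_T_chart_axis:
  assumes "0 < \<theta>" "\<theta> < 2 * pi"
  shows "Im (T_chart (\<i> * of_real \<theta>)) = 0"
proof -
  have s: "sin (\<theta> / 2) > 0" using assms by (intro sin_gt_zero) auto
  have "1 - exp (- (\<i> * of_real \<theta>)) = of_real (2 * sin (\<theta> / 2)) * exp (\<i> * of_real (pi / 2 - \<theta> / 2))"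
    using sin_double[of "\<theta> / 2"] cos_double_sin[of "\<theta> / 2"]
    by (simp add: complex_eq_iff Re_exp Im_exp cos_diff sin_diff power2_eq_square)
  then have "Ln (1 - exp (- (\<i> * of_real \<theta>)))
      = of_real (ln (2 * sin (\<theta> / 2))) + Ln (exp (\<i> * of_real (pi / 2 - \<theta> / 2)))"
    using s by (simp only: Ln_times_of_real[OF _ exp_not_eq_zero] Ln_of_real mult_pos_pos zero_less_numeral)
  also have "Ln (exp (\<i> * of_real (pi / 2 - \<theta> / 2))) = \<i> * of_real (pi / 2 - \<theta> / 2)"
    by (rule Ln_exp) (use assms in auto)
  finally show ?thesis by (simp add: T_chart_def)
qed

text \<open>The logarithmic term is periodic, so only the linear part changes. The jump of Im T by
  pi distinguishes the sheets of \<open>u_chart\<close>.\<close>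

lemma T_chart_add_2pi:
  "T_chart (d + 2 * of_int k * of_real pi * \<i>)
    = T_chart d + of_int k * (of_real pi * \<i> + of_real (pi / sqrt 3))"
proof -
  define D where "D = 2 * of_int k * of_real pi * \<i>"
  have "exp D = 1"
    unfolding D_def using exp_integer_2pi[OF Ints_of_int, of k] by simp
  then have e: "exp (- (d + D)) = exp (- d)" by (simp add: exp_minus exp_diff field_simps)
  have "T_chart (d + D) = T_chart d + (D / 2 - \<i> * D / (2 * of_real (sqrt 3)))"
    unfolding T_chart_def e by (simp only: add_divide_distrib distrib_left) (simp only: algebra_simps)
  also have "D / 2 - \<i> * D / (2 * of_real (sqrt 3)) = of_int k * (of_real pi * \<i> + of_real (pi / sqrt 3))"
    by (simp add: D_def complex_eq_iff Re_divide_of_real Im_divide_of_real)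
  finally show ?thesis by (simp only: D_def)
qed

section \<open>The domain Delta in the coordinate d\<close>

definition chart_domain :: "complex set" where
  "chart_domain = {d. Re d > 0 \<and> - pi / 2 < Im (T_chart d) \<and> Im (T_chart d) < 0}"

text \<open>Solving \<open>u_chart d = g_curve \<eta> \<xi>\<close> gives \<open>exp d = (E - R\<^sup>2) / (E - 1)\<close> with \<open>E = R exp (\<i> \<xi>)\<close>; the branch of
  the logarithm is the continuous one, and \<open>a = ln R\<close> replaces \<open>\<xi>\<close> as parameter.\<close>

definition chart_param :: "real \<Rightarrow> real \<Rightarrow> complex" where
  "chart_param \<eta> a = (let \<xi> = - a / sqrt 3 - \<eta>
     in Complex a (pi - \<xi> + 2 * Im (Ln (1 - exp (Complex (- a) \<xi>)))))"

text \<open>1 - exp (- d) is a positive multiple of 1 / w with w = 1 - exp (Complex (- a) \<xi>), so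
  the two contributions of Im (Ln w) to Im (T_chart d) cancel and a linear expression remains. Each
  \<open>Gamma_curve\<close> thus is a level line of Im T, and - pi < \<eta> < 0 becomes the strip
  condition of \<open>chart_domain\<close>.\<close>

lemma chart_param:
  assumes a: "a > 0"
  shows "Re (chart_param \<eta> a) = a"
    and "u_chart (chart_param \<eta> a) = g_curve \<eta> (- a / sqrt 3 - \<eta>)"
    and "Im (T_chart (chart_param \<eta> a)) = \<eta> / 2"
proof -
  define \<xi> where "\<xi> = - a / sqrt 3 - \<eta>"
  define q where "q = exp (Complex (- a) \<xi>)"
  define E where "E = exp (Complex a \<xi>)"
  define R where "R = complex_of_real (exp a)"
  define w where "w = 1 - q"
  define d where "d = Complex a (pi - \<xi> + 2 * Im (Ln w))"
  have d: "chart_param \<eta> a = d"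
    by (simp add: chart_param_def d_def w_def q_def \<xi>_def Let_def)
  have R0: "R \<noteq> 0" by (simp add: R_def)
  have q1: "norm q < 1" using a by (simp add: q_def)
  have Rew: "Re w > 0"
    using complex_Re_le_cmod[of q] q1 unfolding w_def by simp
  then have w0: "w \<noteq> 0" by auto
  have wn: "w \<notin> \<real>\<^sub>\<le>\<^sub>0" using Rew by (auto simp: complex_nonpos_Reals_iff)
  have ER: "R\<^sup>2 = E * cnj E"
    unfolding R_def E_def exp_cnj exp_of_real[symmetric] power2_eq_square exp_add[symmetric]
    by (rule arg_cong[of _ _ exp]) (simp add: complex_eq_iff)
  have E0: "E \<noteq> 0" by (simp add: E_def)
  have qE: "q = E / R\<^sup>2"
  proof -
    have "q * R * R = E"
      unfolding q_def R_def E_def exp_of_real[symmetric] exp_add[symmetric]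
      by (rule arg_cong[of _ _ exp]) (simp add: complex_eq_iff)
    then show ?thesis using R0 by (simp add: field_simps power2_eq_square)
  qed
  have normE: "norm E > 1" using a by (simp add: E_def)
  then have E1: "E \<noteq> 1" by auto
  have wE: "w = (cnj E - 1) / cnj E"
    unfolding w_def qE ER using E0 by (simp add: field_simps)
  have R2: "R\<^sup>2 \<noteq> E"
  proof
    assume "R\<^sup>2 = E"
    then have "cnj E = 1" unfolding ER using E0 by simp
    then show False using E1 by (metis complex_cnj_cancel_iff complex_cnj_one)
  qed
  have expd: "exp d = (E - R\<^sup>2) / (E - 1)"
  proof -
    \<comment> \<open>Writing the summand from 2 Im (Ln w) as Ln w - cnj (Ln w) makes it
      exponentiate to w / cnj w.\<close>
    have "d = (Complex a (- \<xi>) + \<i> * pi) + (Ln w - cnj (Ln w))"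
      by (simp add: d_def complex_eq_iff)
    then have "exp d = exp (Complex a (- \<xi>)) * exp (\<i> * pi) * (exp (Ln w) / exp (cnj (Ln w)))"
      by (simp only: exp_add exp_diff)
    also have "exp (Complex a (- \<xi>)) = cnj E"
      unfolding E_def exp_cnj by (rule arg_cong[of _ _ exp]) (simp add: complex_eq_iff)
    also have "exp (\<i> * complex_of_real pi) = - 1" by (rule exp_pi_i')
    also have "exp (cnj (Ln w)) = cnj w" using w0 exp_cnj[of "Ln w"] by simp
    also have "exp (Ln w) = w" using w0 by simp
    also have "cnj E * - 1 * (w / cnj w) = (E - R\<^sup>2) / (E - 1)"
      unfolding wE ER using E0 E1 by (simp add: field_simps)
    finally show ?thesis .
  qed
  have em: "exp d - 1 = (1 - R\<^sup>2) / (E - 1)"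
    unfolding expd using E1 by (simp add: field_simps)
  have R1: "R\<^sup>2 \<noteq> 1"
    using a by (simp add: R_def flip: of_real_power exp_double)
  show "Re (chart_param \<eta> a) = a" unfolding d by (simp add: d_def)
  have s3: "sqrt 3 * (\<eta> + \<xi>) = - a" by (simp add: \<xi>_def)
  have "E = R * exp (\<i> * of_real \<xi>)"
    unfolding E_def R_def exp_of_real[symmetric] exp_add[symmetric]
    by (rule arg_cong[of _ _ exp]) (simp add: complex_eq_iff)
  then have "g_curve \<eta> \<xi> = of_real (sqrt 3) * \<i> * (E - 1) / (1 - R\<^sup>2) + u0"
    by (simp add: g_curve_def Let_def R_def s3)
  then show "u_chart (chart_param \<eta> a) = g_curve \<eta> (- a / sqrt 3 - \<eta>)"
    unfolding d \<xi>_def[symmetric] by (simp add: u_chart_def em)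
  have "1 - exp (- d) = (1 - R\<^sup>2) / (E - R\<^sup>2)"
    unfolding exp_minus expd using E1 R2 by (simp add: field_simps)
  also have "\<dots> = of_real (1 - 1 / (exp a)\<^sup>2) * inverse w"
  proof -
    have "complex_of_real (1 - 1 / (exp a)\<^sup>2) = 1 - 1 / R\<^sup>2" by (simp add: R_def)
    moreover have "w = (R\<^sup>2 - E) / R\<^sup>2" unfolding w_def qE using R0 by (simp add: field_simps)
    moreover have "(1 - r) / (E - r) = (1 - 1 / r) * inverse ((r - E) / r)" if "r \<noteq> 0" "r \<noteq> E" for r
      using that by (simp add: field_simps)
    ultimately show ?thesis using R0 R2 by simp
  qed
  finally have "1 - exp (- d) = of_real (1 - 1 / (exp a)\<^sup>2) * inverse w" .
  moreover have "1 - 1 / (exp a)\<^sup>2 > 0" using a by (simp flip: exp_double)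
  ultimately have "Im (Ln (1 - exp (- d))) = - Im (Ln w)"
    using w0 wn by (simp add: Ln_times_of_real Ln_inverse Ln_of_real del: of_real_diff)
  then have "Im (T_chart d) = (pi - \<xi> + 2 * Im (Ln w)) / 2 - a / (2 * sqrt 3) - Im (Ln w) - pi / 2"
    by (simp add: T_chart_def d_def Im_divide_of_real)
  also have "a / (2 * sqrt 3) = (- \<eta> - \<xi>) / 2" by (simp add: \<xi>_def)
  finally show "Im (T_chart (chart_param \<eta> a)) = \<eta> / 2"
    unfolding d by (simp add: field_simps)
qed

text \<open>A point d and the parametrised point with a = Re d and \<eta> = 2 Im (T_chart d) share
  their real part and Im T, so \<open>T_chart_inj_vertical\<close> identifies them. The rectangular
  parameter set later yields connectedness.\<close>

lemma chart_domain_eq: "chart_domain = (\<lambda>(\<eta>, a). chart_param \<eta> a) ` ({- pi<..<0} \<times> {0<..})"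
proof
  show "chart_domain \<subseteq> (\<lambda>(\<eta>, a). chart_param \<eta> a) ` ({- pi<..<0} \<times> {0<..})"
  proof
    fix d assume d: "d \<in> chart_domain"
    define e where "e = chart_param (2 * Im (T_chart d)) (Re d)"
    have "Re d > 0" using d by (simp add: chart_domain_def)
    then have "d = e"
      by (intro T_chart_inj_vertical) (simp_all add: e_def chart_param)
    then show "d \<in> (\<lambda>(\<eta>, a). chart_param \<eta> a) ` ({- pi<..<0} \<times> {0<..})"
      using d unfolding e_def
      by (intro image_eqI[of _ _ "(2 * Im (T_chart d), Re d)"]) (auto simp: chart_domain_def)
  qed
qed (auto simp: chart_domain_def chart_param)

lemma Delta_domain_eq: "Delta_domain = u_chart ` chart_domain"
proof (intro equalityI subsetI)
  fix u assume "u \<in> Delta_domain"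
  then obtain \<eta> \<xi> where \<eta>: "\<eta> \<in> {- pi<..<0}" "\<xi> < - \<eta>" "u = g_curve \<eta> \<xi>"
    by (auto simp: Delta_domain_def Gamma_curve_def)
  define a where "a = - (sqrt 3 * (\<eta> + \<xi>))"
  have "\<xi> = - a / sqrt 3 - \<eta>" "a > 0"
    using \<eta> by (simp_all add: a_def mult_pos_neg)
  then have "u = u_chart (chart_param \<eta> a)" using \<eta> chart_param(2) by metis
  moreover have "chart_param \<eta> a \<in> chart_domain"
    unfolding chart_domain_eq using \<eta> \<open>a > 0\<close> by (intro image_eqI[of _ _ "(\<eta>, a)"]) auto
  ultimately show "u \<in> u_chart ` chart_domain" by blast
next
  fix u assume "u \<in> u_chart ` chart_domain"
  then obtain \<eta> a where "\<eta> \<in> {- pi<..<0}" "a > 0" "u = u_chart (chart_param \<eta> a)"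
    unfolding chart_domain_eq by auto
  then have "\<eta> \<in> {- pi<..<0} \<and> u = g_curve \<eta> (- a / sqrt 3 - \<eta>) \<and> - a / sqrt 3 - \<eta> < - \<eta>"
    by (simp add: chart_param)
  then show "u \<in> Delta_domain" unfolding Delta_domain_def Gamma_curve_def by blast
qed

lemma connected_chart_domain: "connected chart_domain"
proof -
  have "continuous_on ({- pi<..<0} \<times> {0<..}) (\<lambda>z. chart_param (fst z) (snd z))"
  proof -
    have n: "1 - exp (Complex (- snd z) (- snd z / sqrt 3 - fst z)) \<notin> \<real>\<^sub>\<le>\<^sub>0"
      if "z \<in> {- pi<..<0} \<times> {0<..}" for z
    proof -
      have "norm (exp (Complex (- snd z) (- snd z / sqrt 3 - fst z))) < 1" using that by auto
      then have "Re (1 - exp (Complex (- snd z) (- snd z / sqrt 3 - fst z))) > 0"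
        using complex_Re_le_cmod[of "exp (Complex (- snd z) (- snd z / sqrt 3 - fst z))"]
        unfolding minus_complex.sel one_complex.sel by linarith
      then show ?thesis unfolding complex_nonpos_Reals_iff by linarith
    qed
    show ?thesis unfolding chart_param_def Let_def using n
      by (intro continuous_intros) auto
  qed
  moreover have "connected ({- pi<..<0} \<times> {0::real<..})"
    by (intro connected_Times) auto
  ultimately show ?thesis
    unfolding chart_domain_eq case_prod_unfold by (rule connected_continuous_image)
qed

lemma T_chart_holomorphic_right: "T_chart holomorphic_on {d. Re d > 0}"
  using one_minus_exp_notin_nonpos_Reals exp_neq_1_of_Re_pos
  by (intro T_chart_holomorphic) auto

lemma open_chart_domain: "open chart_domain"
proof -
  have "open {w. - pi / 2 < Im w \<and> Im w < 0}"
    by (intro open_Collect_conj open_Collect_less continuous_intros)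
  then have "open ({d. Re d > 0} \<inter> T_chart -` {w. - pi / 2 < Im w \<and> Im w < 0})"
    by (intro continuous_open_preimage holomorphic_on_imp_continuous_on[OF T_chart_holomorphic_right]
        open_halfspace_Re_gt)
  also have "{d. Re d > 0} \<inter> T_chart -` {w. - pi / 2 < Im w \<and> Im w < 0} = chart_domain"
    by (auto simp: chart_domain_def)
  finally show ?thesis .
qed

lemma chart_domain_exp_neq_1: "d \<in> chart_domain \<Longrightarrow> exp d \<noteq> 1"
  by (intro exp_neq_1_of_Re_pos) (simp add: chart_domain_def)

text \<open>On the axis between \<open>0\<close> and \<open>2 \<pi> \<i>\<close>, \<^term>\<open>u_chart\<close> is real and \<^term>\<open>T_chart\<close> is real, while
  \<^term>\<open>T_chart\<close> has derivative \<open>- \<i> u_chart / sqrt 3\<close>; the sign of the imaginary part next to the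
  axis is therefore governed by the sign of \<^term>\<open>u_chart\<close>.\<close>

lemma T_chart_sign_near_axis:
  assumes \<theta>: "0 < \<theta>" "\<theta> < 2 * pi" and u: "Re (u_chart (\<i> * of_real \<theta>)) \<noteq> 0"
  obtains \<epsilon> where "\<epsilon> > 0"
    "\<And>d. dist d (\<i> * of_real \<theta>) < \<epsilon> \<Longrightarrow> Re d = 0 \<Longrightarrow> Im (T_chart d) = 0"
    "\<And>d. dist d (\<i> * of_real \<theta>) < \<epsilon> \<Longrightarrow> Re d \<noteq> 0 \<Longrightarrow>
       Im (T_chart d) * (Re d * Re (u_chart (\<i> * of_real \<theta>))) < 0"
proof -
  define d0 where "d0 = \<i> * complex_of_real \<theta>"
  define c where "c = Re (u_chart d0)"
  have axis: "exp (\<i> * complex_of_real y) \<noteq> 1" if "0 < y" "y < 2 * pi" for y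
  proof
    assume "exp (\<i> * complex_of_real y) = 1"
    then obtain n :: int where "y = of_int (2 * n) * pi" by (auto simp: exp_eq_1)
    then have "0 < real_of_int n" "real_of_int n < 1" using that by (auto simp: zero_less_mult_iff)
    then show False by simp
  qed
  have ne: "exp d0 \<noteq> 1" using axis[OF \<theta>] by (simp add: d0_def)
  have "isCont (\<lambda>d. Re (1 - exp (- d))) d0" "Re (1 - exp (- d0)) > 0"
    using Re_one_minus_exp_pos[of d0] ne by (auto intro!: continuous_intros simp: d0_def)
  then have "\<forall>\<^sub>F d in nhds d0. Re (1 - exp (- d)) > 0"
    by (metis order_tendstoD(1) isContD tendsto_at_iff_tendsto_nhds)
  moreover have "\<forall>\<^sub>F d in nhds d0. Re (u_chart d) * c > 0"
  proof -
    have "isCont (\<lambda>d. Re (u_chart d) * c) d0"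
      using isCont_u_chart[OF ne] by (intro continuous_intros continuous_Re)
    then have "((\<lambda>d. Re (u_chart d) * c) \<longlongrightarrow> Re (u_chart d0) * c) (nhds d0)"
      using tendsto_at_iff_tendsto_nhds[of "\<lambda>d. Re (u_chart d) * c" d0] by (simp only: isCont_def)
    moreover have "Re (u_chart d0) * c > 0"
      using u by (simp add: c_def d0_def zero_less_mult_iff linorder_neq_iff disj_commute)
    ultimately show ?thesis by (rule order_tendstoD(1))
  qed
  moreover have "\<forall>\<^sub>F d in nhds d0. Im d > 0" "\<forall>\<^sub>F d in nhds d0. Im d < 2 * pi"
    using \<theta> eventually_nhds_in_open[OF open_halfspace_Im_gt, of d0 0]
      eventually_nhds_in_open[OF open_halfspace_Im_lt, of d0 "2 * pi"] by (simp_all add: d0_def)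
  \<comment> \<open>The neighbourhood reaches into Re d < 0, where Re (1 - exp (- d)) > 0 is not
    automatic and has to be secured for the differentiability of \<open>T_chart\<close>.\<close>
  ultimately have "\<forall>\<^sub>F d in nhds d0. Re (1 - exp (- d)) > 0 \<and> Re (u_chart d) * c > 0 \<and> Im d > 0 \<and> Im d < 2 * pi"
    by eventually_elim auto
  then obtain \<epsilon> where \<epsilon>: "\<epsilon> > 0" "\<And>d. dist d d0 < \<epsilon> \<Longrightarrow> Re (1 - exp (- d)) > 0"
    "\<And>d. dist d d0 < \<epsilon> \<Longrightarrow> Re (u_chart d) * c > 0"
    "\<And>d. dist d d0 < \<epsilon> \<Longrightarrow> 0 < Im d \<and> Im d < 2 * pi"
    unfolding eventually_nhds_metric by blast
  show thesis
  proof (rule that[OF \<epsilon>(1)])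
    fix d assume "dist d (\<i> * of_real \<theta>) < \<epsilon>" and Re0: "Re d = 0"
    then have "0 < Im d \<and> Im d < 2 * pi" using \<epsilon>(4) by (simp add: d0_def)
    moreover have "d = \<i> * of_real (Im d)" using Re0 by (simp add: complex_eq_iff)
    ultimately show "Im (T_chart d) = 0" using Im_T_chart_axis by metis
  next
    fix d assume d: "dist d (\<i> * of_real \<theta>) < \<epsilon>" and Re0: "Re d \<noteq> 0"
    \<comment> \<open>The horizontal segment from the axis to d: Im T vanishes at its start, and the
      mean value theorem gives the sign at its end.\<close>
    define p where "p t = \<i> * of_real (Im d) + of_real t * of_real (Re d)" for t :: real
    have p: "dist (p t) d0 < \<epsilon>" if "0 \<le> t" "t \<le> 1" for t
    proof -
      have "norm (p t - d0) \<le> norm (d - d0)" unfolding cmod_def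
      proof (intro real_sqrt_le_mono add_mono)
        show "(Re (p t - d0))\<^sup>2 \<le> (Re (d - d0))\<^sup>2"
          using that by (simp add: p_def d0_def power_mult_distrib mult_left_le_one_le power_le_one)
      qed (simp add: p_def d0_def)
      then show ?thesis using d by (simp add: dist_norm d0_def)
    qed
    have der: "((\<lambda>t. Im (T_chart (p t))) has_real_derivative Re d * - (Re (u_chart (p t)) / sqrt 3)) (at t)"
      if "0 \<le> t" "t \<le> 1" for t
    proof -
      have "1 - exp (- p t) \<notin> \<real>\<^sub>\<le>\<^sub>0" using \<epsilon>(2)[OF p[OF that]] by (auto simp: complex_nonpos_Reals_iff)
      then have a: "(T_chart has_field_derivative - \<i> * u_chart (p t) / of_real (sqrt 3)) (at (p t))"
        by (rule has_field_derivative_T_chart)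
      have b: "(p has_vector_derivative of_real (Re d)) (at t)"
        unfolding p_def has_vector_derivative_def
        by (auto intro!: derivative_eq_intros simp: scaleR_conv_of_real)
      have "((\<lambda>t. T_chart (p t)) has_vector_derivative
          of_real (Re d) * (- \<i> * u_chart (p t) / of_real (sqrt 3))) (at t)"
        using field_vector_diff_chain_at[OF b a] by (simp add: o_def)
      then have "((\<lambda>t. Im (T_chart (p t))) has_vector_derivative
          Im (of_real (Re d) * (- \<i> * u_chart (p t) / of_real (sqrt 3)))) (at t)"
        by (rule bounded_linear.has_vector_derivative[OF bounded_linear_Im])
      then show ?thesis
        by (simp add: has_real_derivative_iff_has_vector_derivative Im_divide_of_real)
    qed
    obtain t where t: "0 < t" "t < 1"
      "Im (T_chart (p 1)) - Im (T_chart (p 0)) = (1 - 0) * (Re d * - (Re (u_chart (p t)) / sqrt 3))"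
      using MVT2[of 0 1 "\<lambda>t. Im (T_chart (p t))" "\<lambda>t. Re d * - (Re (u_chart (p t)) / sqrt 3)"] der by auto
    have "0 < Im d \<and> Im d < 2 * pi" using \<epsilon>(4) d by (simp add: d0_def)
    then have "Im (T_chart (p 0)) = 0" using Im_T_chart_axis by (simp add: p_def)
    moreover have "p 1 = d" by (simp add: p_def complex_eq_iff)
    ultimately have "Im (T_chart d) * (Re d * c) = - ((Re d)\<^sup>2 * (Re (u_chart (p t)) * c) / sqrt 3)"
      using t(3) by (simp add: power2_eq_square)
    also have "\<dots> < 0" using \<epsilon>(3)[OF p[of t]] t Re0 by simp
    finally show "Im (T_chart d) * (Re d * Re (u_chart (\<i> * of_real \<theta>))) < 0" by (simp add: c_def d0_def)
  qed
qed

section \<open>Identification and injectivity of T\<close>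

text \<open>A local inverse of \<open>u_chart\<close> on Re u > 1 / 2, where the quotient has
  positive imaginary part and avoids the cut. This half-plane contains the normalisation point u =
  1.\<close>

definition right_chart :: "complex \<Rightarrow> complex" where
  "right_chart u = Ln ((u - cnj u0) / (u - u0))"

lemma u0_minus_cnj_u0: "u0 - cnj u0 = of_real (sqrt 3) * \<i>"
  by (simp add: complex_eq_iff)

lemma u0_quadratic: "(u - u0) * (u - cnj u0) = u\<^sup>2 - u + 1"
proof -
  have "u0 + cnj u0 = 1" by (simp add: complex_eq_iff)
  moreover have "u0 * cnj u0 = 1" by (simp add: complex_eq_iff)
  moreover have "(u - u0) * (u - cnj u0) = u\<^sup>2 - (u0 + cnj u0) * u + u0 * cnj u0"
    by (simp add: algebra_simps power2_eq_square)
  ultimately show ?thesis by simp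
qed

context
  fixes u :: complex
  assumes u: "Re u > 1 / 2"
begin

lemma right_neq: "u \<noteq> u0" "u \<noteq> cnj u0"
  using u by auto

lemma Im_cayley_pos: "Im ((u - cnj u0) / (u - u0)) > 0"
proof -
  have "(Re (u - u0))\<^sup>2 + (Im (u - u0))\<^sup>2 > 0"
    using u by (intro add_pos_nonneg) auto
  moreover have "Im (u - cnj u0) * Re (u - u0) - Re (u - cnj u0) * Im (u - u0) = sqrt 3 * (Re u - 1 / 2)"
    by (simp add: algebra_simps)
  ultimately show ?thesis using u unfolding Im_divide by simp
qed

lemma exp_right_chart: "exp (right_chart u) = (u - cnj u0) / (u - u0)"
  using right_neq by (simp add: right_chart_def)

lemma u_chart_right_chart: "u_chart (right_chart u) = u"
proof -
  have "exp (right_chart u) - 1 = (u0 - cnj u0) / (u - u0)"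
    unfolding exp_right_chart using right_neq by (simp add: field_simps)
  then have "u_chart (right_chart u) = u0 + (u0 - cnj u0) / ((u0 - cnj u0) / (u - u0))"
    by (simp only: u_chart_def u0_minus_cnj_u0)
  also have "\<dots> = u" using right_neq u0_minus_cnj_u0 by simp
  finally show ?thesis .
qed

lemma exp_right_chart_neq_1: "exp (right_chart u) \<noteq> 1"
  using Im_cayley_pos unfolding exp_right_chart by (metis less_irrefl one_complex.sel(2))

lemma Im_right_chart: "0 < Im (right_chart u)" "Im (right_chart u) < pi"
  using Im_cayley_pos Im_Ln_pos_lt[of "(u - cnj u0) / (u - u0)"]
  unfolding right_chart_def by force+

lemma Re_right_chart_pos_iff: "Re (right_chart u) > 0 \<longleftrightarrow> Im u > 0"
  using Im_u_chart_pos_iff[OF exp_right_chart_neq_1] by (simp add: u_chart_right_chart)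

text \<open>\<open>Re_one_minus_exp_pos\<close> covers only Re d \<ge> 0, that is Im u \<ge> 0. For
  the full half-plane Re u > 1 / 2 the point is kept off the cut by its positive imaginary
  part.\<close>

lemma one_minus_exp_right_chart: "1 - exp (- right_chart u) \<notin> \<real>\<^sub>\<le>\<^sub>0"
proof -
  have "1 - exp (- right_chart u) = (u0 - cnj u0) / (u - cnj u0)"
    unfolding exp_minus exp_right_chart using right_neq by (simp add: field_simps)
  also have "Im \<dots> = sqrt 3 * (Re u - 1 / 2) / ((Re (u - cnj u0))\<^sup>2 + (Im (u - cnj u0))\<^sup>2)"
    unfolding u0_minus_cnj_u0 Im_divide by simp
  also have "\<dots> > 0"
    using u by (intro divide_pos_pos mult_pos_pos add_pos_nonneg) auto
  finally show ?thesis by (auto simp: complex_nonpos_Reals_iff)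
qed

lemma has_field_derivative_right_chart:
  "(right_chart has_field_derivative - (of_real (sqrt 3) * \<i>) / (u\<^sup>2 - u + 1)) (at u)"
proof -
  have n: "(u - cnj u0) / (u - u0) \<notin> \<real>\<^sub>\<le>\<^sub>0"
    using Im_cayley_pos by (auto simp: complex_nonpos_Reals_iff)
  have "((\<lambda>u. (u - cnj u0) / (u - u0)) has_field_derivative
      ((1 - 0) * (u - u0) - (u - cnj u0) * (1 - 0)) / ((u - u0) * (u - u0))) (at u)"
    using right_neq by (intro DERIV_divide DERIV_diff DERIV_ident DERIV_const) auto
  from DERIV_chain2[OF has_field_derivative_Ln[OF n] this]
  have "(right_chart has_field_derivative inverse ((u - cnj u0) / (u - u0)) *
      (((1 - 0) * (u - u0) - (u - cnj u0) * (1 - 0)) / ((u - u0) * (u - u0)))) (at u)"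
    unfolding right_chart_def[abs_def] .
  also have "inverse ((u - cnj u0) / (u - u0)) *
      (((1 - 0) * (u - u0) - (u - cnj u0) * (1 - 0)) / ((u - u0) * (u - u0)))
      = - (u0 - cnj u0) / ((u - u0) * (u - cnj u0))"
    using right_neq by (simp add: divide_simps)
  finally show ?thesis unfolding u0_quadratic u0_minus_cnj_u0 .
qed

lemma has_field_derivative_T_right_chart:
  "((\<lambda>u. T_chart (right_chart u)) has_field_derivative - (u / (u\<^sup>2 - u + 1))) (at u)"
proof -
  from DERIV_chain2[OF has_field_derivative_T_chart[OF one_minus_exp_right_chart]
      has_field_derivative_right_chart]
  have A: "((\<lambda>u. T_chart (right_chart u)) has_field_derivative
      - \<i> * u / of_real (sqrt 3) * (- (of_real (sqrt 3) * \<i>) / (u\<^sup>2 - u + 1))) (at u)"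
    unfolding u_chart_right_chart .
  have "\<i> * (a * \<i>) = - a" for a by (simp add: complex_eq_iff)
  then have e: "- \<i> * a / s * (- (s * \<i>) / q) = - (a / q)" if "s \<noteq> 0" for a s q :: complex
    using that by simp
  show ?thesis by (rule DERIV_cong[OF A e]) simp
qed

end

lemma right_chart_u_chart:
  assumes "exp d \<noteq> 1" "- pi < Im d" "Im d \<le> pi"
  shows "right_chart (u_chart d) = d"
proof -
  define k where "k = u0 - cnj u0"
  have "k \<noteq> 0" by (simp add: k_def u0_minus_cnj_u0)
  have "u_chart d = u0 + k / (exp d - 1)" by (simp add: u_chart_def k_def u0_minus_cnj_u0)
  then have "u_chart d - u0 = k / (exp d - 1)" "u_chart d - cnj u0 = k + k / (exp d - 1)"
    by (simp_all add: k_def)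
  then have "(u_chart d - cnj u0) / (u_chart d - u0) = (k + k / (exp d - 1)) / (k / (exp d - 1))"
    by simp
  also have "\<dots> = exp d" using \<open>k \<noteq> 0\<close> assms(1) by (simp add: field_simps)
  finally show ?thesis using assms by (simp add: right_chart_def)
qed

text \<open>Since 1 - \<open>u0\<close> = cnj \<open>u0\<close>, the quotient at u = 1 equals
  \<open>u0\<^sup>2\<close>, the cube root of unity with argument 2 pi / 3.\<close>

lemma right_chart_1: "right_chart 1 = \<i> * of_real (2 * pi / 3)"
proof -
  have "exp (\<i> * of_real (2 * pi / 3)) = Complex (- 1 / 2) (sqrt 3 / 2)"
    by (simp add: complex_eq_iff Re_exp Im_exp cos_120 sin_120)
  moreover have "(1 - cnj u0) / (1 - u0) = Complex (- 1 / 2) (sqrt 3 / 2)"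
  proof -
    have "1 - u0 \<noteq> 0" by (simp add: complex_eq_iff)
    moreover have "1 - cnj u0 = Complex (- 1 / 2) (sqrt 3 / 2) * (1 - u0)"
      by (simp add: complex_eq_iff)
    ultimately show ?thesis by simp
  qed
  ultimately have "right_chart 1 = Ln (exp (\<i> * of_real (2 * pi / 3)))"
    by (simp add: right_chart_def)
  also have "\<dots> = \<i> * of_real (2 * pi / 3)" by (rule Ln_exp) auto
  finally show ?thesis .
qed

lemma T_right_chart_1: "T_chart (right_chart 1) = 0"
proof (rule complex_eqI)
  define d where "d = \<i> * complex_of_real (2 * pi / 3)"
  show "Im (T_chart (right_chart 1)) = Im 0"
    unfolding right_chart_1 by (subst Im_T_chart_axis) auto
  have w: "1 - exp (- d) = Complex (3 / 2) (sqrt 3 / 2)"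
    by (simp add: d_def complex_eq_iff Re_exp Im_exp cos_120 sin_120)
  have "norm (Complex (3 / 2) (sqrt 3 / 2)) = sqrt 3"
    by (simp add: cmod_def power2_eq_square)
  moreover have "Complex (3 / 2) (sqrt 3 / 2) \<noteq> 0" by (simp add: complex_eq_iff)
  ultimately have "Re (Ln (1 - exp (- d))) = ln 3 / 2"
    unfolding w by (simp add: ln_sqrt)
  moreover have "Re (\<i> * d / (2 * of_real (sqrt 3))) = - (pi / (3 * sqrt 3))"
    by (simp add: d_def Re_divide_of_real)
  ultimately show "Re (T_chart (right_chart 1)) = Re 0"
    unfolding right_chart_1 d_def[symmetric] by (simp add: T_chart_def) (simp add: d_def)
qed

text \<open>Both sides have the same derivative and vanish at p = 1.\<close>

lemma T_right_chart_of_real: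
  assumes p: "p > 1 / 2"
  shows "T_chart (right_chart (of_real p)) = of_real (T0_fun p)"
proof -
  define f where "f p = T_chart (right_chart (of_real p)) - of_real (T0_fun p)" for p
  have "(f has_vector_derivative 0) (at p within {1 / 2<..})" if "p \<in> {1 / 2<..}" for p
  proof -
    have a: "((\<lambda>u. T_chart (right_chart u)) has_field_derivative
        - (of_real p / ((of_real p)\<^sup>2 - of_real p + 1))) (at (of_real p))"
      by (rule has_field_derivative_T_right_chart) (use that in auto)
    have b: "(of_real has_vector_derivative (1 :: complex)) (at p)"
      using has_vector_derivative_of_real[OF DERIV_ident] by simp
    have c: "((\<lambda>p. T_chart (right_chart (of_real p))) has_vector_derivative
        - (of_real p / ((of_real p)\<^sup>2 - of_real p + 1))) (at p)"
      using field_vector_diff_chain_at[OF b a] by (simp add: o_def)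
    have d: "((\<lambda>p. complex_of_real (T0_fun p)) has_vector_derivative
        of_real (- (p / (p\<^sup>2 - p + 1)))) (at p)"
      by (rule has_vector_derivative_of_real[OF has_real_derivative_T0_fun])
    have "(f has_vector_derivative 0) (at p)"
      using has_vector_derivative_diff[OF c d] unfolding f_def by simp
    then show ?thesis by (rule has_vector_derivative_at_within)
  qed
  then obtain c where c: "\<And>p. p \<in> {1 / 2<..} \<Longrightarrow> f p = c"
    by (rule has_vector_derivative_zero_constant[rotated]) auto
  have "f p = f 1" using c p by simp
  also have "f 1 = 0" using T_right_chart_1 by (simp add: f_def T0_fun_1)
  finally show ?thesis by (simp add: f_def)
qed

lemma isCont_right_chart: "Re u > 1 / 2 \<Longrightarrow> isCont right_chart u"
  using has_field_derivative_right_chart by (rule DERIV_isCont)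

text \<open>As u = 1 is positive, \<open>T_chart_sign_near_axis\<close> makes Im T negative exactly
  for Re d > 0, that is for Im u > 0; continuity keeps it above - pi / 2. The last property is for
  use in the converse direction: Im T < 0 forces u into the upper half-plane.\<close>

lemma right_chart_near_1:
  obtains r where "r > 0" "r \<le> 1 / 2"
    "\<And>u. dist u 1 < r \<Longrightarrow> Im u > 0 \<Longrightarrow> right_chart u \<in> chart_domain"
    "\<And>u. dist u 1 < r \<Longrightarrow> Im u \<le> 0 \<Longrightarrow> Im (T_chart (right_chart u)) \<ge> 0"
proof -
  have u1: "u_chart (\<i> * of_real (2 * pi / 3)) = 1"
    using u_chart_right_chart[of 1] by (simp add: right_chart_1)
  obtain \<epsilon> where \<epsilon>: "\<epsilon> > 0"
    "\<And>d. dist d (\<i> * of_real (2 * pi / 3)) < \<epsilon> \<Longrightarrow> Re d = 0 \<Longrightarrow> Im (T_chart d) = 0"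
    "\<And>d. dist d (\<i> * of_real (2 * pi / 3)) < \<epsilon> \<Longrightarrow> Re d \<noteq> 0 \<Longrightarrow>
       Im (T_chart d) * (Re d * Re (u_chart (\<i> * of_real (2 * pi / 3)))) < 0"
    by (rule T_chart_sign_near_axis[of "2 * pi / 3"]) (use u1 in auto)
  have "isCont right_chart 1" by (rule isCont_right_chart) simp
  then obtain r1 where r1: "r1 > 0" "\<And>u. dist u 1 < r1 \<Longrightarrow> dist (right_chart u) (right_chart 1) < \<epsilon>"
    using \<epsilon>(1) unfolding continuous_at_eps_delta by blast
  have "isCont (\<lambda>u. T_chart (right_chart u)) 1"
    by (rule DERIV_isCont[OF has_field_derivative_T_right_chart]) simp
  then obtain r2 where r2: "r2 > 0"
    "\<And>u. dist u 1 < r2 \<Longrightarrow> dist (T_chart (right_chart u)) (T_chart (right_chart 1)) < 1"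
    unfolding continuous_at_eps_delta using zero_less_one by blast
  show thesis
  proof (rule that[of "min (1 / 2) (min r1 r2)"])
    fix u :: complex assume u: "dist u 1 < min (1 / 2) (min r1 r2)"
    have Re: "Re u > 1 / 2"
      using u abs_Re_le_cmod[of "u - 1"] by (simp add: dist_norm) linarith
    have d: "dist (right_chart u) (\<i> * of_real (2 * pi / 3)) < \<epsilon>"
      using r1(2)[of u] u by (simp add: right_chart_1)
    {
      assume "Im u > 0"
      then have pos: "Re (right_chart u) > 0" using Re_right_chart_pos_iff[OF Re] by simp
      then have "Im (T_chart (right_chart u)) < 0"
        using \<epsilon>(3)[OF d, unfolded u1] by (simp add: mult_less_0_iff)
      moreover have "\<bar>Im (T_chart (right_chart u))\<bar> < 1"
        using r2(2)[of u] u abs_Im_le_cmod[of "T_chart (right_chart u)"]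
        by (simp add: T_right_chart_1)
      ultimately show "right_chart u \<in> chart_domain"
        using pos pi_gt3 by (auto simp: chart_domain_def)
    next
      assume "Im u \<le> 0"
      then have "Re (right_chart u) \<le> 0" using Re_right_chart_pos_iff[OF Re] by simp
      then show "Im (T_chart (right_chart u)) \<ge> 0"
        using \<epsilon>(2)[OF d] \<epsilon>(3)[OF d, unfolded u1]
        by (cases "Re (right_chart u) = 0") (auto simp: mult_less_0_iff)
    }
  qed (use r1 r2 in auto)
qed

lemma u_chart_holomorphic: "u_chart holomorphic_on {d. exp d \<noteq> 1}"
  unfolding u_chart_def[abs_def] by (intro holomorphic_intros) auto

section \<open>Comparison of a given extension T with the chart\<close>

context
  fixes T :: "complex \<Rightarrow> complex"
  assumes T: "is_T_extension T"
begin

lemma T_continuous: "continuous_on T_domain T"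
  and T_analytic: "T analytic_on Delta_domain"
  and T_of_real: "s \<ge> 0 \<Longrightarrow> T (of_real s) = of_real (T0_fun s)"
  using T by (auto simp: is_T_extension_def)

text \<open>The difference of \<^term>\<open>T\<close> and the explicit chart vanishes on the real axis near 1;
  extended by zero to the lower half-disc it is holomorphic, hence zero.\<close>

lemma T_eq_T_right_chart:
  obtains r where "r > 0" "r \<le> 1 / 2"
    "\<And>u. dist u 1 < r \<Longrightarrow> Im u > 0 \<Longrightarrow> right_chart u \<in> chart_domain"
    "\<And>u. dist u 1 < r \<Longrightarrow> Im u > 0 \<Longrightarrow> T u = T_chart (right_chart u)"
proof -
  obtain r where r: "r > 0" "r \<le> 1 / 2"
    "\<And>u. dist u 1 < r \<Longrightarrow> Im u > 0 \<Longrightarrow> right_chart u \<in> chart_domain"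
    by (rule right_chart_near_1) blast
  have Re: "Re u > 1 / 2" if "u \<in> ball 1 r" for u
  proof -
    have "dist 1 u < r" using that by simp
    then show ?thesis
      using r(2) abs_Re_le_cmod[of "1 - u"] unfolding dist_norm minus_complex.sel one_complex.sel by linarith
  qed
  have Delta: "u \<in> Delta_domain" if "u \<in> ball 1 r" "Im u > 0" for u
  proof -
    have "right_chart u \<in> chart_domain" using r(3) that by (simp add: dist_commute)
    then show ?thesis unfolding Delta_domain_eq using u_chart_right_chart[OF Re[OF that(1)]] by force
  qed
  \<comment> \<open>Continuity of T is available only on \<open>T_domain\<close>, so the real points
    of the disc must be placed there; they are approached from above by u + i k.\<close>
  have dom: "u \<in> T_domain" if u: "u \<in> ball 1 r" "Im u \<ge> 0" for u
  proof -
    have "u \<in> closure Delta_domain" unfolding closure_approachable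
    proof (intro allI impI)
      fix e :: real assume "e > 0"
      define k where "k = min e (r - dist 1 u) / 2"
      have k: "k > 0" "k < e" "k < r - dist 1 u" using \<open>e > 0\<close> u by (auto simp: k_def)
      define y where "y = u + \<i> * of_real k"
      have y: "dist y u = k" using k by (simp add: y_def dist_norm norm_mult)
      have "dist 1 y \<le> dist 1 u + dist y u" by (metis dist_commute dist_triangle)
      then have "y \<in> ball 1 r" using y k by simp
      moreover have "Im y > 0" using u k by (simp add: y_def)
      ultimately show "\<exists>y\<in>Delta_domain. dist y u < e" using Delta y k by (intro bexI[of _ y]) auto
    qed
    then show ?thesis using Re[OF u(1)] by (auto simp: T_domain_def)
  qed
  define h where "h u = (if Im u \<le> 0 then 0 else T u - T_chart (right_chart u))" for u
  have holc: "(\<lambda>u. T_chart (right_chart u)) holomorphic_on ball 1 r"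
    unfolding holomorphic_on_open[OF open_ball] using has_field_derivative_T_right_chart[OF Re] by blast
  have "h holomorphic_on ball 1 r"
  proof (rule holomorphic_on_paste_across_line[of _ \<i> _ 0])
    show "h holomorphic_on ball 1 r \<inter> {z. \<i> \<bullet> z < 0}"
      by (rule holomorphic_transform[OF holomorphic_on_const[of 0]]) (simp add: h_def inner_complex_def)
    have "(\<lambda>u. T u - T_chart (right_chart u)) holomorphic_on ball 1 r \<inter> {z. 0 < \<i> \<bullet> z}"
      by (intro holomorphic_on_diff holomorphic_on_subset[OF analytic_imp_holomorphic[OF T_analytic]]
          holomorphic_on_subset[OF holc]) (auto simp: inner_complex_def intro!: Delta)
    then show "h holomorphic_on ball 1 r \<inter> {z. 0 < \<i> \<bullet> z}"
      by (rule holomorphic_transform) (simp add: h_def inner_complex_def)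
    show "continuous_on (ball 1 r) h"
      unfolding h_def
    proof (rule continuous_on_cases_le)
      show "continuous_on {u \<in> ball 1 r. 0 \<le> Im u} (\<lambda>u. T u - T_chart (right_chart u))"
        by (intro continuous_on_diff continuous_on_subset[OF T_continuous]
            continuous_on_subset[OF holomorphic_on_imp_continuous_on[OF holc]]) (auto intro: dom)
      fix u assume u: "u \<in> ball 1 r" "Im u = 0"
      then have "u = of_real (Re u)" by (simp add: complex_eq_iff)
      then show "0 = T u - T_chart (right_chart u)"
        using T_of_real[of "Re u"] T_right_chart_of_real[of "Re u"] Re[OF u(1)] by simp
    qed (auto intro!: continuous_intros)
  qed auto
  then have "h u = 0" if "u \<in> ball 1 r" for u
  proof (rule analytic_continuation_open[where s = "ball 1 r \<inter> {u. Im u < 0}" and g = "\<lambda>_. 0", rotated 5])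
    have "1 - \<i> * of_real (r / 2) \<in> ball 1 r \<inter> {u. Im u < 0}"
      using r by (simp add: dist_norm norm_mult)
    then show "ball 1 r \<inter> {u. Im u < 0} \<noteq> {}" by blast
    show "open (ball 1 r \<inter> {u. Im u < 0})" by (intro open_Int open_ball open_halfspace_Im_lt)
  qed (use that in \<open>auto simp: h_def\<close>)
  then have "T u = T_chart (right_chart u)" if "dist u 1 < r" "Im u > 0" for u
    using that by (force simp: h_def dist_commute)
  with r show thesis by (intro that[of r]) auto
qed

text \<open>The identity theorem is applied in d on the connected set \<open>chart_domain\<close>.
  The starting set S lies over the small disc at u = 1 and in the principal range of Im d, where
  \<open>right_chart\<close> really inverts \<open>u_chart\<close>.\<close>

lemma T_u_chart:
  assumes d: "d \<in> chart_domain"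
  shows "T (u_chart d) = T_chart d"
proof -
  obtain r where r: "r > 0" "r \<le> 1 / 2"
    "\<And>u. dist u 1 < r \<Longrightarrow> Im u > 0 \<Longrightarrow> right_chart u \<in> chart_domain"
    "\<And>u. dist u 1 < r \<Longrightarrow> Im u > 0 \<Longrightarrow> T u = T_chart (right_chart u)"
    by (rule T_eq_T_right_chart) blast
  define S where "S = chart_domain \<inter> {d. Im d > - pi} \<inter> {d. Im d < pi} \<inter> u_chart -` ball 1 r"
  have holu: "u_chart holomorphic_on chart_domain"
    by (rule holomorphic_on_subset[OF u_chart_holomorphic]) (use chart_domain_exp_neq_1 in auto)
  have "T \<circ> u_chart analytic_on chart_domain"
    by (rule analytic_on_compose)
      (use holu T_analytic open_chart_domain in \<open>simp_all add: analytic_on_open Delta_domain_eq\<close>)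
  then have holT: "(\<lambda>d. T (u_chart d)) holomorphic_on chart_domain"
    using analytic_imp_holomorphic by (simp add: o_def)
  show ?thesis
  proof (rule analytic_continuation_open[where s = S and s' = chart_domain
        and f = "\<lambda>d. T (u_chart d)" and g = T_chart])
    show "open S" unfolding S_def
      by (intro continuous_open_preimage open_Int open_chart_domain open_halfspace_Im_gt open_halfspace_Im_lt
          holomorphic_on_imp_continuous_on holomorphic_on_subset[OF holu] open_ball) auto
    define u where "u = 1 + \<i> * complex_of_real (r / 2)"
    have u: "dist u 1 < r" "Im u > 0" "Re u > 1 / 2"
      using r by (simp_all add: u_def dist_norm norm_mult)
    have "right_chart u \<in> S"
      unfolding S_def using r(3)[OF u(1,2)] Im_right_chart[OF u(3)] u_chart_right_chart[OF u(3)] u(1)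
      by (auto simp: dist_commute intro: less_trans[of "- pi" 0])
    then show "S \<noteq> {}" by blast
    show "T_chart holomorphic_on chart_domain"
      by (rule holomorphic_on_subset[OF T_chart_holomorphic_right]) (auto simp: chart_domain_def)
    fix d assume d: "d \<in> S"
    then have "exp d \<noteq> 1" "Re d > 0" using chart_domain_exp_neq_1 by (auto simp: S_def chart_domain_def)
    then have "Im (u_chart d) > 0" by (simp add: Im_u_chart_pos_iff)
    moreover have "dist (u_chart d) 1 < r" using d by (simp add: S_def dist_commute)
    moreover have "right_chart (u_chart d) = d"
      using \<open>exp d \<noteq> 1\<close> d by (intro right_chart_u_chart) (auto simp: S_def)
    ultimately show "T (u_chart d) = T_chart d" using r(4) by simp
  qed (use d open_chart_domain connected_chart_domain holT in \<open>auto simp: S_def\<close>)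
qed

end

section \<open>The chart maps onto the open strip\<close>

lemma Im_T_chart:
  "Im (T_chart d) = Im d / 2 - Re d / (2 * sqrt 3) + Im (Ln (1 - exp (- d))) - pi / 2"
  by (simp add: T_chart_def Im_divide_of_real)

lemma Re_T_chart:
  "Re (T_chart d) = Re d / 2 + Im d / (2 * sqrt 3) + Re (Ln (1 - exp (- d)))
     - (pi / (3 * sqrt 3) + ln 3 / 2)"
  by (simp add: T_chart_def Re_divide_of_real)

text \<open>The argument of 1 - exp (- d) is below pi / 2 in modulus, so the bounds on Im T confine
  d to a slanted strip. A bound on Re d thereby bounds d.\<close>

lemma chart_domain_Im_bounds:
  assumes "d \<in> chart_domain"
  shows "Re d / sqrt 3 - pi \<le> Im d" "Im d \<le> Re d / sqrt 3 + 2 * pi"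
proof -
  have d: "Re d > 0" "- pi / 2 < Im (T_chart d)" "Im (T_chart d) < 0"
    using assms by (auto simp: chart_domain_def)
  then have pos: "Re (1 - exp (- d)) > 0"
    by (intro Re_one_minus_exp_pos exp_neq_1_of_Re_pos) auto
  then have "1 - exp (- d) \<noteq> 0" by (metis less_irrefl zero_complex.sel(1))
  then have "\<bar>Im (Ln (1 - exp (- d)))\<bar> < pi / 2"
    using Re_Ln_pos_lt pos by blast
  moreover have "Re d / (2 * sqrt 3) = Re d / sqrt 3 / 2" by simp
  ultimately show "Re d / sqrt 3 - pi \<le> Im d" "Im d \<le> Re d / sqrt 3 + 2 * pi"
    using d(2,3) unfolding Im_T_chart by linarith+
qed

text \<open>The limit may leave \<open>chart_domain\<close> through Re l = 0 or exp l = 1; each use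
  treats these cases by its own argument.\<close>

lemma chart_domain_convergent_subsequence:
  assumes d: "\<And>n. d n \<in> chart_domain" and B: "\<And>n::nat. Re (d n) \<le> B"
  obtains l r where "strict_mono r" "(d \<circ> r) \<longlonglongrightarrow> l" "Re l \<ge> 0"
proof -
  have Re: "Re (d n) > 0" for n using d[of n] by (simp add: chart_domain_def)
  have "norm (d n) \<le> B + (B / sqrt 3 + 2 * pi)" for n
  proof -
    have "Re (d n) / sqrt 3 \<le> B / sqrt 3" "Re (d n) / sqrt 3 > 0"
      using B[of n] Re[of n] by (simp_all add: divide_right_mono)
    then have "\<bar>Im (d n)\<bar> \<le> B / sqrt 3 + 2 * pi"
      using chart_domain_Im_bounds[OF d[of n]] pi_gt_zero by linarith
    then show ?thesis using cmod_le[of "d n"] B[of n] Re[of n] by linarith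
  qed
  then have "bounded (range d)" by (auto simp: bounded_iff)
  then obtain l r where lr: "strict_mono r" "(d \<circ> r) \<longlonglongrightarrow> l"
    using bounded_imp_convergent_subsequence by blast
  have "(\<lambda>n. Re ((d \<circ> r) n)) \<longlonglongrightarrow> Re l" by (rule tendsto_Re[OF lr(2)])
  then have "Re l \<ge> 0" by (rule LIMSEQ_le_const) (auto intro: less_imp_le[OF Re])
  with lr show thesis by (rule that)
qed

text \<open>Reduction modulo 2 pi i: Im T equals k pi on the k-th interval of the axis, and only k =
  0 fits between - pi / 2 and 0.\<close>

lemma Im_bounds_on_axis:
  assumes l: "Re l = 0" "exp l \<noteq> 1" and T: "- pi / 2 \<le> Im (T_chart l)" "Im (T_chart l) \<le> 0"
  shows "0 < Im l" "Im l < 2 * pi" "l = \<i> * of_real (Im l)"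
proof -
  define k where "k = \<lfloor>Im l / (2 * pi)\<rfloor>"
  define \<theta> where "\<theta> = Im l - 2 * pi * of_int k"
  have "of_int k \<le> Im l / (2 * pi)" "Im l / (2 * pi) < of_int k + 1"
    unfolding k_def by linarith+
  then have \<theta>: "0 \<le> \<theta>" "\<theta> < 2 * pi" by (simp_all add: \<theta>_def field_simps)
  have l_eq: "l = \<i> * of_real \<theta> + 2 * of_int k * of_real pi * \<i>"
    using l(1) by (simp add: complex_eq_iff \<theta>_def)
  have "\<theta> \<noteq> 0"
  proof
    assume "\<theta> = 0"
    then have "l = (2 * of_int k * pi) * \<i>" using l_eq by simp
    then show False using l(2) exp_integer_2pi[OF Ints_of_int, of k] by simp
  qed
  with \<theta> have \<theta>: "0 < \<theta>" "\<theta> < 2 * pi" by auto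
  have "T_chart l = T_chart (\<i> * of_real \<theta>) + of_int k * (of_real pi * \<i> + of_real (pi / sqrt 3))"
    by (subst l_eq) (rule T_chart_add_2pi)
  then have "Im (T_chart l) = of_int k * pi" using Im_T_chart_axis[OF \<theta>] by simp
  then have "- (1 / 2) * pi \<le> of_int k * pi" "of_int k * pi \<le> 0 * pi" using T by simp_all
  then have "- (1 / 2) \<le> real_of_int k" "real_of_int k \<le> 0"
    using pi_gt_zero by (simp_all only: mult_le_cancel_right_pos)
  then have "k = 0" by linarith
  then have "\<theta> = Im l" by (simp add: \<theta>_def)
  with \<theta> show "0 < Im l" "Im l < 2 * pi" by auto
  show "l = \<i> * of_real (Im l)" using l(1) by (simp add: complex_eq_iff)
qed

lemma inj_on_T_chart: "inj_on T_chart chart_domain"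
  by (rule inj_onI, rule T_chart_inj) (auto simp: chart_domain_def exp_neq_1_of_Re_pos)

text \<open>Exponentiating turns the logarithmic singularity into a factor that stays continuous and
  vanishes where exp d = 1.\<close>

lemma exp_T_chart:
  assumes "Re d > 0"
  shows "exp (T_chart d) = exp (d / 2 - \<i> * d / (2 * of_real (sqrt 3))
     - (\<i> * of_real (pi / 2) + of_real (pi / (3 * sqrt 3) + ln 3 / 2))) * (1 - exp (- d))"
proof -
  have "Re (1 - exp (- d)) > 0"
    using assms by (intro Re_one_minus_exp_pos exp_neq_1_of_Re_pos) auto
  then have "1 - exp (- d) \<noteq> 0" by (metis less_irrefl zero_complex.sel(1))
  then show ?thesis unfolding T_chart_def
    by (simp only: exp_add exp_diff exp_Ln not_False_eq_True) simp
qed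

text \<open>For Re d > 1 the bounds Im d \<ge> - pi and |1 - exp (- d)| \<ge> 1 - exp (- 1) leave Re
  d / 2 as the only unbounded term from below; this produces the explicit constant.\<close>

lemma T_chart_Re_bounded_above:
  assumes d: "d \<in> chart_domain" and K: "Re (T_chart d) \<le> K"
  shows "Re d \<le> max 1 (2 * (K + pi / (2 * sqrt 3) + (pi / (3 * sqrt 3) + ln 3 / 2) - ln (1 - exp (- 1))))"
proof (cases "Re d \<le> 1")
  case False
  have "norm (exp (- d)) \<le> exp (- 1)" using False by simp
  then have n: "1 - exp (- 1) \<le> norm (1 - exp (- d))"
    using norm_triangle_ineq2[of 1 "exp (- d)"] unfolding norm_one by linarith
  have p: "(0 :: real) < 1 - exp (- 1)" by simp
  then have "norm (1 - exp (- d)) > 0" using n by linarith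
  then have "ln (1 - exp (- 1)) \<le> ln (norm (1 - exp (- d)))" "1 - exp (- d) \<noteq> 0"
    using n p ln_le_cancel_iff by (blast, simp only: zero_less_norm_iff not_False_eq_True)
  then have "ln (1 - exp (- 1)) \<le> Re (Ln (1 - exp (- d)))" by (metis Re_Ln)
  moreover have "Im d / (2 * sqrt 3) \<ge> - (pi / (2 * sqrt 3))"
  proof -
    have "Re d / sqrt 3 \<ge> 0" using False by simp
    then have "- pi \<le> Im d" using chart_domain_Im_bounds(1)[OF d] by linarith
    then have "- pi / (2 * sqrt 3) \<le> Im d / (2 * sqrt 3)" by (intro divide_right_mono) auto
    then show ?thesis by simp
  qed
  moreover have "x \<le> 2 * (K + q + c - L)"
    if "x / 2 + i + l - c \<le> K" "L \<le> l" "i \<ge> - q" for x i l c L q :: real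
    using that by (simp add: field_simps)
  ultimately show ?thesis using K unfolding Re_T_chart by (intro max.coboundedI2) blast
qed auto

text \<open>A clopen argument in the connected strip: the image is open by the open mapping theorem,
  and closed in the strip because preimages of a convergent sequence cannot escape from
  \<open>chart_domain\<close>.\<close>

lemma T_chart_image: "T_chart ` chart_domain = {w. - pi / 2 < Im w \<and> Im w < 0}" (is "?I = ?S")
proof -
  have hol: "T_chart holomorphic_on chart_domain"
    by (rule holomorphic_on_subset[OF T_chart_holomorphic_right]) (auto simp: chart_domain_def)
  have sub: "?I \<subseteq> ?S" by (auto simp: chart_domain_def)
  have "open ?I" by (rule open_mapping_thm3[OF hol open_chart_domain inj_on_T_chart])
  then have "openin (top_of_set ?S) ?I" using sub by (simp add: open_subset)
  moreover have "closedin (top_of_set ?S) ?I"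
  proof -
    have "w \<in> ?I" if w: "w \<in> ?S" "w \<in> closure ?I" for w
    proof -
      obtain x where x: "\<And>n. x n \<in> ?I" "x \<longlonglongrightarrow> w"
        using w(2) unfolding closure_sequential by blast
      then have "\<forall>n. \<exists>d. d \<in> chart_domain \<and> x n = T_chart d" by blast
      from choice[OF this] obtain d where d: "\<And>n. d n \<in> chart_domain" "\<And>n. x n = T_chart (d n)"
        by blast
      obtain K where K: "\<And>n. norm (x n) \<le> K"
        using convergent_imp_bounded[OF x(2)] by (auto simp: bounded_iff)
      have "Re (T_chart (d n)) \<le> K" for n
        using K[of n] complex_Re_le_cmod[of "x n"] by (simp add: d(2))
      from T_chart_Re_bounded_above[OF d(1) this]
      obtain l r where lr: "strict_mono r" "(d \<circ> r) \<longlonglongrightarrow> l" "Re l \<ge> 0"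
        by (rule chart_domain_convergent_subsequence[OF d(1)])
      have dl: "(\<lambda>n. d (r n)) \<longlonglongrightarrow> l" using lr(2) by (simp add: o_def)
      have Tl: "(\<lambda>n. T_chart (d (r n))) \<longlonglongrightarrow> w"
        using LIMSEQ_subseq_LIMSEQ[OF x(2) lr(1)] by (simp add: o_def d(2))
      \<comment> \<open>Otherwise the exponentials of the values would tend to 0, whereas exp w is
        nonzero.\<close>
      have "exp l \<noteq> 1"
      proof
        assume l1: "exp l = 1"
        have "(\<lambda>n. exp (T_chart (d (r n)))) \<longlonglongrightarrow> exp w" using Tl by (rule tendsto_exp)
        moreover have "exp (T_chart (d (r n))) = exp (d (r n) / 2 - \<i> * d (r n) / (2 * of_real (sqrt 3))
            - (\<i> * of_real (pi / 2) + of_real (pi / (3 * sqrt 3) + ln 3 / 2))) * (1 - exp (- d (r n)))" for n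
          by (rule exp_T_chart) (use d(1) in \<open>simp add: chart_domain_def\<close>)
        moreover have "(\<lambda>n. exp (d (r n) / 2 - \<i> * d (r n) / (2 * of_real (sqrt 3))
            - (\<i> * of_real (pi / 2) + of_real (pi / (3 * sqrt 3) + ln 3 / 2))) * (1 - exp (- d (r n))))
          \<longlonglongrightarrow> exp (l / 2 - \<i> * l / (2 * of_real (sqrt 3))
            - (\<i> * of_real (pi / 2) + of_real (pi / (3 * sqrt 3) + ln 3 / 2))) * (1 - exp (- l))"
          by (intro tendsto_intros dl) simp_all
        ultimately have "exp w = exp (l / 2 - \<i> * l / (2 * of_real (sqrt 3))
            - (\<i> * of_real (pi / 2) + of_real (pi / (3 * sqrt 3) + ln 3 / 2))) * (1 - exp (- l))"
          using LIMSEQ_unique by (simp only:)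
        then show False using l1 by (simp add: exp_minus)
      qed
      then have "(\<lambda>n. T_chart (d (r n))) \<longlonglongrightarrow> T_chart l"
        by (intro isCont_tendsto_compose[OF isCont_T_chart dl] lr)
      then have w_eq: "w = T_chart l" using Tl LIMSEQ_unique by blast
      \<comment> \<open>On the axis T is real, but w lies strictly inside the strip.\<close>
      have "Re l \<noteq> 0"
      proof
        assume "Re l = 0"
        then have "0 < Im l" "Im l < 2 * pi" "l = \<i> * of_real (Im l)"
          using Im_bounds_on_axis[OF _ \<open>exp l \<noteq> 1\<close>] w(1) by (auto simp: w_eq)
        then have "Im w = 0" unfolding w_eq using Im_T_chart_axis by metis
        then show False using w(1) by simp
      qed
      then have "l \<in> chart_domain" using lr(3) w(1) by (simp add: chart_domain_def w_eq)
      then show ?thesis using w_eq by blast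
    qed
    then have "?S \<inter> closure ?I \<subseteq> ?I" by (intro subsetI) (simp only: Int_iff)
    moreover have "?I \<subseteq> ?S \<inter> closure ?I" by (rule Int_greatest[OF sub closure_subset])
    ultimately have "?I = ?S \<inter> closure ?I" by (intro equalityI)
    moreover have "closedin (top_of_set ?S) (?S \<inter> closure ?I)"
      by (rule closedin_closed_Int[OF closed_closure])
    ultimately show ?thesis by (simp only:)
  qed
  moreover have "connected ?S"
  proof -
    have "?S = {w. Im w > - pi / 2} \<inter> {w. Im w < 0}" by auto
    then show ?thesis
      by (simp only: convex_connected convex_Int convex_halfspace_Im_gt convex_halfspace_Im_lt)
  qed
  moreover have "?I \<noteq> {}"
  proof -
    have "(- pi / 2, 1 :: real) \<in> {- pi<..<0} \<times> {0<..}" by simp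
    then have "chart_domain \<noteq> {}" unfolding chart_domain_eq by blast
    then show ?thesis by simp
  qed
  ultimately show ?thesis using connected_clopen by blast
qed

lemma Delta_domain_subset: "Delta_domain \<subseteq> T_domain"
proof
  fix u assume u: "u \<in> Delta_domain"
  then obtain d where d: "d \<in> chart_domain" "u = u_chart d" by (auto simp: Delta_domain_eq)
  then have "u \<noteq> u0" using chart_domain_exp_neq_1[OF d(1)] by (simp add: u_chart_def)
  then show "u \<in> T_domain" using u closure_subset by (auto simp: T_domain_def)
qed

section \<open>Injectivity of T on the closed domain\<close>

context
  fixes T :: "complex \<Rightarrow> complex"
  assumes T: "is_T_extension T"
begin

text \<open>Away from \<open>u0\<close> the values exp d of approximating points stay bounded, so
  these points subconverge, and finiteness of u excludes exp l = 1. For a limit on the axis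
  \<open>T_chart_sign_near_axis\<close> rules out u < 0, next to which Im T would be
  positive.\<close>

lemma T_domain_lift:
  assumes u: "u \<in> T_domain"
  obtains l where "Re l \<ge> 0" "exp l \<noteq> 1" "u_chart l = u" "T u = T_chart l"
    "Re l = 0 \<longrightarrow> (\<exists>p\<ge>0. u = of_real p)"
proof -
  define k where "k = of_real (sqrt 3) * \<i>"
  have k0: "k \<noteq> 0" by (simp add: k_def)
  have "u \<noteq> u0" "u \<in> closure Delta_domain" using u by (auto simp: T_domain_def)
  then obtain x where x: "\<And>n. x n \<in> Delta_domain" "x \<longlonglongrightarrow> u"
    unfolding closure_sequential by blast
  then have "\<forall>n. \<exists>d. d \<in> chart_domain \<and> x n = u_chart d" unfolding Delta_domain_eq by blast
  from choice[OF this] obtain d where d: "\<And>n. d n \<in> chart_domain" "\<And>n. x n = u_chart (d n)"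
    by blast
  have e: "exp (d n) = 1 + k * inverse (x n - u0)" for n
  proof -
    have "x n - u0 = k / (exp (d n) - 1)" unfolding d(2) by (simp add: u_chart_def k_def)
    then have "k * inverse (x n - u0) = k * inverse (k / (exp (d n) - 1))" by (simp only:)
    also have "\<dots> = exp (d n) - 1" using k0 by simp
    finally show ?thesis by simp
  qed
  have lim: "(\<lambda>n. 1 + k * inverse (x n - u0)) \<longlonglongrightarrow> 1 + k * inverse (u - u0)"
    using \<open>u \<noteq> u0\<close> by (intro tendsto_intros x) simp
  then obtain K where K: "\<And>n. norm (exp (d n)) \<le> K"
    using convergent_imp_bounded[OF lim] by (auto simp: bounded_iff e)
  have "Re (d n) \<le> ln K" for n
  proof -
    have "exp (Re (d n)) \<le> K" using K[of n] by simp
    then show ?thesis by (metis exp_gt_zero ln_exp ln_le_cancel_iff order_less_le_trans)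
  qed
  then obtain l r where lr: "strict_mono r" "(d \<circ> r) \<longlonglongrightarrow> l" "Re l \<ge> 0"
    by (rule chart_domain_convergent_subsequence[OF d(1)])
  have dl: "(\<lambda>n. d (r n)) \<longlonglongrightarrow> l" using lr(2) by (simp add: o_def)
  have xl: "(\<lambda>n. x (r n)) \<longlonglongrightarrow> u" using LIMSEQ_subseq_LIMSEQ[OF x(2) lr(1)] by (simp add: o_def)
  have "(\<lambda>n. exp (d (r n))) \<longlonglongrightarrow> 1 + k * inverse (u - u0)"
    using LIMSEQ_subseq_LIMSEQ[OF lim lr(1)] by (simp add: o_def e)
  then have el: "exp l = 1 + k * inverse (u - u0)"
    using LIMSEQ_unique tendsto_exp[OF dl] by blast
  then have l1: "exp l \<noteq> 1" using k0 \<open>u \<noteq> u0\<close> by simp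
  have "exp l - 1 = k / (u - u0)" by (simp only: el add_diff_cancel_left' divide_inverse)
  then have ul: "u_chart l = u" unfolding u_chart_def k_def[symmetric] using k0 \<open>u \<noteq> u0\<close> by simp
  have "x n \<in> T_domain" for n using x(1) Delta_domain_subset by blast
  then have "(\<lambda>n. T (x (r n))) \<longlonglongrightarrow> T u"
    by (intro continuous_on_tendsto_compose[OF T_continuous[OF T] xl u] always_eventually allI)
  then have "(\<lambda>n. T_chart (d (r n))) \<longlonglongrightarrow> T u" using T_u_chart[OF T d(1)] by (simp add: d(2))
  moreover have Tl: "(\<lambda>n. T_chart (d (r n))) \<longlonglongrightarrow> T_chart l"
    by (intro isCont_tendsto_compose[OF isCont_T_chart dl] lr l1)
  ultimately have Tu: "T u = T_chart l" using LIMSEQ_unique by blast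
  have dn: "Re (d n) > 0" "- pi / 2 < Im (T_chart (d n))" "Im (T_chart (d n)) < 0" for n
    using d(1)[of n] by (auto simp: chart_domain_def)
  have "\<exists>p\<ge>0. u = of_real p" if "Re l = 0"
  proof -
    have "(\<lambda>n. Im (T_chart (d (r n)))) \<longlonglongrightarrow> Im (T_chart l)" by (rule tendsto_Im[OF Tl])
    then have "- pi / 2 \<le> Im (T_chart l)" "Im (T_chart l) \<le> 0"
      by (rule LIMSEQ_le_const, use dn(2) less_imp_le in blast)
        (rule LIMSEQ_le_const2[OF \<open>(\<lambda>n. Im (T_chart (d (r n)))) \<longlonglongrightarrow> Im (T_chart l)\<close>],
          use dn(3) less_imp_le in blast)
    from Im_bounds_on_axis[OF that l1 this]
    have l: "0 < Im l" "Im l < 2 * pi" "l = \<i> * of_real (Im l)" .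
    have ur: "u = of_real (Re u)"
      using Im_u_chart_eq_0_iff[OF l1] that by (simp add: ul complex_eq_iff)
    have "Re u \<ge> 0"
    proof (rule ccontr)
      assume "\<not> Re u \<ge> 0"
      then have neg: "Re u < 0" by simp
      have uc: "u_chart (\<i> * of_real (Im l)) = u" using l(3) ul by simp
      obtain \<epsilon> where \<epsilon>: "\<epsilon> > 0" "\<And>d. dist d (\<i> * of_real (Im l)) < \<epsilon> \<Longrightarrow> Re d \<noteq> 0 \<Longrightarrow>
          Im (T_chart d) * (Re d * Re (u_chart (\<i> * of_real (Im l)))) < 0"
        by (rule T_chart_sign_near_axis[OF l(1,2)]) (use uc neg in auto)
      obtain n where "dist (d (r n)) l < \<epsilon>"
        using dl \<epsilon>(1) unfolding lim_sequentially by blast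
      then have "Im (T_chart (d (r n))) * (Re (d (r n)) * Re u) < 0"
        using \<epsilon>(2)[of "d (r n)"] dn(1)[of "r n"] l(3) uc by simp
      moreover have "Re (d (r n)) * Re u < 0" using dn(1)[of "r n"] neg by (rule mult_pos_neg)
      ultimately show False using mult_neg_neg[OF dn(3)[of "r n"]] by fastforce
    qed
    with ur show ?thesis by blast
  qed
  with lr(3) l1 ul Tu show thesis by (intro that) auto
qed

text \<open>The monotonicity argument fails if both lifts lie on the axis, where the derivative of
  \<open>T_chart\<close> is purely imaginary; strict monotonicity of \<open>T0_fun\<close> takes
  over there.\<close>

lemma inj_on_T: "inj_on T T_domain"
proof (rule inj_onI)
  fix u v assume u: "u \<in> T_domain" and v: "v \<in> T_domain" and eq: "T u = T v"
  obtain l where l: "Re l \<ge> 0" "exp l \<noteq> 1" "u_chart l = u" "T u = T_chart l"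
    "Re l = 0 \<longrightarrow> (\<exists>p\<ge>0. u = of_real p)" by (rule T_domain_lift[OF u])
  obtain m where m: "Re m \<ge> 0" "exp m \<noteq> 1" "u_chart m = v" "T v = T_chart m"
    "Re m = 0 \<longrightarrow> (\<exists>p\<ge>0. v = of_real p)" by (rule T_domain_lift[OF v])
  show "u = v"
  proof (cases "Re l > 0 \<or> Re m > 0")
    case True
    have "T_chart l = T_chart m" using l(4) m(4) eq by metis
    from T_chart_inj[OF l(1,2) m(1,2) True this] show ?thesis using l(3) m(3) by metis
  next
    case False
    then have "Re l = 0" "Re m = 0" using l(1) m(1) by auto
    then obtain p q where pq: "p \<ge> 0" "u = of_real p" "q \<ge> 0" "v = of_real q"
      using l(5) m(5) by blast
    have "complex_of_real (T0_fun p) = of_real (T0_fun q)"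
      using eq T_of_real[OF T pq(1)] T_of_real[OF T pq(3)] unfolding pq(2,4) by metis
    then have "T0_fun p = T0_fun q" by (simp only: of_real_eq_iff)
    then have "p = q" using inj_onD[OF T0_fun_inj_on] pq(1,3) by blast
    then show ?thesis using pq(2,4) by metis
  qed
qed

lemma T_inverse_eq: "u \<in> T_domain \<Longrightarrow> T_inverse T (T u) = u"
  unfolding T_inverse_def by (rule the_inv_into_f_f[OF inj_on_T])

end

section \<open>Analytic continuation in the quadrant\<close>

definition log_arg :: "complex \<Rightarrow> complex" where
  "log_arg z = 1 / 2 * Ln (1 + 2 / (z\<^sup>2 - 2))"

lemma Q_quadrant_power2:
  assumes "z \<in> Q_quadrant"
  shows "Im (z\<^sup>2) > 0" "Im (1 + 2 / (z\<^sup>2 - 2)) < 0"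
proof -
  show z: "Im (z\<^sup>2) > 0" using assms by (simp add: Q_quadrant_def power2_eq_square)
  have "Im (2 / (z\<^sup>2 - 2)) = - (2 * Im (z\<^sup>2)) / ((Re (z\<^sup>2 - 2))\<^sup>2 + (Im (z\<^sup>2 - 2))\<^sup>2)"
    by (simp add: Im_divide)
  also have "\<dots> < 0"
    using z by (intro divide_neg_pos add_nonneg_pos) auto
  finally show "Im (1 + 2 / (z\<^sup>2 - 2)) < 0" by simp
qed

text \<open>Squaring sends the quadrant into the upper half-plane and w to 1 + 2 / (w - 2) flips it,
  so the principal argument lies in (- pi, 0).\<close>

lemma log_arg_Q_quadrant:
  assumes "z \<in> Q_quadrant"
  shows "- pi / 2 < Im (log_arg z)" "Im (log_arg z) < 0"
proof -
  define v where "v = 1 + 2 / (z\<^sup>2 - 2)"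
  have v: "Im v < 0" using Q_quadrant_power2(2)[OF assms] by (simp add: v_def)
  then have v0: "v \<noteq> 0" by auto
  have "Im (Ln v) > - pi" "Im (Ln v) \<le> pi" using mpi_less_Im_Ln[OF v0] Im_Ln_le_pi[OF v0] by auto
  moreover have "\<not> 0 \<le> Im (Ln v)" using Im_Ln_pos_le[OF v0] \<open>Im (Ln v) \<le> pi\<close> v by auto
  ultimately show "- pi / 2 < Im (log_arg z)" "Im (log_arg z) < 0"
    by (simp_all add: log_arg_def v_def)
qed

lemma Q_quadrant_eq: "Q_quadrant = {z. Re z > 0} \<inter> {z. Im z > 0}"
  by (auto simp: Q_quadrant_def)

lemma open_Q_quadrant: "open Q_quadrant"
  unfolding Q_quadrant_eq by (intro open_Int open_halfspace_Re_gt open_halfspace_Im_gt)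

lemma connected_Q_quadrant: "connected Q_quadrant"
  unfolding Q_quadrant_eq
  by (intro convex_connected convex_Int convex_halfspace_Re_gt convex_halfspace_Im_gt)

lemma log_arg_holomorphic: "log_arg holomorphic_on Q_quadrant"
proof -
  have "z\<^sup>2 - 2 \<noteq> 0 \<and> 1 + 2 / (z\<^sup>2 - 2) \<notin> \<real>\<^sub>\<le>\<^sub>0" if "z \<in> Q_quadrant" for z
  proof -
    have "z\<^sup>2 - 2 \<noteq> 0" using Q_quadrant_power2(1)[OF that] by auto
    moreover have "1 + 2 / (z\<^sup>2 - 2) \<notin> \<real>\<^sub>\<le>\<^sub>0"
      using Q_quadrant_power2(2)[OF that] unfolding complex_nonpos_Reals_iff by linarith
    ultimately show ?thesis by blast
  qed
  then show ?thesis unfolding log_arg_def[abs_def] by (intro holomorphic_intros) auto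
qed

section \<open>The generating function at complex arguments\<close>

definition V_gf :: "complex \<Rightarrow> complex" where
  "V_gf x = (\<Sum>n. of_real (V_poly n 1) * x ^ n)"

definition V_gf_radius :: real where
  "V_gf_radius = (1 - exp (- 2 * T0_fun 0)) / 2"

lemma V_gf_radius: "0 < V_gf_radius" "V_gf_radius < 1 / 2" "V_gf_radius = 1 / supp_radius\<^sup>2"
proof -
  have "T0_fun 0 > 0" by (simp add: T0_fun_0)
  then show "0 < V_gf_radius" by (simp add: V_gf_radius_def)
  have "exp (- 2 * T0_fun 0) > 0" by simp
  then show "V_gf_radius < 1 / 2" unfolding V_gf_radius_def by simp
  show "V_gf_radius = 1 / supp_radius\<^sup>2" by (simp only: V_gf_radius_def inverse_supp_radius_power2)
qed

lemma V_gf_sums: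
  assumes "norm x < V_gf_radius"
  shows "(\<lambda>n. of_real (V_poly n 1) * x ^ n) sums V_gf x"
proof -
  obtain y where y: "norm x < y" "y < V_gf_radius" using assms dense by blast
  then have y0: "0 < y" using norm_ge_zero[of x] by linarith
  have S: "summable (\<lambda>n. V_poly n 1 * y ^ n)"
    using y y0 by (intro V_poly_series) (auto simp: V_gf_radius_def)
  have le: "norm (complex_of_real (V_poly n 1) * x ^ n) \<le> V_poly n 1 * y ^ n" for n
  proof -
    have "norm x ^ n \<le> y ^ n" using y by (intro power_mono) auto
    then show ?thesis using V_poly_nonneg[of 1 n] by (simp add: norm_mult norm_power mult_left_mono)
  qed
  have "summable (\<lambda>n. complex_of_real (V_poly n 1) * x ^ n)"
    by (rule summable_comparison_test'[OF S le])
  then show ?thesis unfolding V_gf_def by (rule summable_sums)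
qed

lemma V_gf_holomorphic: "V_gf holomorphic_on ball 0 V_gf_radius"
  by (rule power_series_holomorphic[where a = "\<lambda>n. of_real (V_poly n 1)"]) (simp add: V_gf_sums)

lemma V_gf_0: "V_gf 0 = 1"
  using sums_unique[OF V_gf_sums[of 0]] powser_zero[of "\<lambda>n. complex_of_real (V_poly n 1)"] V_gf_radius(1)
  by (simp add: V_gf_def)

lemma V_gf_of_real:
  assumes "0 < x" "x < V_gf_radius"
  obtains a where "V_gf (of_real x) = of_real a" "a > 0" "T0_fun (1 / a) = - ln (1 - 2 * x) / 2"
proof
  have x: "0 < x" "x < (1 - exp (- 2 * T0_fun 0)) / 2" using assms by (simp_all add: V_gf_radius_def)
  note V = V_poly_series[OF x]
  show "V_gf (of_real x) = of_real (\<Sum>n. V_poly n 1 * x ^ n)"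
    unfolding V_gf_def using suminf_of_real[OF V(1), where ?'a = complex] by simp
  show "(\<Sum>n. V_poly n 1 * x ^ n) > 0" "T0_fun (1 / (\<Sum>n. V_poly n 1 * x ^ n)) = - ln (1 - 2 * x) / 2"
    by (rule V)+
qed

text \<open>The real identity of \<open>V_poly_series\<close> holds on an interval accumulating at
  the interior point 0, so the identity theorem extends it to complex x. The radius is small enough
  to keep 1 / \<open>V_gf x\<close> near 1, where \<open>right_chart_near_1\<close> applies.\<close>

lemma T_chart_V_gf:
  obtains r where "0 < r" "r \<le> V_gf_radius"
    "\<And>x. norm x < r \<Longrightarrow> Re (1 / V_gf x) > 1 / 2 \<and> T_chart (right_chart (1 / V_gf x)) = - Ln (1 - 2 * x) / 2
       \<and> (Im (T_chart (right_chart (1 / V_gf x))) < 0 \<longrightarrow> right_chart (1 / V_gf x) \<in> chart_domain)"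
proof -
  obtain r0 where r0: "r0 > 0" "r0 \<le> 1 / 2"
    "\<And>u. dist u 1 < r0 \<Longrightarrow> Im u > 0 \<Longrightarrow> right_chart u \<in> chart_domain"
    "\<And>u. dist u 1 < r0 \<Longrightarrow> Im u \<le> 0 \<Longrightarrow> Im (T_chart (right_chart u)) \<ge> 0"
    by (rule right_chart_near_1) blast
  have "isCont V_gf 0"
    using holomorphic_on_imp_continuous_on[OF V_gf_holomorphic] V_gf_radius(1)
    by (simp add: continuous_on_eq_continuous_at)
  then have "isCont (\<lambda>x. 1 / V_gf x) 0" by (intro continuous_intros) (simp_all add: V_gf_0)
  then obtain r1 where r1: "r1 > 0" "\<And>x. dist x 0 < r1 \<Longrightarrow> dist (1 / V_gf x) (1 / V_gf 0) < r0"
    unfolding continuous_at_eps_delta using r0(1) by blast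
  define r where "r = min r1 V_gf_radius"
  have r: "0 < r" "r \<le> r1" "r \<le> V_gf_radius" using r1 V_gf_radius by (simp_all add: r_def)
  have near: "dist (1 / V_gf x) 1 < r0" if "norm x < r" for x
    using r1(2)[of x] that r by (simp add: V_gf_0)
  have Re: "Re (1 / V_gf x) > 1 / 2" if "norm x < r" for x
  proof -
    have "norm (1 / V_gf x - 1) < 1 / 2" using near[OF that] r0(2) by (simp only: dist_norm)
    then show ?thesis using abs_Re_le_cmod[of "1 / V_gf x - 1"] unfolding minus_complex.sel one_complex.sel by linarith
  qed
  have ne: "V_gf x \<noteq> 0" if "norm x < r" for x
    using Re[OF that] by auto
  define h where "h x = T_chart (right_chart (1 / V_gf x)) - - Ln (1 - 2 * x) / 2" for x
  have "h holomorphic_on ball 0 r"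
  proof -
    have "(\<lambda>x. 1 / V_gf x) holomorphic_on ball 0 r"
      by (intro holomorphic_intros holomorphic_on_subset[OF V_gf_holomorphic]) (use r ne in auto)
    moreover have "(\<lambda>u. T_chart (right_chart u)) holomorphic_on {u. Re u > 1 / 2}"
      unfolding holomorphic_on_open[OF open_halfspace_Re_gt]
      using has_field_derivative_T_right_chart by blast
    ultimately have "(\<lambda>u. T_chart (right_chart u)) \<circ> (\<lambda>x. 1 / V_gf x) holomorphic_on ball 0 r"
      by (rule holomorphic_on_compose_gen) (use Re in auto)
    then have a: "(\<lambda>x. T_chart (right_chart (1 / V_gf x))) holomorphic_on ball 0 r" by (simp add: o_def)
    have "1 - 2 * x \<notin> \<real>\<^sub>\<le>\<^sub>0" if "norm x < r" for x :: complex
      using that r V_gf_radius(2) complex_Re_le_cmod[of x] by (auto simp: complex_nonpos_Reals_iff)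
    then show ?thesis unfolding h_def[abs_def] by (intro holomorphic_intros a) auto
  qed
  then have h0: "h x = 0" if "norm x < r" for x
  proof (rule analytic_continuation[where U = "complex_of_real ` {0<..<r}" and \<xi> = 0])
    show "0 islimpt complex_of_real ` {0<..<r}"
      unfolding islimpt_approachable
    proof (intro allI impI)
      fix e :: real assume "e > 0"
      then obtain m where "0 < m" "m < min e r" using r(1) dense[of 0 "min e r"] by auto
      then show "\<exists>x'\<in>complex_of_real ` {0<..<r}. x' \<noteq> 0 \<and> dist x' 0 < e"
        by (intro bexI[of _ "of_real m"] imageI) auto
    qed
    fix x assume "x \<in> complex_of_real ` {0<..<r}"
    then obtain t where t: "x = of_real t" "0 < t" "t < r" by auto
    then obtain a where a: "V_gf (of_real t) = of_real a" "a > 0" "T0_fun (1 / a) = - ln (1 - 2 * t) / 2"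
      using V_gf_of_real[of t] r by (metis order_less_le_trans)
    have e: "1 / V_gf x = of_real (1 / a)" by (simp add: t a)
    have "norm x < r" using t by simp
    then have "1 / a > 1 / 2" using Re[of x] unfolding e by (simp only: Re_complex_of_real)
    then have "T_chart (right_chart (1 / V_gf x)) = of_real (- ln (1 - 2 * t) / 2)"
      unfolding e a(3)[symmetric] by (rule T_right_chart_of_real)
    moreover have "Ln (1 - 2 * x) = of_real (ln (1 - 2 * t))"
    proof -
      have "1 - 2 * t > 0" using t r V_gf_radius(2) by linarith
      moreover have "1 - 2 * x = of_real (1 - 2 * t)" by (simp add: t)
      ultimately show ?thesis by (simp only: Ln_of_real)
    qed
    ultimately show "h x = 0" by (simp add: h_def)
  qed (use r that in auto)
  show thesis
  proof (rule that[OF r(1,3)], intro conjI impI)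
    fix x :: complex assume x: "norm x < r"
    show "Re (1 / V_gf x) > 1 / 2" by (rule Re[OF x])
    show "T_chart (right_chart (1 / V_gf x)) = - Ln (1 - 2 * x) / 2" using h0[OF x] by (simp only: h_def right_minus_eq)
    assume "Im (T_chart (right_chart (1 / V_gf x))) < 0"
    then show "right_chart (1 / V_gf x) \<in> chart_domain"
      using r0(3,4)[OF near[OF x]] by fastforce
  qed
qed

section \<open>The identity for F in the quadrant and on its boundary\<close>

context
  fixes M :: "real measure" and T :: "complex \<Rightarrow> complex"
  assumes M: "standard_V_monotone_gaussian M" and T: "is_T_extension T"
begin

definition F_quotient :: "complex \<Rightarrow> complex" where
  "F_quotient z = 1 / (z * cauchy_stieltjes M z)"

lemma F_quotient_eq_V_gf:
  assumes z: "norm z > supp_radius"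
  shows "F_quotient z = 1 / V_gf (1 / z\<^sup>2)"
proof -
  have z0: "z \<noteq> 0" using z supp_radius_pos by auto
  have "supp_radius\<^sup>2 < (norm z)\<^sup>2"
    using z supp_radius_pos by (intro power_strict_mono) auto
  then have "norm (1 / z\<^sup>2) < V_gf_radius"
    unfolding V_gf_radius(3) using supp_radius_pos by (simp add: norm_divide norm_power frac_less2)
  from V_gf_sums[OF this]
  have "(\<lambda>n. 1 / z * (of_real (V_poly n 1) * (1 / z\<^sup>2) ^ n)) sums (1 / z * V_gf (1 / z\<^sup>2))"
    by (rule sums_mult)
  moreover have "1 / z * (of_real (V_poly n 1) * (1 / z\<^sup>2) ^ n) = of_real (V_poly n 1) / z ^ (2 * n + 1)" for n
    by (simp add: power_one_over power_mult)
  ultimately have "cauchy_stieltjes M z = 1 / z * V_gf (1 / z\<^sup>2)"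
    using cauchy_stieltjes_sums[OF M z] sums_unique2 by (simp only:)
  then show ?thesis using z0 by (simp add: F_quotient_def)
qed

text \<open>It is not known beforehand that F(z) / z stays in \<open>Delta_domain\<close>. Instead
  the candidate u_chart (g (log_arg z)), with g the inverse of \<open>T_chart\<close>, is
  holomorphic on the whole quadrant and lies in \<open>Delta_domain\<close> by construction; it
  equals \<open>F_quotient\<close> for large z, hence everywhere.\<close>

lemma F_quotient_Q_quadrant:
  assumes z: "z \<in> Q_quadrant"
  shows "F_quotient z \<in> Delta_domain" "T (F_quotient z) = log_arg z"
proof -
  have hol: "T_chart holomorphic_on chart_domain"
    by (rule holomorphic_on_subset[OF T_chart_holomorphic_right]) (auto simp: chart_domain_def)
  obtain g where g: "g holomorphic_on (T_chart ` chart_domain)" "\<And>d. d \<in> chart_domain \<Longrightarrow> g (T_chart d) = d"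
    using holomorphic_has_inverse[OF hol open_chart_domain inj_on_T_chart] by metis
  have im: "log_arg y \<in> T_chart ` chart_domain" if "y \<in> Q_quadrant" for y
    unfolding T_chart_image using log_arg_Q_quadrant[OF that] by simp
  have g_im: "g (log_arg y) \<in> chart_domain" "T_chart (g (log_arg y)) = log_arg y"
    if "y \<in> Q_quadrant" for y
    using im[OF that] g(2) by auto
  obtain r where r: "0 < r" "r \<le> V_gf_radius"
    "\<And>x. norm x < r \<Longrightarrow> Re (1 / V_gf x) > 1 / 2 \<and> T_chart (right_chart (1 / V_gf x)) = - Ln (1 - 2 * x) / 2
       \<and> (Im (T_chart (right_chart (1 / V_gf x))) < 0 \<longrightarrow> right_chart (1 / V_gf x) \<in> chart_domain)"
    by (rule T_chart_V_gf) blast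
  \<comment> \<open>Beyond B the expansion at infinity holds and x = \<open>1 / z\<^sup>2\<close>
    satisfies |x| < r.\<close>
  define B where "B = max supp_radius (1 / sqrt r)"
  define S where "S = Q_quadrant \<inter> {z. norm z > B}"
  have near: "u_chart (g (log_arg y)) = F_quotient y" if y: "y \<in> S" for y
  proof -
    have yQ: "y \<in> Q_quadrant" and yB: "norm y > supp_radius" "norm y > 1 / sqrt r"
      using y by (auto simp: S_def B_def)
    define x where "x = 1 / y\<^sup>2"
    have y0: "y \<noteq> 0" using yB supp_radius_pos by auto
    have "(1 / sqrt r)\<^sup>2 < (norm y)\<^sup>2"
      using yB(2) r(1) by (intro power_strict_mono) auto
    then have "1 / r < (norm y)\<^sup>2" using r(1) by (simp add: power_divide)
    then have x: "norm x < r" using r(1) y0 by (simp add: x_def norm_divide norm_power field_simps)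
    have y2: "y\<^sup>2 - 2 \<noteq> 0" using Q_quadrant_power2(1)[OF yQ] by auto
    have "1 - 2 * x = inverse (1 + 2 / (y\<^sup>2 - 2))"
      using y0 y2 by (simp add: x_def field_simps)
    moreover have "1 + 2 / (y\<^sup>2 - 2) \<notin> \<real>\<^sub>\<le>\<^sub>0"
      using Q_quadrant_power2(2)[OF yQ] unfolding complex_nonpos_Reals_iff by linarith
    ultimately have "Ln (1 - 2 * x) = - Ln (1 + 2 / (y\<^sup>2 - 2))" by (simp only: Ln_inverse not_False_eq_True)
    then have w: "- Ln (1 - 2 * x) / 2 = log_arg y" by (simp add: log_arg_def)
    have Uy: "F_quotient y = 1 / V_gf x" unfolding x_def by (rule F_quotient_eq_V_gf[OF yB(1)])
    have Re: "Re (F_quotient y) > 1 / 2" and Tr: "T_chart (right_chart (F_quotient y)) = log_arg y"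
      and dom: "Im (T_chart (right_chart (F_quotient y))) < 0 \<longrightarrow> right_chart (F_quotient y) \<in> chart_domain"
      using r(3)[OF x] unfolding Uy w by blast+
    have "right_chart (F_quotient y) \<in> chart_domain" using dom log_arg_Q_quadrant(2)[OF yQ] by (simp add: Tr)
    then have "g (log_arg y) = right_chart (F_quotient y)" using g(2) Tr by metis
    then show ?thesis using u_chart_right_chart[OF Re] by simp
  qed
  have "u_chart (g (log_arg z)) = F_quotient z"
  proof (rule analytic_continuation_open[where s = S and s' = Q_quadrant
        and f = "\<lambda>z. u_chart (g (log_arg z))" and g = F_quotient])
    show "open S" unfolding S_def
      by (intro open_Int open_Q_quadrant open_Collect_less continuous_intros)
    have "B > 0" using supp_radius_pos by (simp add: B_def less_max_iff_disj)
    then have "Complex (B + 1) (B + 1) \<in> S"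
      using complex_Re_le_cmod[of "Complex (B + 1) (B + 1)"] by (simp add: S_def Q_quadrant_def)
    then show "S \<noteq> {}" by blast
    have "g \<circ> log_arg holomorphic_on Q_quadrant"
      by (rule holomorphic_on_compose_gen[OF log_arg_holomorphic g(1)]) (use im in auto)
    then have "u_chart \<circ> (g \<circ> log_arg) holomorphic_on Q_quadrant"
      by (rule holomorphic_on_compose_gen[OF _ u_chart_holomorphic])
        (use g_im chart_domain_exp_neq_1 in auto)
    then show "(\<lambda>z. u_chart (g (log_arg z))) holomorphic_on Q_quadrant" by (simp add: o_def)
    have "cauchy_stieltjes M holomorphic_on Q_quadrant"
      by (rule holomorphic_on_subset[OF cauchy_stieltjes_holomorphic[OF M]])
        (auto simp: Q_quadrant_def dest!: notin_supp_segment_of_Im[OF less_imp_neq[THEN not_sym]])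
    moreover have "z * cauchy_stieltjes M z \<noteq> 0" if "z \<in> Q_quadrant" for z
      using that cauchy_stieltjes_nonzero[OF M, of z] notin_supp_segment_of_Im[of z]
      by (auto simp: Q_quadrant_def)
    ultimately show "F_quotient holomorphic_on Q_quadrant"
      unfolding F_quotient_def[abs_def] by (intro holomorphic_intros) auto
  qed (use z near open_Q_quadrant connected_Q_quadrant in \<open>auto simp: S_def\<close>)
  then show "F_quotient z \<in> Delta_domain" "T (F_quotient z) = log_arg z"
    using g_im[OF z] T_u_chart[OF T g_im(1)[OF z]] unfolding Delta_domain_eq by (metis imageI)+
qed

text \<open>z is approached along the diagonal direction 1 + i, which enters the quadrant from
  either boundary ray. The limit lies in the closure of \<open>Delta_domain\<close>, and being real
  it is not \<open>u0\<close>.\<close>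

lemma F_quotient_boundary:
  assumes z: "z \<notin> supp_segment" "Im z \<ge> 0" "Re z \<ge> 0" "z \<noteq> 0"
    and real: "Im (F_quotient z) = 0" and pos: "z\<^sup>2 - 2 \<noteq> 0" "1 + 2 / (z\<^sup>2 - 2) \<notin> \<real>\<^sub>\<le>\<^sub>0"
  shows "F_quotient z \<in> T_domain" "T (F_quotient z) = log_arg z"
proof -
  define y where "y n = z + (1 + \<i>) * of_real (1 / real (Suc n))" for n
  have yQ: "y n \<in> Q_quadrant" for n
    using z by (simp add: y_def Q_quadrant_def add_nonneg_pos)
  have "(\<lambda>n. complex_of_real (1 / real (Suc n))) \<longlonglongrightarrow> of_real 0"
    by (intro tendsto_of_real LIMSEQ_Suc lim_1_over_n)
  then have "y \<longlonglongrightarrow> z + (1 + \<i>) * of_real 0"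
    unfolding y_def by (intro tendsto_add[OF tendsto_const] tendsto_mult[OF tendsto_const])
  then have yz: "y \<longlonglongrightarrow> z" by simp
  have "isCont (cauchy_stieltjes M) z"
    using cauchy_stieltjes_has_field_derivative[OF M z(1)] by (rule DERIV_isCont)
  then have "isCont F_quotient z"
    unfolding F_quotient_def using z cauchy_stieltjes_nonzero[OF M z(1,2)] by (intro continuous_intros) auto
  then have Ul: "(\<lambda>n. F_quotient (y n)) \<longlonglongrightarrow> F_quotient z" using yz by (rule isCont_tendsto_compose)
  then have "F_quotient z \<in> closure Delta_domain"
    unfolding closure_sequential using F_quotient_Q_quadrant(1)[OF yQ] by (intro exI[of _ "\<lambda>n. F_quotient (y n)"]) auto
  moreover have "F_quotient z \<noteq> u0" using real by auto
  ultimately show dom: "F_quotient z \<in> T_domain" by (simp add: T_domain_def)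
  have "F_quotient (y n) \<in> T_domain" for n
    using F_quotient_Q_quadrant(1)[OF yQ] Delta_domain_subset by blast
  then have "(\<lambda>n. T (F_quotient (y n))) \<longlonglongrightarrow> T (F_quotient z)"
    by (intro continuous_on_tendsto_compose[OF T_continuous[OF T] Ul dom] always_eventually allI)
  then have "(\<lambda>n. log_arg (y n)) \<longlonglongrightarrow> T (F_quotient z)" using F_quotient_Q_quadrant(2)[OF yQ] by simp
  moreover have "isCont log_arg z"
    unfolding log_arg_def using pos by (intro continuous_intros) auto
  then have "(\<lambda>n. log_arg (y n)) \<longlonglongrightarrow> log_arg z" using yz by (rule isCont_tendsto_compose)
  ultimately show "T (F_quotient z) = log_arg z" using LIMSEQ_unique by blast
qed

lemma recip_eq:
  assumes "z \<noteq> 0" "F_quotient z \<in> T_domain" "T (F_quotient z) = log_arg z"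
  shows "recip_cauchy_stieltjes M z = z * T_inverse T (log_arg z)"
  using T_inverse_eq[OF T assms(2)] assms by (simp add: F_quotient_def recip_cauchy_stieltjes_def)

lemma recip_boundary:
  assumes z: "z \<notin> supp_segment" "Im z \<ge> 0" "Re z \<ge> 0" "z \<noteq> 0"
    and real: "Im (F_quotient z) = 0" and v: "1 + 2 / (z\<^sup>2 - 2) = of_real v" "v > 0" "z\<^sup>2 - 2 \<noteq> 0"
  shows "log_arg z \<in> T_strip" "recip_cauchy_stieltjes M z = z * T_inverse T (log_arg z)"
proof -
  have "log_arg z = of_real (1 / 2 * ln v)" unfolding log_arg_def v(1) using v(2) by (simp add: Ln_of_real)
  then have "Im (log_arg z) = 0" by (simp only: Im_complex_of_real)
  then show "log_arg z \<in> T_strip" by (simp add: T_strip_def)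
  have "1 + 2 / (z\<^sup>2 - 2) \<notin> \<real>\<^sub>\<le>\<^sub>0" unfolding v(1) using v(2) by (simp add: complex_nonpos_Reals_iff)
  from F_quotient_boundary[OF z real v(3) this] show "recip_cauchy_stieltjes M z = z * T_inverse T (log_arg z)"
    by (intro recip_eq z)
qed

text \<open>The boundary rays reduce to realness of F(z) / z: on the imaginary axis the reflection
  makes F purely imaginary, on the real axis conjugation makes the transform real.\<close>

lemma recip_formula:
  assumes "z \<in> Q_quadrant \<union> {\<i> * of_real y | y. y > 0} \<union> of_real ` {supp_radius<..}"
  shows "log_arg z \<in> T_strip \<and> recip_cauchy_stieltjes M z = z * T_inverse T (log_arg z)"
proof -
  consider "z \<in> Q_quadrant" | y where "z = \<i> * of_real y" "y > 0" | x where "z = of_real x" "x > supp_radius"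
    using assms by auto
  then show ?thesis
  proof cases
    case 1
    then have "z \<noteq> 0" by (auto simp: Q_quadrant_def)
    then show ?thesis
      using log_arg_Q_quadrant[OF 1] F_quotient_Q_quadrant[OF 1] Delta_domain_subset
      by (auto simp: T_strip_def intro!: recip_eq)
  next
    case 2
    have zK: "z \<notin> supp_segment" using 2 by (intro notin_supp_segment_of_Im) simp
    have "- cnj z = z" using 2 by simp
    then have "recip_cauchy_stieltjes M z = - cnj (recip_cauchy_stieltjes M z)"
      using recip_cauchy_stieltjes_reflect[OF M zK] by simp
    then have "Re (recip_cauchy_stieltjes M z) = 0" by (simp add: complex_eq_iff)
    moreover have "F_quotient z = recip_cauchy_stieltjes M z / z" by (simp add: F_quotient_def recip_cauchy_stieltjes_def)
    ultimately have real: "Im (F_quotient z) = 0" using 2 by (simp add: Im_divide)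
    have z2: "z\<^sup>2 - 2 = of_real (- (y\<^sup>2 + 2))" using 2 by (simp add: power_mult_distrib)
    have y2: "y\<^sup>2 + 2 > 0" using zero_le_power2[of y] by linarith
    have "1 + 2 / complex_of_real r = of_real (1 + 2 / r)" for r by simp
    then have "1 + 2 / (z\<^sup>2 - 2) = of_real (1 + 2 / - (y\<^sup>2 + 2))" unfolding z2 by blast
    moreover have "2 / (y\<^sup>2 + 2) < 1" using 2 y2 by (simp add: divide_less_eq)
    then have "1 + 2 / - (y\<^sup>2 + 2) > 0" unfolding divide_minus_right by linarith
    moreover have "z\<^sup>2 - 2 \<noteq> 0" unfolding z2 of_real_eq_0_iff using y2 by simp
    moreover have "Im z \<ge> 0" "Re z \<ge> 0" "z \<noteq> 0" using 2 by auto
    ultimately show ?thesis using recip_boundary[OF zK _ _ _ real] by blast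
  next
    case 3
    have x0: "x > 0" using 3 supp_radius_pos by simp
    have zK: "z \<notin> supp_segment" using 3 x0 by (intro notin_supp_segment_of_norm) simp
    have "cnj z = z" using 3 by simp
    then have "cauchy_stieltjes M z = cnj (cauchy_stieltjes M z)"
      using cauchy_stieltjes_cnj[OF M, of z] by simp
    then have "Im (cauchy_stieltjes M z) = 0" by (simp add: complex_eq_iff)
    then have real: "Im (F_quotient z) = 0" using 3 by (simp add: F_quotient_def Im_divide)
    have z2: "z\<^sup>2 - 2 = of_real (x\<^sup>2 - 2)" using 3 by simp
    have "supp_radius\<^sup>2 < x\<^sup>2" using 3 supp_radius_pos by (intro power_strict_mono) auto
    then have x2: "x\<^sup>2 - 2 > 0" using gamma0_pos unfolding supp_radius_power2 by linarith
    have "1 + 2 / (z\<^sup>2 - 2) = of_real (1 + 2 / (x\<^sup>2 - 2))" unfolding z2 by simp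
    moreover have "1 + 2 / (x\<^sup>2 - 2) > 0" using x2 by (intro add_pos_pos divide_pos_pos) auto
    moreover have "z\<^sup>2 - 2 \<noteq> 0" unfolding z2 of_real_eq_0_iff using x2 by simp
    moreover have "Im z \<ge> 0" "Re z \<ge> 0" "z \<noteq> 0" using 3 x0 by auto
    ultimately show ?thesis using recip_boundary[OF zK _ _ _ real] by blast
  qed
qed

end

text \<open>Division by 0 and \<open>the_inv_into\<close> are total in HOL. The first conjunct and
  the membership in \<open>T_strip\<close> make sure that the formulas speak about genuine
  values.\<close>

theorem theorem5p1:
  fixes \<mu> :: "real measure" and T :: "complex \<Rightarrow> complex"
  assumes "standard_V_monotone_gaussian \<mu>"
    and "is_T_extension T"
  shows "(\<forall>z \<in> {z. Im z \<ge> 0} - of_real ` {- sqrt (2 + gamma0) .. sqrt (2 + gamma0)}.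
            z \<notin> of_real ` measure_supp \<mu> \<and> cauchy_stieltjes \<mu> z \<noteq> 0)
    \<and> (\<forall>z \<in> Q_quadrant \<union> {\<i> * of_real y | y. y > 0} \<union> of_real ` {sqrt (2 + gamma0) <..}.
          (1 / 2) * Ln (1 + 2 / (z\<^sup>2 - 2)) \<in> T_strip
          \<and> recip_cauchy_stieltjes \<mu> z = z * T_inverse T ((1 / 2) * Ln (1 + 2 / (z\<^sup>2 - 2))))
    \<and> (\<forall>z \<in> {z. Im z \<ge> 0} - of_real ` {- sqrt (2 + gamma0) .. sqrt (2 + gamma0)}.
          Re z < 0 \<longrightarrow> recip_cauchy_stieltjes \<mu> z = - cnj (recip_cauchy_stieltjes \<mu> (- cnj z)))"
  unfolding supp_radius_def[symmetric] supp_segment_def[symmetric] log_arg_def[symmetric]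
proof (intro conjI ballI impI)
  fix z assume z: "z \<in> {z. Im z \<ge> 0} - supp_segment"
  show "z \<notin> of_real ` measure_supp \<mu>"
  proof
    assume "z \<in> of_real ` measure_supp \<mu>"
    then obtain x where x: "z = of_real x" "x \<in> measure_supp \<mu>" by blast
    then have "\<not> \<bar>x\<bar> > supp_radius" using notin_measure_supp[OF assms(1)] by blast
    then have "x \<in> {- supp_radius..supp_radius}" by (simp add: abs_le_iff not_less)
    then show False using z x(1) by (auto simp: supp_segment_def)
  qed
  show "cauchy_stieltjes \<mu> z \<noteq> 0" using cauchy_stieltjes_nonzero[OF assms(1)] z by simp
next
  fix z assume "z \<in> Q_quadrant \<union> {\<i> * of_real y | y. y > 0} \<union> of_real ` {supp_radius<..}"
  from recip_formula[OF assms this]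
  show "log_arg z \<in> T_strip" "recip_cauchy_stieltjes \<mu> z = z * T_inverse T (log_arg z)" by auto
next
  fix z assume "z \<in> {z. Im z \<ge> 0} - supp_segment"
  then show "recip_cauchy_stieltjes \<mu> z = - cnj (recip_cauchy_stieltjes \<mu> (- cnj z))"
    using recip_cauchy_stieltjes_reflect[OF assms(1)] by simp
qed

end
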